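(* Assume hypotheses (H1) and (H2) of the context, that $\beta\in(\frac12,1)$, and that $\mu(y\in Y:\varphi(y)>n)=c(n^{-\beta}+H(n))$, where $H(n)=O(n^{-2\beta})$ and $c>0$. Let $\gamma=\min\{1-\beta,\beta-\frac12\}$. Then, in the operator norm on $\mathcal{B}$, $$n^{1-\beta}T_n=c^{-1}d_\beta P+O(n^{-\gamma}).$$ Moreover, if $\beta\in(\frac34,1)$, then $\lim_{n\to\infty}n^{1-\beta}\{n^{1-\beta}T_n-c^{-1}d_\beta P\}=c^{-1}d_{\beta,1}P$.
   Context: Setting. $(X,\mu)$ is an infinite measure space, $f:X\to X$ a conservative measure preserving map, $Y\subset X$ measurable with $\mu(Y)\in(0,\infty)$, and $\mu$ is rescaled so that $\mu(Y)=1$. Let $\varphi:Y\to\mathbb{Z}^+$, $\varphi(y)=\inf\{n\ge1:f^ny\in Y\}$ (finite a.e.), and $F=f^\varphi:Y\to Y$ the first return map. Let $L:L^1(X)\to L^1(X)$ and $R:L^1(Y)\to L^1(Y)$ be the transfer operators of $f$ and $F$: $\int_XLv\,w\,d\mu=\int_Xv\,w\circ f\,d\mu$ and $\int_YRv\,w\,d\mu=\int_Yv\,w\circ F\,d\mu$ for bounded measurable $w$. For $v$ on $Y$ set $T_nv=1_YL^n(1_Yv)$ ($n\ge0$), $R_nv=R(1_{\{\varphi=n\}}v)$ ($n\ge1$), and $R(z)v=R(z^\varphi v)=\sum_{n\ge1}z^nR_nv$ for $z\in\bar{\mathbb{D}}=\{z\in\mathbb{C}:|z|\le1\}$. $\mathcal{B}\subset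 L^\infty(Y)$ is a (real) Banach space of functions containing the constants with norm satisfying $|v|_\infty\le\|v\|$ (complexified when $z$ is complex), such that: (H1) there is $C>0$ such that for all $n\ge1$, $R_n:\mathcal{B}\to\mathcal{B}$ is bounded with $\|R_n\|\le C\mu(\varphi=n)$. (H2) (i) the eigenvalue $1$ is simple and isolated in the spectrum of $R(1):\mathcal{B}\to\mathcal{B}$; (ii) for $z\in\bar{\mathbb{D}}\setminus\{1\}$ the spectrum of $R(z):\mathcal{B}\to\mathcal{B}$ does not contain $1$. $P$ is the spectral projection of $R(1)$ for the eigenvalue $1$: $Pv\equiv\int_Yv\,d\mu$. Constants. $d_\beta=\frac1\pi\sin\beta\pi$. $H_1(x)=c^{-1}\mu(\varphi>x)-x^{-\beta}$ for $x>0$ (so $H_1(x)=[x]^{-\beta}-x^{-\beta}+H([x])$ for $x\ge1$), $c_H=\int_0^\infty H_1(x)\,dx$, $c_\beta=-i\int_0^\infty e^{i\sigma}\sigma^{-\beta}\,d\sigma$, $e_0=ic_H/c_\beta$, $\xi^-_p=\int_0^\infty e^{-i\sigma}\sigma^{-p}\,d\sigma$ for $0<p<1$ (improper integrals), and $d_{\beta,1}=\frac1\pi\mathrm{Re}\,(e_0\,\xi^-_{2\beta-1}/c_\beta)$. *)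

theory Defs
  imports "HOL-Probability.Essential_Supremum" "HOL-Library.Landau_Symbols"
begin

section \<open>Conservative measure preserving maps and first returns\<close>

definition measure_preserving_map :: "'a measure \<Rightarrow> ('a \<Rightarrow> 'a) \<Rightarrow> bool" where
  "measure_preserving_map M f \<longleftrightarrow> f \<in> measurable M M \<and> distr M M f = M"

(* Every wandering set is null. *)
definition conservative :: "'a measure \<Rightarrow> ('a \<Rightarrow> 'a) \<Rightarrow> bool" where
  "conservative M f \<longleftrightarrow>
    (\<forall>W\<in>sets M. disjoint_family (\<lambda>n::nat. (f ^^ n) -` W \<inter> space M) \<longrightarrow> emeasure M W = 0)"

(* The infimum is taken in nat, so the value is 0 at points that never return to Y. If f is
   conservative and measure preserving, these points form a null subset of Y. *)
definition return_time :: "('a \<Rightarrow> 'a) \<Rightarrow> 'a set \<Rightarrow> 'a \<Rightarrow> nat" where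
  "return_time f Y y = Inf {n. n \<ge> 1 \<and> (f ^^ n) y \<in> Y}"

definition return_map :: "('a \<Rightarrow> 'a) \<Rightarrow> 'a set \<Rightarrow> 'a \<Rightarrow> 'a" where
  "return_map f Y y = (f ^^ return_time f Y y) y"

section \<open>Transfer operators\<close>

(* Elements of L^1 are represented by integrable functions; the duality relation determines
   A v up to a null set, so A is an arbitrary choice of representatives. *)
definition transfer_operator ::
    "'a measure \<Rightarrow> ('a \<Rightarrow> 'a) \<Rightarrow> (('a \<Rightarrow> real) \<Rightarrow> ('a \<Rightarrow> real)) \<Rightarrow> bool" where
  "transfer_operator N g A \<longleftrightarrow>
    (\<forall>v. integrable N v \<longrightarrow> integrable N (A v) \<and>
      (\<forall>w\<in>borel_measurable N. bounded (w ` space N) \<longrightarrow>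
        (\<integral>x. A v x * w x \<partial>N) = (\<integral>x. v x * w (g x) \<partial>N)))"

definition T_fun ::
    "(('a \<Rightarrow> real) \<Rightarrow> ('a \<Rightarrow> real)) \<Rightarrow> 'a set \<Rightarrow> nat \<Rightarrow> ('a \<Rightarrow> real) \<Rightarrow> 'a \<Rightarrow> real" where
  "T_fun L Y n v = (\<lambda>y. indicator Y y * (L ^^ n) (\<lambda>x. indicator Y x * v x) y)"

definition R_fun ::
    "(('a \<Rightarrow> real) \<Rightarrow> ('a \<Rightarrow> real)) \<Rightarrow> ('a \<Rightarrow> nat) \<Rightarrow> nat \<Rightarrow> ('a \<Rightarrow> real) \<Rightarrow> 'a \<Rightarrow> real" where
  "R_fun R \<phi> n v = R (\<lambda>y. indicator {y. \<phi> y = n} y * v y)"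

section \<open>Banach spaces of bounded functions\<close>

(* A Banach space contained in L^\<infinity>(N), with norm dominating the L^\<infinity> norm and containing the
   constants, is given by an abstract Banach space 'b and its inclusion e into L^\<infinity>(N): e v is
   a representative of the class of v, so e is linear and injective modulo null sets. *)
definition Linfty_subspace :: "'a measure \<Rightarrow> ('b::banach \<Rightarrow> 'a \<Rightarrow> real) \<Rightarrow> bool" where
  "Linfty_subspace N e \<longleftrightarrow>
    (\<forall>v. e v \<in> borel_measurable N) \<and>
    (\<forall>v. esssup N (\<lambda>y. ereal \<bar>e v y\<bar>) \<le> ereal (norm v)) \<and>
    (\<forall>u v. AE y in N. e (u + v) y = e u y + e v y) \<and>
    (\<forall>a v. AE y in N. e (a *\<^sub>R v) y = a * e v y) \<and>
    (\<forall>u v. (AE y in N. e u y = e v y) \<longrightarrow> u = v) \<and>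
    (\<forall>a. \<exists>v. AE y in N. e v y = a)"

(* The bounded operator S acts on the function space as the function-level operator A does. *)
definition realizes ::
    "'a measure \<Rightarrow> ('b::banach \<Rightarrow> 'a \<Rightarrow> real) \<Rightarrow> ('b \<Rightarrow>\<^sub>L 'b) \<Rightarrow> (('a \<Rightarrow> real) \<Rightarrow> 'a \<Rightarrow> real) \<Rightarrow> bool"
  where
  "realizes N e S A \<longleftrightarrow> (\<forall>v. AE y in N. e (S v) y = A (e v) y)"

section \<open>Complexification and spectrum\<close>

(* The complexification of 'b is 'b \<times> 'b, where (x, y) stands for x + i y. The product norm is
   equivalent to the usual complexification norms, and the spectrum, spectral projections and
   convergence of operators depend on the norm only up to equivalence. *)
lift_definition cscale :: "complex \<Rightarrow> ('b::real_normed_vector \<times> 'b) \<Rightarrow>\<^sub>L ('b \<times> 'b)" is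
  "\<lambda>z p. (Re z *\<^sub>R fst p - Im z *\<^sub>R snd p, Re z *\<^sub>R snd p + Im z *\<^sub>R fst p)"
  by (intro bounded_linear_Pair bounded_linear_sub bounded_linear_add
      bounded_linear_compose[OF bounded_linear_scaleR_right] bounded_linear_fst bounded_linear_snd)

lift_definition complexify ::
    "('b::real_normed_vector \<Rightarrow>\<^sub>L 'b) \<Rightarrow> ('b \<times> 'b) \<Rightarrow>\<^sub>L ('b \<times> 'b)" is
  "\<lambda>A p. (A (fst p), A (snd p))"
  by (intro bounded_linear_Pair bounded_linear_compose[OF _ bounded_linear_fst]
      bounded_linear_compose[OF _ bounded_linear_snd])

definition inverse_op :: "('v::real_normed_vector \<Rightarrow>\<^sub>L 'v) \<Rightarrow> ('v \<Rightarrow>\<^sub>L 'v) \<Rightarrow> bool" where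
  "inverse_op A B \<longleftrightarrow> A o\<^sub>L B = id_blinfun \<and> B o\<^sub>L A = id_blinfun"

definition op_spectrum :: "(('b::real_normed_vector \<times> 'b) \<Rightarrow>\<^sub>L ('b \<times> 'b)) \<Rightarrow> complex set" where
  "op_spectrum A = {\<zeta>. \<not> (\<exists>B. inverse_op (cscale \<zeta> - A) B)}"

definition resolvent ::
    "(('b::real_normed_vector \<times> 'b) \<Rightarrow>\<^sub>L ('b \<times> 'b)) \<Rightarrow> complex \<Rightarrow> ('b \<times> 'b) \<Rightarrow>\<^sub>L ('b \<times> 'b)" where
  "resolvent A \<xi> = (THE B. inverse_op (cscale \<xi> - A) B)"

(* Q = 1/(2 pi i) times the contour integral of the resolvent over a circle of radius r that
   separates \<zeta> from the rest of the spectrum, parametrized by \<xi> = \<zeta> + r exp(i t). *)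
definition spectral_projection ::
    "(('b::banach \<times> 'b) \<Rightarrow>\<^sub>L ('b \<times> 'b)) \<Rightarrow> complex \<Rightarrow> (('b \<times> 'b) \<Rightarrow>\<^sub>L ('b \<times> 'b)) \<Rightarrow> bool" where
  "spectral_projection A \<zeta> Q \<longleftrightarrow>
    (\<exists>r>0. cball \<zeta> r \<inter> op_spectrum A = {\<zeta>} \<and>
      Q = (1 / (2 * pi)) *\<^sub>R
        integral {0..2 * pi} (\<lambda>t. cscale (of_real r * cis t) o\<^sub>L resolvent A (\<zeta> + of_real r * cis t)))"

(* Algebraic multiplicity one: the range of the spectral projection is one-dimensional over the
   complex numbers. *)
definition simple_eigenvalue ::
    "(('b::banach \<times> 'b) \<Rightarrow>\<^sub>L ('b \<times> 'b)) \<Rightarrow> complex \<Rightarrow> bool" where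
  "simple_eigenvalue A \<zeta> \<longleftrightarrow>
    (\<exists>Q u. spectral_projection A \<zeta> Q \<and> u \<noteq> 0 \<and> blinfun_apply A u = cscale \<zeta> u \<and>
      range (blinfun_apply Q) = range (\<lambda>z. blinfun_apply (cscale z) u))"

(* R(z) = \<Sum>n\<ge>1. z^n R_n on the complexification *)
definition R_gen :: "(nat \<Rightarrow> 'b::banach \<Rightarrow>\<^sub>L 'b) \<Rightarrow> complex \<Rightarrow> ('b \<times> 'b) \<Rightarrow>\<^sub>L ('b \<times> 'b)" where
  "R_gen Rn z = (\<Sum>n. cscale (z ^ Suc n) o\<^sub>L complexify (Rn (Suc n)))"

section \<open>Constants\<close>

(* The integrals over (0, \<infinity>) are Henstock-Kurzweil integrals; on unbounded intervals these
   include conditionally convergent improper integrals. *)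

definition d_const :: "real \<Rightarrow> real" where
  "d_const \<beta> = (1 / pi) * sin (\<beta> * pi)"

definition c_const :: "real \<Rightarrow> complex" where
  "c_const \<beta> = - \<i> * integral {0<..} (\<lambda>\<sigma>::real. exp (\<i> * of_real \<sigma>) * of_real (\<sigma> powr - \<beta>))"

definition xi_minus :: "real \<Rightarrow> complex" where
  "xi_minus p = integral {0<..} (\<lambda>\<sigma>::real. exp (- \<i> * of_real \<sigma>) * of_real (\<sigma> powr - p))"

definition H1_fun :: "'a measure \<Rightarrow> 'a set \<Rightarrow> ('a \<Rightarrow> nat) \<Rightarrow> real \<Rightarrow> real \<Rightarrow> real \<Rightarrow> real" where
  "H1_fun M Y \<phi> c \<beta> x = (1 / c) * measure M {y \<in> Y. real (\<phi> y) > x} - x powr - \<beta>"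

definition cH_const :: "'a measure \<Rightarrow> 'a set \<Rightarrow> ('a \<Rightarrow> nat) \<Rightarrow> real \<Rightarrow> real \<Rightarrow> real" where
  "cH_const M Y \<phi> c \<beta> = integral {0<..} (H1_fun M Y \<phi> c \<beta>)"

definition e0_const :: "'a measure \<Rightarrow> 'a set \<Rightarrow> ('a \<Rightarrow> nat) \<Rightarrow> real \<Rightarrow> real \<Rightarrow> complex" where
  "e0_const M Y \<phi> c \<beta> = \<i> * of_real (cH_const M Y \<phi> c \<beta>) / c_const \<beta>"

definition d1_const :: "'a measure \<Rightarrow> 'a set \<Rightarrow> ('a \<Rightarrow> nat) \<Rightarrow> real \<Rightarrow> real \<Rightarrow> real" where
  "d1_const M Y \<phi> c \<beta> =
    (1 / pi) * Re (e0_const M Y \<phi> c \<beta> * xi_minus (2 * \<beta> - 1) / c_const \<beta>)"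

end

theory Submission
  imports Defs "HOL-Real_Asymp.Real_Asymp" "HOL-Probability.Probability_Measure"
begin

text \<open>Splitting the orbit of a point of \<open>Y\<close> at its first return gives the renewal equation
\<open>T\<^sub>n = (\<Sum>j=1..n. T\<^sub>n\<^sub>-\<^sub>j R\<^sub>j)\<close> for \<open>n \<ge> 1\<close>, so that formally
\<open>(\<Sum>n. z ^ n T\<^sub>n) = (I - R(z))\<^sup>-\<^sup>1\<close> for \<open>|z| < 1\<close>; write \<open>T(z)\<close> for the right-hand side.
The operators \<open>T\<^sub>n\<close> are studied as the Fourier coefficients of \<open>T\<close> on the circle of radius
\<open>1 - 1 / (n + 2)\<close>. Nothing is known in advance about the size, or even the existence, of \<open>T\<^sub>n\<close> as an
operator on the Banach space, so the power series is used only after pairing with a bounded function on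
\<open>Y\<close>: then all coefficients are bounded numbers, the renewal equation gives the generating function
(\<open>functional_generating_function\<close>), and since pairings separate the elements of the space, the Fourier
coefficients of \<open>T\<close>, which are bounded operators by construction, act as \<open>T\<^sub>n\<close> does
(\<open>T_op_functional\<close>, \<open>realizes_T_fun\<close>).

What matters is the behaviour of \<open>T(z)\<close> at the only singularity \<open>z = 1\<close>. For
\<open>r(z) = (\<Sum>n. z ^ n \<mu>(\<phi> = n))\<close> the assumption on the tails gives
\<open>1 - r(z) = c (\<Gamma>(1 - \<beta>) (1 - z)\<^sup>\<beta> + c\<^sub>H (1 - z)) + O(|1 - z|\<^sup>2\<^sup>\<beta>)\<close>
(\<open>one_minus_gf_expansion\<close>, \<open>cH_eq_suminf\<close>). By (H1), \<open>R\<close> is \<open>\<beta>\<close>-Hoelder on the closed disc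
(\<open>R_holder\<close>). If \<open>x = T(z) v\<close>, then \<open>x - P x\<close> is controlled by a reduced resolvent of \<open>R(1)\<close>, while the
integral of \<open>x\<close> satisfies a scalar equation with leading coefficient \<open>1 - r(z)\<close>; together this yields
\<open>T(z) = (1 - r(z))\<^sup>-\<^sup>1 P + O(1)\<close> near \<open>1\<close> (\<open>T_gen_near_1\<close>), and away from \<open>1\<close> the resolvent is bounded by
(H2) and compactness. A geometric series turns \<open>(1 - r(z))\<^sup>-\<^sup>1\<close> into a finite combination \<open>E(z)\<close> of the
powers \<open>(1 - z) powr (- \<beta> + k (1 - \<beta>))\<close> plus a bounded term (\<open>reciprocal_expansion\<close>).

So \<open>T(z) = E(z) P + S(z)\<close> with \<open>S\<close> bounded and
\<open>\<parallel>S(z') - S(z)\<parallel> \<le> C |z' - z|\<^sup>\<beta> |1 - z|\<^sup>-\<^sup>2\<^sup>\<beta>\<close> when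
\<open>|z' - z| \<le> |1 - z| / 2\<close> (\<open>T_reg_holder\<close>). Shifting the angle by \<open>\<pi> / n\<close> and
splitting the circle at distance \<open>n powr - (1/2)\<close> from \<open>1\<close> shows that the \<open>n\<close>-th Fourier coefficient of
such a function is \<open>O(n powr - (1/2))\<close> (\<open>fourier_coefficient_decay\<close>). The coefficients of \<open>E\<close> are
binomial coefficients; the terms \<open>k = 0\<close> and \<open>k = 1\<close> have orders \<open>n powr (\<beta> - 1)\<close> and
\<open>n powr (2 * \<beta> - 2)\<close>, and their constants agree with \<open>d_const \<beta> / c\<close> and \<open>d1_const / c\<close> by the reflection
formula and the evaluation of the oscillatory integrals (\<open>xi_minus_eq\<close>, \<open>d1_const_eq\<close>). The second term
dominates \<open>n powr - (1/2)\<close> precisely when \<open>\<beta> > 3/4\<close>, which explains both parts of the result.\<close>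

section \<open>Operators on the complexification\<close>

lemma blinfun_apply_cscale [simp]:
  "blinfun_apply (cscale z) p = (Re z *\<^sub>R fst p - Im z *\<^sub>R snd p, Re z *\<^sub>R snd p + Im z *\<^sub>R fst p)"
  by (simp add: cscale.rep_eq)

lemma blinfun_apply_complexify [simp]: "blinfun_apply (complexify A) p = (A (fst p), A (snd p))"
  by (simp add: complexify.rep_eq)

lemma cscale_1 [simp]: "cscale 1 = id_blinfun"
  by (rule blinfun_eqI) auto

lemma cscale_mult: "cscale (a * b) = cscale a o\<^sub>L cscale b"
  by (rule blinfun_eqI) (auto simp: algebra_simps)

lemma cscale_commute: "cscale a (cscale b x) = cscale b (cscale a x)"
  by (metis blinfun_apply_blinfun_compose cscale_mult mult.commute)

lemma cscale_of_real: "cscale (of_real a) = a *\<^sub>R id_blinfun"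
  by (rule blinfun_eqI) (auto simp: blinfun.bilinear_simps scaleR_prod_def)

text \<open>The constant 2 arises because the product norm is not invariant under rotations \<open>cis t\<close>; only
boundedness up to a fixed factor is ever used.\<close>

lemma norm_cscale_apply_le: "norm (blinfun_apply (cscale z) p) \<le> 2 * norm z * norm p"
proof -
  have "cscale z p = (Re z *\<^sub>R p) + (Im z *\<^sub>R (- snd p, fst p))"
    by (auto simp: scaleR_prod_def)
  also have "norm \<dots> \<le> norm (Re z *\<^sub>R p) + norm (Im z *\<^sub>R (- snd p, fst p))"
    by (rule norm_triangle_ineq)
  also have "norm (- snd p, fst p) = norm p"
    by (simp add: norm_prod_def add.commute)
  then have "norm (Re z *\<^sub>R p) + norm (Im z *\<^sub>R (- snd p, fst p)) = \<bar>Re z\<bar> * norm p + \<bar>Im z\<bar> * norm p"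
    by (simp only: norm_scaleR)
  also have "\<dots> \<le> norm z * norm p + norm z * norm p"
    by (intro add_mono mult_right_mono abs_Re_le_cmod abs_Im_le_cmod) auto
  finally show ?thesis by simp
qed

lemma norm_cscale_le: "norm (cscale z) \<le> 2 * norm z"
  by (rule norm_blinfun_bound) (auto simp: norm_cscale_apply_le simp del: blinfun_apply_cscale)

lemma bounded_linear_cscale: "bounded_linear cscale"
proof (rule bounded_linear_intro[where K = 2])
  show "cscale (x + y) = cscale x + cscale y" for x y
    by (rule blinfun_eqI) (auto simp: blinfun.bilinear_simps algebra_simps)
  show "cscale (r *\<^sub>R x) = r *\<^sub>R cscale x" for r x
    by (rule blinfun_eqI) (auto simp: blinfun.bilinear_simps scaleR_prod_def algebra_simps)
  show "norm (cscale x) \<le> norm x * 2" for x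
    using norm_cscale_le[of x] by (simp add: mult.commute)
qed

lemmas cscale_diff = linear_diff[OF bounded_linear.linear[OF bounded_linear_cscale]]
lemmas cscale_add = linear_add[OF bounded_linear.linear[OF bounded_linear_cscale]]
lemmas cscale_minus = linear_neg[OF bounded_linear.linear[OF bounded_linear_cscale]]
lemmas cscale_0 [simp] = linear_0[OF bounded_linear.linear[OF bounded_linear_cscale]]

lemmas continuous_on_cscale [continuous_intros] =
  bounded_linear.continuous_on[OF bounded_linear_cscale]

lemma continuous_on_blinfun_compose [continuous_intros]:
  "continuous_on S f \<Longrightarrow> continuous_on S g \<Longrightarrow> continuous_on S (\<lambda>x. f x o\<^sub>L g x)"
  by (rule bounded_bilinear.continuous_on[OF bounded_bilinear_blinfun_compose])

lemma norm_complexify_le: "norm (complexify A) \<le> norm A"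
proof (rule norm_blinfun_bound)
  fix p :: "'a \<times> 'a"
  have "norm (complexify A p) = sqrt ((norm (A (fst p)))\<^sup>2 + (norm (A (snd p)))\<^sup>2)"
    by (simp add: norm_prod_def)
  also have "\<dots> \<le> sqrt ((norm A * norm (fst p))\<^sup>2 + (norm A * norm (snd p))\<^sup>2)"
    by (intro real_sqrt_le_mono add_mono power_mono norm_blinfun norm_ge_zero)
  also have "\<dots> = sqrt ((norm A)\<^sup>2 * ((norm (fst p))\<^sup>2 + (norm (snd p))\<^sup>2))"
    by (simp add: power_mult_distrib distrib_left)
  also have "\<dots> = norm A * norm p"
    by (simp add: norm_prod_def real_sqrt_mult)
  finally show "norm (complexify A p) \<le> norm A * norm p" .
qed simp

lemma cscale_complexify_commute: "cscale z (complexify A p) = complexify A (cscale z p)"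
  by (simp add: blinfun.bilinear_simps)

lemma blinfun_compose_assoc: "(A o\<^sub>L B) o\<^sub>L C = A o\<^sub>L (B o\<^sub>L C)"
  by (rule blinfun_eqI) simp

lemma blinfun_compose_id [simp]: "A o\<^sub>L id_blinfun = A" "id_blinfun o\<^sub>L A = A"
  by (rule blinfun_eqI, simp)+

lemmas compose_simps = bounded_bilinear.diff_left[OF bounded_bilinear_blinfun_compose]
  bounded_bilinear.diff_right[OF bounded_bilinear_blinfun_compose]
  bounded_bilinear.add_left[OF bounded_bilinear_blinfun_compose]
  bounded_bilinear.add_right[OF bounded_bilinear_blinfun_compose]

lemma inverse_op_left: "inverse_op A B \<Longrightarrow> B (A x) = x"
  unfolding inverse_op_def by (metis blinfun_apply_blinfun_compose blinfun_apply_id_blinfun id_apply)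

lemma inverse_op_right: "inverse_op A B \<Longrightarrow> A (B x) = x"
  unfolding inverse_op_def by (metis blinfun_apply_blinfun_compose blinfun_apply_id_blinfun id_apply)

lemma inverse_op_unique: "inverse_op A B \<Longrightarrow> inverse_op A B' \<Longrightarrow> B = B'"
  by (rule blinfun_eqI) (metis inverse_op_left inverse_op_right)

lemma inverse_op_diff:
  assumes "inverse_op A B" "inverse_op A' B'"
  shows "B' - B = B' o\<^sub>L (A - A') o\<^sub>L B"
  by (rule blinfun_eqI)
     (simp add: blinfun.bilinear_simps inverse_op_left[OF assms(2)] inverse_op_right[OF assms(1)])

lemma norm_compose3_le: "norm (A o\<^sub>L B o\<^sub>L C) \<le> norm A * norm B * norm C"
  by (rule order_trans[OF norm_blinfun_compose]) (intro mult_right_mono norm_blinfun_compose norm_ge_zero)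

lemma inverse_op_commute:
  assumes "inverse_op A B" "\<And>x. A (C x) = C (A x)"
  shows "B (C x) = C (B x)"
  by (metis assms inverse_op_left inverse_op_right)

text \<open>The inverses are given, so no series has to be summed: the resolvent identity
\<open>B(y) - B(x) = B(y) (A(x) - A(y)) B(x)\<close> first bounds \<open>B(y)\<close> near \<open>x\<close> and then forces convergence.\<close>

lemma continuous_on_inverse_op:
  fixes A :: "'x::metric_space \<Rightarrow> ('v::real_normed_vector \<Rightarrow>\<^sub>L 'v)"
  assumes A: "continuous_on S A" and B: "\<And>x. x \<in> S \<Longrightarrow> inverse_op (A x) (B x)"
  shows "continuous_on S B"
  unfolding continuous_on_def
proof
  fix x assume x: "x \<in> S"
  define b where "b = norm (B x)"
  have lim: "((\<lambda>y. norm (A x - A y)) \<longlongrightarrow> 0) (at x within S)"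
  proof -
    have "(A \<longlongrightarrow> A x) (at x within S)" using A x by (simp add: continuous_on_def)
    from tendsto_norm[OF tendsto_diff[OF tendsto_const this, of "A x"]] show ?thesis by simp
  qed
  have bl: "b * (1/(2*(b+1))) \<le> 1/2" "(0::real) < 1/(2*(b+1))"
    unfolding b_def using norm_ge_zero[of "B x"] by (simp_all add: divide_simps add_nonneg_pos)
  have ev: "eventually (\<lambda>y. norm (A x - A y) < 1/(2*(b+1))) (at x within S)"
    by (rule order_tendstoD(2)[OF lim bl(2)])
  have evS: "eventually (\<lambda>y. y \<in> S) (at x within S)" by (simp add: eventually_at_filter)
  have "eventually (\<lambda>y. norm (B y - B x) \<le> 2 * b * norm (A x - A y) * b) (at x within S)"
    using ev evS
  proof eventually_elim
    case (elim y)
    have d: "B y - B x = B y o\<^sub>L (A x - A y) o\<^sub>L B x"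
      by (rule inverse_op_diff[OF B[OF x] B[OF elim(2)]])
    have n: "norm (B y - B x) \<le> norm (B y) * norm (A x - A y) * b"
      unfolding d b_def by (rule norm_compose3_le)
    have "norm (A x - A y) * b \<le> (1/(2*(b+1))) * b"
      using elim(1) by (intro mult_right_mono) (auto simp: b_def)
    also have "\<dots> \<le> 1/2" using bl by (simp add: mult.commute)
    finally have "norm (B y) * (norm (A x - A y) * b) \<le> norm (B y) * (1/2)"
      by (intro mult_left_mono) auto
    then have "norm (B y - B x) \<le> norm (B y) / 2" using n by (simp add: mult.assoc)
    then have "norm (B y) \<le> 2 * b"
      using norm_triangle_sub[of "B y" "B x"] by (simp add: b_def)
    then have "norm (B y) * (norm (A x - A y) * b) \<le> 2 * b * (norm (A x - A y) * b)"
      by (intro mult_right_mono) (auto simp: b_def)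
    then show ?case using n by (simp add: mult.assoc)
  qed
  moreover have "((\<lambda>y. 2 * b * norm (A x - A y) * b) \<longlongrightarrow> 2 * b * 0 * b) (at x within S)"
    by (intro tendsto_intros lim)
  ultimately have "((\<lambda>y. norm (B y - B x)) \<longlongrightarrow> 0) (at x within S)"
    by (intro tendsto_sandwich[of "\<lambda>_. 0" "\<lambda>y. norm (B y - B x)" _ "\<lambda>y. 2 * b * norm (A x - A y) * b"])
       auto
  then show "(B \<longlongrightarrow> B x) (at x within S)"
    by (simp add: tendsto_norm_zero_iff LIM_zero_iff)
qed

lemma integral_blinfun_compose_left:
  fixes f :: "real \<Rightarrow> ('v::banach \<Rightarrow>\<^sub>L 'v)"
  assumes "f integrable_on S"
  shows "A o\<^sub>L integral S f = integral S (\<lambda>t. A o\<^sub>L f t)"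
  using integral_linear[OF assms bounded_bilinear.bounded_linear_right[OF bounded_bilinear_blinfun_compose, of A]]
  by (simp add: o_def)

lemma integral_blinfun_compose_right:
  fixes f :: "real \<Rightarrow> ('v::banach \<Rightarrow>\<^sub>L 'v)"
  assumes "f integrable_on S"
  shows "integral S f o\<^sub>L A = integral S (\<lambda>t. f t o\<^sub>L A)"
  using integral_linear[OF assms bounded_bilinear.bounded_linear_left[OF bounded_bilinear_blinfun_compose, of A]]
  by (simp add: o_def)

lemma integral_blinfun_apply:
  fixes f :: "real \<Rightarrow> ('v::banach \<Rightarrow>\<^sub>L 'w::banach)"
  assumes "f integrable_on S"
  shows "integral S f x = integral S (\<lambda>t. f t x)"
  using integral_linear[OF assms blinfun.bounded_linear_left[of x]] by (simp add: o_def)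

text \<open>Functional calculus around the eigenvalue \<open>1\<close> without residues. \<open>G\<close> is the mean of the resolvent over
the circle, that is, the contour integral of \<open>(\<xi> - 1)\<^sup>-\<^sup>1\<close> times the resolvent. Integrating
\<open>(1 - A) (\<xi> - A)\<^sup>-\<^sup>1 = I - (\<xi> - 1) (\<xi> - A)\<^sup>-\<^sup>1\<close> shows that \<open>G\<close> inverts \<open>1 - A\<close> on the
complement of the eigenspace; on a fixed vector of \<open>A\<close> the resolvent is \<open>(\<xi> - 1)\<^sup>-\<^sup>1\<close>, so \<open>P\<close> fixes it.\<close>

lemma resolvent_identity:
  fixes A :: "('b::banach \<times> 'b) \<Rightarrow>\<^sub>L ('b \<times> 'b)" and P :: "'b \<Rightarrow>\<^sub>L 'b"
  assumes comm: "\<And>z x. A (cscale z x) = cscale z (A x)"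
    and P: "spectral_projection A 1 (complexify P)"
  obtains G where "(id_blinfun - A) o\<^sub>L G = id_blinfun - complexify P"
    and "G o\<^sub>L (id_blinfun - A) = id_blinfun - complexify P"
    and "\<And>x. complexify P (A x) = A (complexify P x)"
    and "\<And>x. A x = x \<Longrightarrow> complexify P x = x"
    and "\<And>(C :: ('b \<times> 'b) \<Rightarrow>\<^sub>L ('b \<times> 'b)) x. (\<And>x. A (C x) = C (A x)) \<Longrightarrow> (\<And>z x. cscale z (C x) = C (cscale z x)) \<Longrightarrow> G (C x) = C (G x)"
proof -
  from P obtain r where r: "r > 0" "cball 1 r \<inter> op_spectrum A = {1}"
    "complexify P = (1 / (2 * pi)) *\<^sub>R
        integral {0..2 * pi} (\<lambda>t. cscale (of_real r * cis t) o\<^sub>L resolvent A (1 + of_real r * cis t))"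
    unfolding spectral_projection_def by auto
  define \<xi> where "\<xi> t = 1 + of_real r * cis t" for t
  define Rs where "Rs t = resolvent A (\<xi> t)" for t
  have inv: "inverse_op (cscale (\<xi> t) - A) (Rs t)" for t
  proof -
    have "\<xi> t \<in> cball 1 r" using r(1) by (simp add: \<xi>_def dist_norm norm_mult)
    moreover have "\<xi> t \<noteq> 1" using r(1) by (simp add: \<xi>_def)
    ultimately have "\<xi> t \<notin> op_spectrum A" using r(2) by blast
    then obtain B where B: "inverse_op (cscale (\<xi> t) - A) B" by (auto simp: op_spectrum_def)
    show ?thesis unfolding Rs_def resolvent_def 
      by (rule theI[where P = "inverse_op (cscale (\<xi> t) - A)", OF B]) (rule inverse_op_unique[OF _ B])
  qed
  have cR: "continuous_on UNIV Rs"
    by (rule continuous_on_inverse_op[OF _ inv]) (unfold \<xi>_def, intro continuous_intros)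
  have cR': "continuous_on S Rs" for S by (rule continuous_on_subset[OF cR]) auto
  define G where "G = (1 / (2 * pi)) *\<^sub>R integral {0..2 * pi} Rs"
  have int1: "Rs integrable_on {0..2*pi}"
    by (intro integrable_continuous_real cR')
  have int2: "(\<lambda>t. cscale (of_real r * cis t) o\<^sub>L Rs t) integrable_on {0..2*pi}"
    by (intro integrable_continuous_real continuous_intros cR')
  have P': "complexify P = (1 / (2 * pi)) *\<^sub>R integral {0..2 * pi} (\<lambda>t. cscale (of_real r * cis t) o\<^sub>L Rs t)"
    using r(3) by (simp add: Rs_def \<xi>_def)
  have idint: "integral {0..2*pi} (\<lambda>t. id_blinfun - (cscale (of_real r * cis t) o\<^sub>L Rs t)) = (2*pi) *\<^sub>R (id_blinfun - complexify P)"
    unfolding P' by (subst integral_diff) (use int2 in \<open>auto simp: scaleR_diff_right\<close>)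
  have commRs: "Rs t (C x) = C (Rs t x)" if "\<And>x. A (C x) = C (A x)" "\<And>z x. cscale z (C x) = C (cscale z x)" 
    for C :: "('b \<times> 'b) \<Rightarrow>\<^sub>L ('b \<times> 'b)" and t x
    by (rule inverse_op_commute[OF inv]) (simp only: blinfun.diff_left that blinfun.diff_right)
  have RsA: "Rs t (A x) = A (Rs t x)" for t x by (rule commRs) (auto simp only: comm)
  have e1: "(id_blinfun - A) o\<^sub>L Rs t = id_blinfun - (cscale (of_real r * cis t) o\<^sub>L Rs t)" for t
  proof (rule blinfun_eqI)
    fix x
    have "cscale (\<xi> t) (Rs t x) - A (Rs t x) = x"
      using inverse_op_right[OF inv, of t x] by (simp only: blinfun.diff_left)
    moreover have "cscale (\<xi> t) (Rs t x) = Rs t x + cscale (of_real r * cis t) (Rs t x)"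
      unfolding \<xi>_def cscale_add by (simp add: blinfun.add_left del: blinfun_apply_cscale)
    ultimately show "((id_blinfun - A) o\<^sub>L Rs t) x = (id_blinfun - (cscale (of_real r * cis t) o\<^sub>L Rs t)) x"
      by (simp add: blinfun.diff_left del: blinfun_apply_cscale) (simp add: algebra_simps del: blinfun_apply_cscale)
  qed
  have e2: "Rs t o\<^sub>L (id_blinfun - A) = (id_blinfun - A) o\<^sub>L Rs t" for t
    by (rule blinfun_eqI) (simp add: blinfun.bilinear_simps RsA)
  show thesis
  proof (rule that[of G])
    have "(id_blinfun - A) o\<^sub>L integral {0..2*pi} Rs = (2*pi) *\<^sub>R (id_blinfun - complexify P)"
      unfolding integral_blinfun_compose_left[OF int1] e1 idint ..
    then show "(id_blinfun - A) o\<^sub>L G = id_blinfun - complexify P"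
      unfolding G_def by (simp add: bounded_bilinear.scaleR_right[OF bounded_bilinear_blinfun_compose])
    have "integral {0..2*pi} Rs o\<^sub>L (id_blinfun - A) = (2*pi) *\<^sub>R (id_blinfun - complexify P)"
      unfolding integral_blinfun_compose_right[OF int1] e2 e1 idint ..
    then show "G o\<^sub>L (id_blinfun - A) = id_blinfun - complexify P"
      unfolding G_def by (simp add: bounded_bilinear.scaleR_left[OF bounded_bilinear_blinfun_compose])
  next
    fix x
    show "complexify P (A x) = A (complexify P x)"
    proof -
      have "complexify P o\<^sub>L A = A o\<^sub>L complexify P"
        unfolding P' bounded_bilinear.scaleR_right[OF bounded_bilinear_blinfun_compose]
          bounded_bilinear.scaleR_left[OF bounded_bilinear_blinfun_compose]
          integral_blinfun_compose_left[OF int2] integral_blinfun_compose_right[OF int2]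
        by (intro arg_cong2[where f=scaleR] refl integral_cong blinfun_eqI)
           (simp add: RsA comm del: blinfun_apply_cscale)
      then show ?thesis by (metis blinfun_apply_blinfun_compose)
    qed
  next
    fix x assume x: "A x = x"
    have "cscale (of_real r * cis t) (Rs t x) = x" for t
    proof -
      have "(cscale (\<xi> t) - A) x = cscale (of_real r * cis t) x"
        unfolding \<xi>_def cscale_add by (simp add: blinfun.add_left blinfun.diff_left x del: blinfun_apply_cscale)
      then have "x = Rs t (cscale (of_real r * cis t) x)"
        using inverse_op_left[OF inv, of t x] by simp
      also have "\<dots> = cscale (of_real r * cis t) (Rs t x)"
        by (rule commRs) (rule comm, rule cscale_commute)
      finally show ?thesis by simp
    qed
    then have "integral {0..2 * pi} (\<lambda>t. cscale (of_real r * cis t) o\<^sub>L Rs t) x = (2 * pi) *\<^sub>R x"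
      unfolding integral_blinfun_apply[OF int2] by (simp del: blinfun_apply_cscale)
    then show "complexify P x = x" unfolding P' by (simp add: blinfun.scaleR_left)
  next
    fix C :: "('b \<times> 'b) \<Rightarrow>\<^sub>L ('b \<times> 'b)" and x
    assume "\<And>x. A (C x) = C (A x)" "\<And>z x. cscale z (C x) = C (cscale z x)"
    then have "Rs t o\<^sub>L C = C o\<^sub>L Rs t" for t by (intro blinfun_eqI) (simp add: commRs)
    then have "integral {0..2*pi} Rs o\<^sub>L C = C o\<^sub>L integral {0..2*pi} Rs"
      unfolding integral_blinfun_compose_left[OF int1] integral_blinfun_compose_right[OF int1] by simp
    then have "(integral {0..2*pi} Rs o\<^sub>L C) x = (C o\<^sub>L integral {0..2*pi} Rs) x" by simp
    then show "G (C x) = C (G x)" unfolding G_def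
      by (simp add: blinfun.scaleR_left blinfun.scaleR_right)
  qed
qed

section \<open>Power series at the boundary point 1\<close>

lemma sum_powr_le:
  fixes \<eta> :: real
  assumes "0 < \<eta>" "\<eta> < 1"
  shows "(\<Sum>k=1..N. real k powr - \<eta>) \<le> real N powr (1 - \<eta>) / (1 - \<eta>)"
proof (induction N)
  case 0
  then show ?case by simp
next
  case (Suc N)
  show ?case
  proof (cases "N = 0")
    case True
    then show ?thesis using assms by simp
  next
    case False
    have "\<exists>z::real. real N < z \<and> z < real (Suc N) \<and>
        real (Suc N) powr (1-\<eta>) - real N powr (1-\<eta>) = (real (Suc N) - real N) * ((1-\<eta>) * z powr (-\<eta>))"
      using False by (intro MVT2) (auto intro!: derivative_eq_intros)
    then obtain z where z: "real N < z" "z < real (Suc N)"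
      "real (Suc N) powr (1-\<eta>) - real N powr (1-\<eta>) = (1-\<eta>) * z powr (-\<eta>)" by auto
    have "real (Suc N) powr (-\<eta>) \<le> z powr (-\<eta>)"
      using z False assms by (intro powr_mono2') auto
    then have "(1-\<eta>) * real (Suc N) powr (-\<eta>) \<le> real (Suc N) powr (1-\<eta>) - real N powr (1-\<eta>)"
      using z(3) assms by simp
    then show ?thesis using Suc assms by (simp add: field_simps)
  qed
qed

lemma suminf_powr_tail_le:
  fixes p :: real
  assumes "1 < p" "N \<ge> 1"
  shows "summable (\<lambda>k. real (k + N + 1) powr - p)"
    and "(\<Sum>k. real (k + N + 1) powr - p) \<le> real N powr (1 - p) / (p - 1)"
proof -
  have step: "(p - 1) * real (n + 1) powr - p \<le> real n powr (1 - p) - real (n+1) powr (1 - p)"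
    if "n \<ge> 1" for n
  proof -
    have "\<exists>z::real. real n < z \<and> z < real (Suc n) \<and>
        real (Suc n) powr (1-p) - real n powr (1-p) = (real (Suc n) - real n) * ((1-p) * z powr (-p))"
      using that by (intro MVT2) (auto intro!: derivative_eq_intros)
    then obtain z where z: "real n < z" "z < real (Suc n)"
      "real (Suc n) powr (1-p) - real n powr (1-p) = (1-p) * z powr (-p)" by auto
    have "real (Suc n) powr (-p) \<le> z powr (-p)"
      using z that assms by (intro powr_mono2') auto
    then have "(p-1) * real (Suc n) powr (-p) \<le> (p-1) * z powr (-p)"
      using assms by simp
    then show ?thesis using z(3) by (simp add: algebra_simps)
  qed
  have part: "(\<Sum>k<n. real (k + N + 1) powr - p) \<le> (real N powr (1 - p) - real (n + N) powr (1-p)) / (p - 1)" for n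
  proof (induction n)
    case (Suc n)
    from step[of "n+N"] assms
    have "real (n + N + 1) powr - p \<le> (real (n+N) powr (1 - p) - real (n+N+1) powr (1 - p)) / (p-1)"
      by (simp add: field_simps)
    then show ?case using Suc by (simp add: diff_divide_distrib add_ac)
  qed simp
  have part': "(\<Sum>k<n. real (k + N + 1) powr - p) \<le> real N powr (1 - p) / (p - 1)" for n
    by (rule order_trans[OF part]) (use assms in \<open>auto intro!: divide_right_mono\<close>)
  show sm: "summable (\<lambda>k. real (k + N + 1) powr - p)"
    by (rule summableI_nonneg_bounded[OF _ part']) auto
  show "(\<Sum>k. real (k + N + 1) powr - p) \<le> real N powr (1 - p) / (p - 1)"
    by (rule suminf_le_const[OF sm part'])
qed

text \<open>Summation by parts.\<close>

lemma weighted_sum_plus_tail: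
  fixes a :: "nat \<Rightarrow> real"
  assumes "summable a"
  shows "(\<Sum>n\<le>N. real n * a n) + real N * (\<Sum>k. a (k + N + 1)) = (\<Sum>m<N. \<Sum>k. a (k + m + 1))"
proof (induction N)
  case (Suc N)
  have "summable (\<lambda>k. a (k + N + 1))"
    using assms summable_iff_shift[of a "N+1"] by (simp add: add.assoc)
  from suminf_split_head[OF this]
  have "(\<Sum>k. a (k + Suc N + 1)) = (\<Sum>k. a (k + N + 1)) - a (Suc N)" by simp
  then show ?case using Suc by (simp add: distrib_right distrib_left diff_divide_distrib right_diff_distrib)
qed simp

text \<open>Split at \<open>n \<approx> 1/h\<close>: beyond it the tail bound applies directly, below it summation by parts
turns \<open>\<Sum>n a\<^sub>n\<close> into a sum of tails. With \<open>|z\<^sup>n - w\<^sup>n| \<le> min 2 (n |z - w|)\<close> this makes power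
series with such coefficients \<open>\<eta>\<close>-Hoelder up to the boundary of the disc.\<close>

lemma holder_of_tail:
  fixes a :: "nat \<Rightarrow> real" and \<eta> K :: real
  assumes nn: "\<And>n. a n \<ge> 0" and sm: "summable a" and \<eta>: "0 < \<eta>" "\<eta> < 1"
    and tail: "\<And>N. N \<ge> 1 \<Longrightarrow> (\<Sum>k. a (k + N + 1)) \<le> K * real N powr - \<eta>"
  obtains K' where "K' \<ge> 0"
    and "\<And>h. h \<ge> 0 \<Longrightarrow> summable (\<lambda>n. a n * min 2 (real n * h))"
    and "\<And>h. h \<ge> 0 \<Longrightarrow> (\<Sum>n. a n * min 2 (real n * h)) \<le> K' * h powr \<eta>"
proof -
  have smN: "summable (\<lambda>k. a (k + N + 1))" for N
    using sm summable_iff_shift[of a "N+1"] by (simp add: add.assoc)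
  have sm': "summable (\<lambda>n. a n * min 2 (real n * h))" if "h \<ge> 0" for h
  proof (rule summable_comparison_test'[OF summable_mult[OF sm, of 2]])
    fix n :: nat
    have "a n * min 2 (real n * h) \<le> a n * 2"
      by (intro mult_left_mono nn) simp
    then show "norm (a n * min 2 (real n * h)) \<le> 2 * a n"
      using nn[of n] that by (simp add: abs_mult)
  qed
  define t where "t N = (\<Sum>k. a (k + N + 1))" for N
  have t0: "t N \<ge> 0" for N unfolding t_def by (intro suminf_nonneg smN nn)
  define K2 where "K2 = t 0 + \<bar>K\<bar> / (1-\<eta>)"
  have K2: "K2 \<ge> 0" unfolding K2_def using t0 \<eta> by auto
  have S1: "(\<Sum>n\<le>N. real n * a n) \<le> K2 * real N powr (1-\<eta>)" if "N \<ge> 1" for N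
  proof -
    have "(\<Sum>n\<le>N. real n * a n) \<le> (\<Sum>m<N. t m)"
      using weighted_sum_plus_tail[OF sm, of N] mult_nonneg_nonneg[of "real N" "t N"] t0[of N]
      unfolding t_def by linarith
    also have "\<dots> \<le> (\<Sum>m\<le>N. t m)"
      by (intro sum_mono2) (auto simp: t0)
    also have "\<dots> = t 0 + (\<Sum>m=1..N. t m)"
      by (simp add: sum.atLeast_Suc_atMost atMost_atLeast0)
    also have "(\<Sum>m=1..N. t m) \<le> (\<Sum>m=1..N. \<bar>K\<bar> * real m powr - \<eta>)"
    proof (intro sum_mono)
      fix m assume m: "m \<in> {1..N}"
      have "t m \<le> K * real m powr - \<eta>" using tail[of m] m unfolding t_def by auto
      also have "\<dots> \<le> \<bar>K\<bar> * real m powr - \<eta>" by (intro mult_right_mono) auto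
      finally show "t m \<le> \<bar>K\<bar> * real m powr - \<eta>" .
    qed
    also have "\<dots> = \<bar>K\<bar> * (\<Sum>m=1..N. real m powr - \<eta>)" by (simp add: sum_distrib_left)
    also have "\<dots> \<le> \<bar>K\<bar> * (real N powr (1 - \<eta>) / (1 - \<eta>))"
      by (intro mult_left_mono sum_powr_le \<eta>) auto
    also have "t 0 \<le> t 0 * real N powr (1-\<eta>)"
      using t0[of 0] that \<eta> ge_one_powr_ge_zero[of "real N" "1-\<eta>"] mult_left_mono[of 1 "real N powr (1-\<eta>)" "t 0"] by simp
    finally show ?thesis unfolding K2_def by (simp add: algebra_simps)
  qed
  define K' where "K' = K2 + 4 * \<bar>K\<bar> + 2 * (\<Sum>n. a n)"
  have sa: "(\<Sum>n. a n) \<ge> 0" by (intro suminf_nonneg sm nn)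
  have main: "(\<Sum>n. a n * min 2 (real n * h)) \<le> K' * h powr \<eta>" if h: "h \<ge> 0" for h
  proof -
    consider "h = 0" | "0 < h" "h \<le> 1" | "h > 1" using h by linarith
    then show ?thesis
    proof cases
      case 1 then show ?thesis by simp
    next
      case 3
      have "(\<Sum>n. a n * min 2 (real n * h)) \<le> (\<Sum>n. 2 * a n)"
        by (intro suminf_le sm' h summable_mult sm) (metis min.cobounded1 mult.commute mult_left_mono nn)
      also have "\<dots> = 2 * (\<Sum>n. a n)" by (intro suminf_mult sm)
      also have "\<dots> \<le> K' * 1" unfolding K'_def using K2 by simp
      also have "\<dots> \<le> K' * h powr \<eta>"
        using 3 \<eta> K2 sa by (intro mult_left_mono ge_one_powr_ge_zero) (auto simp: K'_def)
      finally show ?thesis .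
    next
      case 2
      define N where "N = nat \<lfloor>1/h\<rfloor>"
      have ih: "1/h \<ge> 1" using 2 by simp
      have N1: "N \<ge> 1" unfolding N_def using ih by linarith
      have Nle: "real N \<le> 1/h" unfolding N_def using ih by linarith
      have Nge: "1/h \<le> 2 * real N" using N1 unfolding N_def using ih by linarith
      have "(\<Sum>n. a n * min 2 (real n * h)) =
          (\<Sum>n. a (n + (N+1)) * min 2 (real (n + (N+1)) * h)) + (\<Sum>n<N+1. a n * min 2 (real n * h))"
        by (intro suminf_split_initial_segment sm' h)
      also have "(\<Sum>n. a (n + (N+1)) * min 2 (real (n + (N+1)) * h)) \<le> (\<Sum>n. 2 * a (n + N + 1))"
      proof (intro suminf_le)
        show "summable (\<lambda>n. a (n + (N+1)) * min 2 (real (n + (N+1)) * h))"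
          using sm'[OF h] summable_iff_shift[of "\<lambda>n. a n * min 2 (real n * h)" "N+1"] by blast
        show "summable (\<lambda>n. 2 * a (n + N + 1))" by (intro summable_mult smN)
        show "a (n + (N+1)) * min 2 (real (n + (N+1)) * h) \<le> 2 * a (n + N + 1)" for n
          using mult_left_mono[OF min.cobounded1 nn] by (simp add: add.assoc mult.commute)
      qed
      also have "\<dots> = 2 * t N" unfolding t_def by (intro suminf_mult smN)
      also have "t N \<le> \<bar>K\<bar> * real N powr - \<eta>"
        using order_trans[OF tail[OF N1] mult_right_mono[OF abs_ge_self powr_ge_zero]] unfolding t_def .
      also have "real N powr - \<eta> \<le> (1/(2*h)) powr - \<eta>"
        using Nge N1 \<eta> 2 by (intro powr_mono2') (auto simp: field_simps)
      also have "(1/(2*h)) powr - \<eta> = (2*h) powr \<eta>"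
        using 2 by (simp add: powr_minus_divide powr_divide)
      also have "\<dots> = 2 powr \<eta> * h powr \<eta>" using 2 by (simp add: powr_mult)
      also have "2 powr \<eta> \<le> (2::real) powr 1" using \<eta> by (intro powr_mono) auto
      also have "(\<Sum>n<N+1. a n * min 2 (real n * h)) \<le> (\<Sum>n<N+1. a n * (real n * h))"
        by (intro sum_mono mult_left_mono nn) auto
      also have "\<dots> = h * (\<Sum>n\<le>N. real n * a n)"
        by (simp add: sum_distrib_left lessThan_Suc_atMost mult_ac)
      also have "\<dots> \<le> h * (K2 * real N powr (1-\<eta>))"
        using 2 by (intro mult_left_mono S1 N1) auto
      also have "real N powr (1-\<eta>) \<le> (1/h) powr (1-\<eta>)"
        using Nle \<eta> by (intro powr_mono2) auto
      also have "h * (K2 * (1/h) powr (1-\<eta>)) = K2 * h powr \<eta>"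
        using 2 by (simp add: powr_divide powr_diff field_simps)
      finally have "(\<Sum>n. a n * min 2 (real n * h)) \<le> 2 * (\<bar>K\<bar> * (2 powr 1 * h powr \<eta>)) + K2 * h powr \<eta>"
        using K2 2 by (simp add: mult_left_mono)
      also have "\<dots> \<le> K' * h powr \<eta>" unfolding K'_def using sa by (simp add: algebra_simps)
      finally show ?thesis .
    qed
  qed
  show thesis
    by (rule that[OF _ sm' main]) (use K2 sa in \<open>auto simp: K'_def\<close>)
qed

definition bincoef :: "real \<Rightarrow> nat \<Rightarrow> real" where
  "bincoef a n = pochhammer a n / fact n"

lemma bincoef_sums:
  fixes z :: complex
  assumes "norm z < 1"
  shows "(\<lambda>n. of_real (bincoef a n) * z ^ n) sums ((1 - z) powr (- of_real a))"
proof -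
  have "(\<lambda>n. (- of_real a gchoose n) * (-z) ^ n) sums (1 + (-z)) powr (- of_real a)"
    by (rule gen_binomial_complex) (use assms in auto)
  moreover have "(- of_real a gchoose n) * (-z) ^ n = of_real (bincoef a n) * z ^ n" for n
    by (simp add: gbinomial_pochhammer bincoef_def pochhammer_of_real power_minus[of z])
  ultimately show ?thesis by simp
qed

lemma bincoef_limit: "(\<lambda>n. bincoef a n * real n powr (1 - a)) \<longlonglongrightarrow> rGamma a"
proof -
  have "(\<lambda>n. rGamma_series a n * (real n / (a + real n))) \<longlonglongrightarrow> rGamma a * 1"
    by (intro tendsto_mult rGamma_series_LIMSEQ) real_asymp
  moreover have "eventually (\<lambda>n. rGamma_series a n * (real n / (a + real n)) = bincoef a n * real n powr (1 - a)) sequentially"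
    using eventually_gt_at_top[of "nat \<lceil>\<bar>a\<bar>\<rceil> + 1"]
  proof eventually_elim
    case (elim n)
    then have "a + real n > 0" "n > 0" by linarith+
    then have "rGamma_series a n * (real n / (a + real n)) =
        pochhammer a n * (a + real n) / (fact n * real n powr a) * (real n / (a + real n))"
      by (simp add: rGamma_series_def pochhammer_Suc powr_def)
    also have "\<dots> = bincoef a n * (real n / real n powr a)"
      using elim \<open>a + real n > 0\<close> by (simp add: bincoef_def)
    also have "real n / real n powr a = real n powr (1 - a)"
      using \<open>n > 0\<close> by (simp add: powr_diff)
    finally show ?case .
  qed
  ultimately show ?thesis
    by (simp add: tendsto_cong)
qed

lemma bigo_nat_bound:
  fixes f g :: "nat \<Rightarrow> real"
  assumes "f \<in> O(g)" and pos: "\<And>n. n \<ge> 1 \<Longrightarrow> g n > 0"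
  obtains C where "C \<ge> 0" "\<And>n. n \<ge> 1 \<Longrightarrow> \<bar>f n\<bar> \<le> C * g n"
proof -
  from assms(1) obtain c where c: "c > 0" "eventually (\<lambda>n. norm (f n) \<le> c * norm (g n)) at_top"
    by (elim landau_o.bigE)
  then obtain N where N: "\<And>n. n \<ge> N \<Longrightarrow> norm (f n) \<le> c * norm (g n)"
    by (auto simp: eventually_at_top_linorder)
  define C where "C = c + (\<Sum>n\<in>{1..N}. \<bar>f n\<bar> / g n)"
  have s: "(\<Sum>n\<in>{1..N}. \<bar>f n\<bar> / g n) \<ge> 0" by (intro sum_nonneg divide_nonneg_nonneg) (auto intro: less_imp_le[OF pos])
  have "\<bar>f n\<bar> \<le> C * g n" if n: "n \<ge> 1" for n
  proof (cases "n \<le> N")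
    case True
    have "\<bar>f n\<bar> / g n \<le> (\<Sum>n\<in>{1..N}. \<bar>f n\<bar> / g n)"
      by (rule member_le_sum) (use n True in \<open>auto intro!: divide_nonneg_nonneg intro: less_imp_le[OF pos]\<close>)
    also have "\<dots> \<le> C" unfolding C_def using c by simp
    finally show ?thesis using pos[OF n] by (simp add: field_simps)
  next
    case False
    have "\<bar>f n\<bar> \<le> c * g n" using N[of n] False pos[OF n] by auto
    also have "\<dots> \<le> C * g n" using s pos[OF n] unfolding C_def by (intro mult_right_mono) auto
    finally show ?thesis .
  qed
  then show thesis using that[of C] c s by (simp add: C_def)
qed

text \<open>Telescoping, with \<open>1/n\<^sup>2 \<le> 2 (1/n - 1/(n+1))\<close>.\<close>

lemma limit_rate:
  fixes y :: "nat \<Rightarrow> real"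
  assumes lim: "y \<longlonglongrightarrow> l" and C: "C \<ge> 0"
    and step: "\<And>n. n \<ge> 1 \<Longrightarrow> \<bar>y (Suc n) - y n\<bar> \<le> C / real n ^ 2" and n: "n \<ge> 1"
  shows "\<bar>y n - l\<bar> \<le> 2 * C / real n"
proof -
  have *: "\<bar>y (n + k) - y n\<bar> \<le> 2 * C * (1 / real n - 1 / real (n + k))" for k
  proof (induction k)
    case (Suc k)
    have "1 / real (n+k)^2 \<le> 2 * (1 / real (n+k) - 1 / real (n + k + 1))"
    proof -
      define x where "x = real (n + k)"
      have x: "x \<ge> 1" using n by (simp add: x_def)
      have "1 / x^2 \<le> 2 * (1 / x - 1 / (x + 1))"
        using x by (simp add: divide_simps power2_eq_square)
      then show ?thesis by (simp add: x_def add_ac)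
    qed
    then have "C / real (n+k)^2 \<le> C * (2 * (1 / real (n+k) - 1 / real (n + k + 1)))"
      using mult_left_mono[OF _ C] by fastforce
    then have "\<bar>y (n + Suc k) - y (n+k)\<bar> \<le> 2 * C * (1 / real (n+k) - 1 / real (n + k + 1))"
    proof -
      have "\<bar>y (Suc (n + k)) - y (n + k)\<bar> \<le> C / real (n+k)^2" using step[of "n+k"] n by simp
      also note \<open>C / real (n+k)^2 \<le> _\<close>
      finally show ?thesis by (simp add: algebra_simps)
    qed
    then show ?case using Suc by (simp add: algebra_simps)
  qed simp
  have "\<bar>y (n + k) - y n\<bar> \<le> 2 * C / real n" for k
    using order_trans[OF *[of k], of "2 * C / real n"] C by (simp add: field_simps)
  moreover have "(\<lambda>k. \<bar>y (n + k) - y n\<bar>) \<longlonglongrightarrow> \<bar>l - y n\<bar>"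
    using LIMSEQ_ignore_initial_segment[OF lim, of n] by (intro tendsto_intros) (simp add: add.commute)
  ultimately have "\<bar>l - y n\<bar> \<le> 2 * C / real n"
    by (intro LIMSEQ_le_const2) auto
  then show ?thesis by (simp add: abs_minus_commute)
qed

text \<open>The Gamma limit alone gives no rate. The rate comes from the consecutive ratios of
\<open>bincoef a n * n powr (1 - a)\<close>, which are \<open>1 + O(1/n\<^sup>2)\<close>.\<close>

lemma bincoef_rate:
  assumes a: "0 < a" "a < (1::real)"
  obtains C where "C \<ge> 0" "\<And>n. n \<ge> 1 \<Longrightarrow> \<bar>bincoef a n - rGamma a * real n powr (a - 1)\<bar> \<le> C * real n powr (a - 2)"
proof -
  define y where "y n = bincoef a n * real n powr (1 - a)" for n
  have lim: "y \<longlonglongrightarrow> rGamma a" unfolding y_def by (rule bincoef_limit)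
  then obtain Y where Y: "\<And>n. \<bar>y n\<bar> \<le> Y" "Y > 0"
    using convergent_imp_Bseq[of y] unfolding convergent_def Bseq_def by (auto simp: real_norm_def)
  have "(\<lambda>n::nat. (1+a/real n)*(1+1/real n) powr (-a) - 1) \<in> O(\<lambda>n. 1/real n^2)"
    using a by real_asymp
  then obtain C where C: "C \<ge> 0" "\<And>n. n \<ge> 1 \<Longrightarrow> \<bar>(1+a/real n)*(1+1/real n) powr (-a) - 1\<bar> \<le> C * (1/real n^2)"
    by (rule bigo_nat_bound) auto
  have ratio: "y (Suc n) - y n = y n * ((1+a/real n)*(1+1/real n) powr (-a) - 1)" if n: "n \<ge> 1" for n
  proof -
    have e: "1 + 1 / real n = (real n + 1) / real n" using n by (simp add: field_simps)
    have "y (Suc n) = bincoef a n * ((a + real n) / (real n + 1)) * (real n + 1) powr (1 - a)"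
      by (simp add: y_def bincoef_def pochhammer_Suc add_ac)
    also have "(real n + 1) powr (1 - a) = (real n + 1) * (real n + 1) powr (-a)"
      using powr_add[of "real n + 1" 1 "-a"] n by simp
    also have "(real n + 1) powr (-a) = (1 + 1 / real n) powr (-a) * real n powr (-a)"
      unfolding e using n by (simp add: powr_divide)
    also have "bincoef a n * ((a + real n) / (real n + 1)) * ((real n + 1) * ((1 + 1 / real n) powr (-a) * real n powr (-a)))
        = bincoef a n * (real n * real n powr (-a)) * ((a + real n) / real n * (1 + 1 / real n) powr (-a))"
      using n by simp
    also have "real n * real n powr (-a) = real n powr (1 - a)"
      using powr_add[of "real n" 1 "-a"] n by simp
    also have "(a + real n) / real n = 1 + a / real n" using n by (simp add: field_simps)
    finally show ?thesis unfolding y_def by (simp add: algebra_simps)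
  qed
  have st: "\<bar>y (Suc n) - y n\<bar> \<le> (Y * C) / real n ^ 2" if "n \<ge> 1" for n
    unfolding ratio[OF that] abs_mult using mult_mono[OF Y(1) C(2)[OF that]] Y(2) by simp
  show thesis
  proof (rule that)
    show "2 * (Y * C) \<ge> 0" using Y(2) C by simp
    fix n :: nat assume n: "n \<ge> 1"
    have "bincoef a n - rGamma a * real n powr (a - 1) = (y n - rGamma a) * real n powr (a - 1)"
      unfolding y_def using n by (simp add: left_diff_distrib mult.assoc flip: powr_add)
    also have "\<bar>\<dots>\<bar> \<le> 2 * (Y * C) / real n * real n powr (a - 1)"
      unfolding abs_mult using limit_rate[OF lim _ st n] Y(2) C by (intro mult_mono) auto
    also have "\<dots> = 2 * (Y * C) * real n powr (a - 2)"
      using n powr_diff[of "real n" "a-1" 1] by simp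
    finally show "\<bar>bincoef a n - rGamma a * real n powr (a - 1)\<bar> \<le> 2 * (Y * C) * real n powr (a - 2)" .
  qed
qed

lemma norm_powr_of_real: "norm ((z::complex) powr of_real a) = norm z powr a"
  by (simp add: powr_def norm_exp_eq_Re)

lemma powr_of_real_power: "z \<noteq> 0 \<Longrightarrow> ((z::complex) powr of_real a) ^ k = z powr of_real (real k * a)"
  by (induction k) (simp_all add: powr_def exp_add[symmetric] algebra_simps)

lemma norm_power_diff_min:
  fixes z w :: complex
  assumes "norm z \<le> 1" "norm w \<le> 1"
  shows "norm (z ^ n - w ^ n) \<le> min 2 (real n * norm (z - w))"
proof -
  have "norm (z ^ n - w ^ n) \<le> norm (z ^ n) + norm (w ^ n)" by (rule norm_triangle_ineq4)
  also have "\<dots> \<le> 1 + 1" using assms by (intro add_mono) (simp_all add: norm_power power_le_one)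
  finally show ?thesis using norm_power_diff[OF assms, of n] by simp
qed

lemma power_series_at_1_holder:
  fixes g :: "nat \<Rightarrow> real"
  assumes p: "1 < p" "p < 2" and g: "\<And>n. n \<ge> 1 \<Longrightarrow> \<bar>g n\<bar> \<le> C * real n powr - p"
  shows "summable (\<lambda>n. \<bar>g n\<bar>)"
    and "\<exists>K\<ge>0. \<forall>z::complex. norm z \<le> 1 \<longrightarrow> norm ((\<Sum>n. of_real (g n) * z ^ n) - of_real (suminf g)) \<le> K * norm (1 - z) powr (p - 1)"
proof -
  have t1: "(\<Sum>k. \<bar>g (k + N + 1)\<bar>) \<le> C / (p - 1) * real N powr -(p - 1)"
    and t2: "summable (\<lambda>k. \<bar>g (k + N + 1)\<bar>)" if N: "N \<ge> 1" for N
  proof -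
    have sm: "summable (\<lambda>k. C * real (k + N + 1) powr - p)"
      by (intro summable_mult suminf_powr_tail_le p N)
    show s: "summable (\<lambda>k. \<bar>g (k + N + 1)\<bar>)"
      by (rule summable_comparison_test'[OF sm, of 0]) (use g[of "_ + N + 1"] in \<open>simp add: add_ac\<close>)
    have C: "C \<ge> 0" using g[of 1] by simp
    have "(\<Sum>k. \<bar>g (k + N + 1)\<bar>) \<le> (\<Sum>k. C * real (k + N + 1) powr - p)"
      by (intro suminf_le s sm g) auto
    also have "\<dots> = C * (\<Sum>k. real (k + N + 1) powr - p)"
      by (intro suminf_mult suminf_powr_tail_le p N)
    also have "\<dots> \<le> C * (real N powr (1 - p) / (p - 1))"
      by (intro mult_left_mono suminf_powr_tail_le p N C)
    finally show "(\<Sum>k. \<bar>g (k + N + 1)\<bar>) \<le> C / (p - 1) * real N powr -(p - 1)" by simp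
  qed
  show sm: "summable (\<lambda>n. \<bar>g n\<bar>)"
    using t2[of 1] summable_iff_shift[of "\<lambda>n. \<bar>g n\<bar>" 2] by (simp add: add.assoc numeral_2_eq_2)
  obtain K where K: "K \<ge> 0" "\<And>h. h \<ge> 0 \<Longrightarrow> summable (\<lambda>n. \<bar>g n\<bar> * min 2 (real n * h))"
     "\<And>h. h \<ge> 0 \<Longrightarrow> (\<Sum>n. \<bar>g n\<bar> * min 2 (real n * h)) \<le> K * h powr (p - 1)"
    by (rule holder_of_tail[of "\<lambda>n. \<bar>g n\<bar>" "p - 1" "C / (p - 1)"]) (use p sm t1 in auto)
  show "\<exists>K\<ge>0. \<forall>z::complex. norm z \<le> 1 \<longrightarrow> norm ((\<Sum>n. of_real (g n) * z ^ n) - of_real (suminf g)) \<le> K * norm (1 - z) powr (p - 1)"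
  proof (intro exI[of _ K] conjI K allI impI)
    fix z :: complex assume z: "norm z \<le> 1"
    have s1: "summable (\<lambda>n. of_real (g n) * z ^ n)"
      by (rule summable_comparison_test'[OF sm, of 0])
         (use z in \<open>auto simp: norm_mult norm_power intro!: mult_left_le power_le_one\<close>)
    have sg: "summable g" by (rule summable_rabs_cancel[OF sm])
    have s2: "(\<lambda>n. complex_of_real (g n)) sums of_real (suminf g)"
      by (intro sums_of_real summable_sums sg)
    have "(\<lambda>n. of_real (g n) * z ^ n - of_real (g n)) sums ((\<Sum>n. of_real (g n) * z ^ n) - of_real (suminf g))"
      by (intro sums_diff s2 summable_sums s1)
    then have eq: "(\<Sum>n. of_real (g n) * z ^ n) - of_real (suminf g) = (\<Sum>n. of_real (g n) * (z ^ n - 1 ^ n))"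
      by (simp add: sums_iff algebra_simps)
    have le: "norm (of_real (g n) * (z ^ n - 1 ^ n)) \<le> \<bar>g n\<bar> * min 2 (real n * norm (1 - z))" for n
      unfolding norm_mult using norm_power_diff_min[OF z, of 1 n]
      by (simp add: norm_minus_commute mult_left_mono)
    have "norm (\<Sum>n. of_real (g n) * (z ^ n - 1 ^ n)) \<le> (\<Sum>n. \<bar>g n\<bar> * min 2 (real n * norm (1 - z)))"
      by (rule norm_suminf_le[OF le K(2)]) simp
    also have "\<dots> \<le> K * norm (1 - z) powr (p - 1)" by (rule K(3)) simp
    finally show "norm ((\<Sum>n. of_real (g n) * z ^ n) - of_real (suminf g)) \<le> K * norm (1 - z) powr (p - 1)"
      unfolding eq .
  qed
qed

text \<open>The correction left after the model tail \<open>n powr - \<beta>\<close> is replaced by the multiple of the coefficients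
of \<open>(1 - z) powr (\<beta> - 1)\<close> with the same leading order; unlike the tails themselves it is summable.\<close>

definition tail_defect :: "(nat \<Rightarrow> real) \<Rightarrow> real \<Rightarrow> real \<Rightarrow> nat \<Rightarrow> real" where
  "tail_defect t c \<beta> n = t n / c - Gamma (1 - \<beta>) * bincoef (1 - \<beta>) n"

lemma tail_defect_bound:
  assumes \<beta>: "1 / 2 < \<beta>" "\<beta> < 1" and c: "c > 0"
    and t: "\<And>n. n \<ge> 1 \<Longrightarrow> t n = c * (real n powr - \<beta> + H n)"
    and H: "H \<in> O(\<lambda>n. real n powr (- 2 * \<beta>))"
  obtains C where "C \<ge> 0" "\<And>n. n \<ge> 1 \<Longrightarrow> \<bar>tail_defect t c \<beta> n\<bar> \<le> C * real n powr -(2 * \<beta>)"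
proof -
  obtain C1 where C1: "C1 \<ge> 0" "\<And>n. n \<ge> 1 \<Longrightarrow> \<bar>H n\<bar> \<le> C1 * real n powr (- 2 * \<beta>)"
    using H by (rule bigo_nat_bound) auto
  obtain C2 where C2: "C2 \<ge> 0" "\<And>n. n \<ge> 1 \<Longrightarrow>
      \<bar>bincoef (1-\<beta>) n - rGamma (1-\<beta>) * real n powr (1-\<beta> - 1)\<bar> \<le> C2 * real n powr (1-\<beta> - 2)"
    using bincoef_rate[of "1-\<beta>"] \<beta> by auto
  have G: "Gamma (1-\<beta>) > 0" using \<beta> by (intro Gamma_real_pos) auto
  show thesis
  proof (rule that[of "C1 + Gamma (1-\<beta>) * C2"])
    show "0 \<le> C1 + Gamma (1-\<beta>) * C2" using C1 C2 G by auto
    fix n :: nat assume n: "n \<ge> 1"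
    have "Gamma (1-\<beta>) * rGamma (1-\<beta>) = 1" using G by (simp add: rGamma_inverse_Gamma)
    then have "tail_defect t c \<beta> n = H n - Gamma (1-\<beta>) * (bincoef (1-\<beta>) n - rGamma (1-\<beta>) * real n powr (1-\<beta> - 1))"
      unfolding tail_defect_def t[OF n] right_diff_distrib mult.assoc[symmetric] using c by simp
    also have "\<bar>\<dots>\<bar> \<le> C1 * real n powr (- 2 * \<beta>) + Gamma (1-\<beta>) * (C2 * real n powr (1-\<beta> - 2))"
      using C1(2)[OF n] mult_left_mono[OF C2(2)[OF n], of "Gamma (1-\<beta>)"] G
      by (intro order_trans[OF abs_triangle_ineq4] add_mono) (auto simp: abs_mult)
    also have "real n powr (1-\<beta> - 2) \<le> real n powr (- 2 * \<beta>)"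
      using n \<beta> by (intro powr_mono) auto
    finally show "\<bar>tail_defect t c \<beta> n\<bar> \<le> (C1 + Gamma (1-\<beta>) * C2) * real n powr -(2 * \<beta>)"
      using mult_left_mono[of _ _ "Gamma (1-\<beta>) * C2"] C2(1) G by (simp add: distrib_right mult.assoc)
  qed
qed

text \<open>\<open>(1 - r(z)) / (1 - z)\<close> is the generating function of the tails \<open>t\<close>. Its model part sums in closed form to
a multiple of \<open>(1 - z) powr (\<beta> - 1)\<close>, and the defect part is \<open>(2 \<beta> - 1)\<close>-Hoelder at \<open>1\<close>.\<close>

lemma one_minus_gf_expansion:
  fixes t H :: "nat \<Rightarrow> real"
  assumes \<beta>: "1 / 2 < \<beta>" "\<beta> < 1" and c: "c > 0"
    and t: "\<And>n. n \<ge> 1 \<Longrightarrow> t n = c * (real n powr - \<beta> + H n)" and t0: "t 0 = 1"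
    and H: "H \<in> O(\<lambda>n. real n powr (- 2 * \<beta>))"
    and r: "\<And>z::complex. norm z < 1 \<Longrightarrow> (\<lambda>n. of_real (t n - t (Suc n)) * z ^ Suc n) sums r z"
  obtains K where "K \<ge> 0" "\<And>z. norm z < 1 \<Longrightarrow>
    norm (1 - r z - of_real c * (of_real (Gamma (1 - \<beta>)) * (1 - z) powr of_real \<beta>
            + of_real (suminf (tail_defect t c \<beta>)) * (1 - z)))
      \<le> K * norm (1 - z) powr (2 * \<beta>)"
proof -
  obtain C where C: "C \<ge> 0" "\<And>n. n \<ge> 1 \<Longrightarrow> \<bar>tail_defect t c \<beta> n\<bar> \<le> C * real n powr -(2 * \<beta>)"
    using tail_defect_bound[OF \<beta> c t H] by blast
  define g where "g = tail_defect t c \<beta>"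
  have C': "n \<ge> 1 \<Longrightarrow> \<bar>g n\<bar> \<le> C * real n powr -(2 * \<beta>)" for n using C g_def by simp
  have p: "1 < 2*\<beta>" "2*\<beta> < 2" using \<beta> by auto
  note ps = power_series_at_1_holder[OF p C']
  from ps(2) obtain K where K: "K \<ge> 0" "\<And>z::complex. norm z \<le> 1 \<Longrightarrow>
     norm ((\<Sum>n. of_real (g n) * z ^ n) - of_real (suminf g)) \<le> K * norm (1 - z) powr (2*\<beta> - 1)"
    by blast
  show thesis
  proof (rule that[of "c * K"])
    show "0 \<le> c * K" using c K by simp
    fix z :: complex assume z: "norm z < 1"
    define u where "u = 1 - z"
    have u0: "u \<noteq> 0" using z by (auto simp: u_def)
    define S where "S = (\<Sum>n. of_real (g n) * z ^ n)"
    have sS: "(\<lambda>n. of_real (g n) * z ^ n) sums S" unfolding S_def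
      by (intro summable_sums summable_comparison_test'[OF ps(1), of 0])
         (use z in \<open>auto simp: norm_mult norm_power intro!: mult_left_le power_le_one\<close>)
    have "(\<lambda>n. of_real c * (of_real (Gamma (1-\<beta>)) * (of_real (bincoef (1-\<beta>) n) * z^n) + of_real (g n) * z ^ n))
       sums (of_real c * (of_real (Gamma (1-\<beta>)) * (1-z) powr (- of_real (1-\<beta>)) + S))" (is "_ sums ?T")
      by (intro sums_mult sums_add sS bincoef_sums z)
    moreover have "of_real c * (of_real (Gamma (1-\<beta>)) * (of_real (bincoef (1-\<beta>) n) * z^n) + of_real (g n) * z ^ n)
         = of_real (t n) * z ^ n" for n
    proof -
      have "t n = c * (Gamma (1-\<beta>) * bincoef (1-\<beta>) n + g n)" using c by (simp add: g_def tail_defect_def)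
      then show ?thesis by (simp add: algebra_simps)
    qed
    ultimately have sT: "(\<lambda>n. of_real (t n) * z ^ n) sums ?T" by simp
    have "(\<lambda>n. of_real (t (Suc n)) * z ^ Suc n) sums (?T - 1)"
      using sT sums_Suc_iff[of "\<lambda>n. of_real (t n) * z ^ n"] t0 by simp
    then have "(\<lambda>n. z * (of_real (t n) * z ^ n) - of_real (t (Suc n)) * z ^ Suc n) sums (z * ?T - (?T - 1))"
      by (intro sums_diff sums_mult sT)
    moreover have "z * (of_real (t n) * z ^ n) - of_real (t (Suc n)) * z ^ Suc n = of_real (t n - t (Suc n)) * z ^ Suc n" for n
      by (simp add: algebra_simps)
    ultimately have "r z = z * ?T - (?T - 1)"
      using r[OF z] by (simp add: sums_unique2)
    then have rz: "1 - r z = u * ?T" by (simp add: u_def algebra_simps)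
    have uu: "u * (1-z) powr (- of_real (1-\<beta>)) = u powr of_real \<beta>"
      using powr_diff[of u "of_real \<beta>" 1] u0 by (simp add: u_def)
    have e: "1 - r z - of_real c * (of_real (Gamma (1 - \<beta>)) * u powr of_real \<beta> + of_real (suminf g) * u)
        = of_real c * u * (S - of_real (suminf g))"
      unfolding rz uu[symmetric] by (simp add: algebra_simps)
    have "norm (of_real c * u * (S - of_real (suminf g))) \<le> c * norm u * (K * norm u powr (2*\<beta> - 1))"
      using K(2)[of z] z c unfolding norm_mult by (intro mult_mono) (auto simp: S_def u_def)
    also have "\<dots> = c * K * norm u powr (2*\<beta>)"
      using u0 powr_add[of "norm u" 1 "2*\<beta>-1"] by simp
    finally show "norm (1 - r z - of_real c * (of_real (Gamma (1 - \<beta>)) * (1 - z) powr of_real \<beta>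
            + of_real (suminf (tail_defect t c \<beta>)) * (1 - z))) \<le> c * K * norm (1 - z) powr (2 * \<beta>)"
      using e by (simp add: u_def g_def)
  qed
qed

text \<open>The partial sum of the geometric expansion of
\<open>1 / (b ((1 - z) powr \<beta> + \<theta> (1 - z)))\<close> in powers of \<open>\<theta> (1 - z) powr (1 - \<beta>)\<close>.\<close>

definition singular_part :: "real \<Rightarrow> real \<Rightarrow> real \<Rightarrow> nat \<Rightarrow> complex \<Rightarrow> complex" where
  "singular_part b \<theta> \<beta> K z =
    (\<Sum>k\<le>K. of_real ((- \<theta>) ^ k / b) * (1 - z) powr (- of_real (\<beta> - real k * (1 - \<beta>))))"

text \<open>Put \<open>s = - \<theta> (1 - z) powr (1 - \<beta>)\<close>. Up to \<open>O(|1 - z| powr \<beta>)\<close>, the product of \<open>w\<close> and the partial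
sum is \<open>1 - s ^ (K + 1)\<close>, and the condition on \<open>K\<close> makes \<open>s ^ (K + 1)\<close> of that order as well. Division
by \<open>w\<close>, which is at least of order \<open>|1 - z| powr \<beta>\<close>, leaves a bounded error.\<close>

lemma reciprocal_expansion:
  fixes w :: "complex \<Rightarrow> complex" and b :: real
  assumes \<beta>: "1 / 2 < \<beta>" "\<beta> < 1" and b: "b > 0" and K: "(real K + 1) * (1 - \<beta>) \<ge> \<beta>"
    and w: "\<And>z. norm z < 1 \<Longrightarrow> norm (w z - of_real b * ((1 - z) powr of_real \<beta> + of_real \<theta> * (1 - z)))
      \<le> C * norm (1 - z) powr (2 * \<beta>)" and C: "C \<ge> 0"
  obtains \<delta> c1 C1 where "\<delta> > 0" "c1 > 0" "C1 \<ge> 0"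
    "\<And>z. norm z < 1 \<Longrightarrow> norm (1 - z) < \<delta> \<Longrightarrow> norm (w z) \<ge> c1 * norm (1 - z) powr \<beta>"
    "\<And>z. norm z < 1 \<Longrightarrow> norm (1 - z) < \<delta> \<Longrightarrow> norm (1 / w z - singular_part b \<theta> \<beta> K z) \<le> C1"
proof -
  let ?F = "\<lambda>x::real. \<bar>\<theta>\<bar> * x powr (1-\<beta>) + C/b * x powr \<beta>"
  have "(?F \<longlongrightarrow> \<bar>\<theta>\<bar> * 0 powr (1-\<beta>) + C/b * 0 powr \<beta>) (at_right 0)"
    using \<beta> by (intro tendsto_intros) (auto simp: eventually_at_filter)
  then have "eventually (\<lambda>x. ?F x < 1/2) (at_right 0)"
    by (rule order_tendstoD) (use \<beta> in auto)
  then obtain \<delta>0 where \<delta>0: "\<delta>0 > 0" "\<And>x. 0 < x \<Longrightarrow> x < \<delta>0 \<Longrightarrow> ?F x < 1/2"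
    by (auto simp: eventually_at_right_field)
  define \<delta> where "\<delta> = min \<delta>0 1"
  define E where "E = (\<Sum>k\<le>K. \<bar>\<theta>\<bar> ^ k)"
  have E0: "E \<ge> 0" unfolding E_def by (intro sum_nonneg) auto
  define C1 where "C1 = 2 / b * (\<bar>\<theta>\<bar> ^ Suc K + E * (C / b))"
  have both: "norm (w z) \<ge> b/2 * norm (1 - z) powr \<beta> \<and> norm (1 / w z - singular_part b \<theta> \<beta> K z) \<le> C1"
    if z: "norm z < 1" "norm (1 - z) < \<delta>" for z
  proof -
    define u where "u = 1 - z"
    have u0: "u \<noteq> 0" using z by (auto simp: u_def)
    define x where "x = norm u"
    have x: "0 < x" "x < 1" "?F x < 1/2" using \<delta>0 u0 z by (auto simp: x_def u_def \<delta>_def)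
    define q where "q = u powr of_real (1-\<beta>)"
    have nq: "norm q = x powr (1-\<beta>)" unfolding q_def x_def by (rule norm_powr_of_real)
    define ub where "ub = u powr of_real \<beta>"
    have ub: "ub \<noteq> 0" "norm ub = x powr \<beta>" "ub * q = u"
      using u0 by (auto simp: ub_def q_def x_def norm_powr_of_real powr_add[symmetric])
    define err where "err = w z / (of_real b * ub) - (1 + of_real \<theta> * q)"
    have wz: "w z = of_real b * ub * (1 + of_real \<theta> * q + err)"
      using ub(1) b by (simp add: err_def)
    have "of_real b * ub * err = w z - of_real b * (ub + of_real \<theta> * u)"
      unfolding wz ub(3)[symmetric] by (simp add: algebra_simps)
    then have "norm (of_real b * ub * err) \<le> C * x powr (2*\<beta>)"
      using w[OF z(1)] by (simp add: ub_def u_def x_def)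
    also have "x powr (2*\<beta>) = x powr \<beta> * x powr \<beta>" by (simp add: powr_add[symmetric])
    finally have nerr: "norm err \<le> C/b * x powr \<beta>"
      using b x by (simp add: norm_mult ub field_simps)
    have "norm (of_real \<theta> * q + err) \<le> ?F x"
      using nerr by (intro order_trans[OF norm_triangle_ineq] add_mono) (auto simp: norm_mult nq)
    then have half: "norm (1 + of_real \<theta> * q + err) \<ge> 1/2"
    proof -
      define v where "v = of_real \<theta> * q + err"
      have "norm v < 1/2" using \<open>norm (of_real \<theta> * q + err) \<le> ?F x\<close> x(3) unfolding v_def by linarith
      moreover have "1 - norm v \<le> norm (1 + v)"
        using norm_triangle_ineq2[of 1 "- v"] by simp
      ultimately show ?thesis unfolding v_def add.assoc by linarith
    qed
    have nw: "norm (w z) \<ge> b/2 * x powr \<beta>"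
      using mult_left_mono[OF half, of "b * x powr \<beta>"] b x unfolding wz norm_mult ub by simp
    have "b/2 * x powr \<beta> > 0" using b x by simp
    then have w0: "w z \<noteq> 0" using nw by (metis norm_zero not_less)
    have qk: "u powr (- of_real (\<beta> - real k * (1 - \<beta>))) = q ^ k / ub" for k
    proof -
      have "u powr (- of_real (\<beta> - real k * (1 - \<beta>))) = u powr (of_real (real k * (1-\<beta>)) - of_real \<beta>)"
        by (simp add: algebra_simps)
      also have "\<dots> = u powr (of_real (real k * (1-\<beta>))) / ub" by (simp add: powr_diff ub_def)
      finally show ?thesis unfolding q_def using powr_of_real_power[OF u0, of "1-\<beta>" k] by simp
    qed
    define s where "s = - (of_real \<theta> * q)"
    have sp: "singular_part b \<theta> \<beta> K z = (\<Sum>k\<le>K. s ^ k) / (of_real b * ub)"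
      unfolding singular_part_def u_def[symmetric] qk s_def sum_divide_distrib
      by (intro sum.cong) (auto simp: power_minus[of "of_real \<theta>"] power_minus[of "of_real \<theta> * q"] power_mult_distrib)
    have "(\<Sum>k\<le>K. s ^ k) * (1 - s) = 1 - s ^ Suc K"
      using sum_gp_basic[of s K] by (simp add: mult.commute)
    then have sw: "singular_part b \<theta> \<beta> K z * w z - 1 = - (s ^ Suc K) + (\<Sum>k\<le>K. s ^ k) * err"
      unfolding sp wz using b ub(1) by (simp add: s_def algebra_simps)
    have "norm (- (s ^ Suc K)) \<le> \<bar>\<theta>\<bar> ^ Suc K * x powr \<beta>"
    proof -
      have "norm q ^ Suc K = x powr ((real K + 1) * (1-\<beta>))"
      proof -
        have "(x powr (1-\<beta>)) ^ Suc K = (x powr (1-\<beta>)) powr real (Suc K)"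
          by (rule powr_realpow[symmetric]) (use x in simp)
        then show ?thesis unfolding nq by (simp add: powr_powr algebra_simps)
      qed
      also have "\<dots> \<le> x powr \<beta>" using x K by (intro powr_mono') auto
      finally show ?thesis unfolding s_def norm_minus_cancel norm_power norm_mult power_mult_distrib
        by (intro mult_mono) auto
    qed
    moreover have "norm ((\<Sum>k\<le>K. s ^ k) * err) \<le> E * (C/b * x powr \<beta>)"
    proof -
      have "norm (\<Sum>k\<le>K. s ^ k) \<le> (\<Sum>k\<le>K. \<bar>\<theta>\<bar> ^ k)"
      proof (rule sum_norm_le)
        fix k
        have "norm q \<le> 1" unfolding nq using x \<beta> by (simp add: powr_le1)
        then show "norm (s ^ k) \<le> \<bar>\<theta>\<bar> ^ k"
          unfolding s_def norm_power norm_minus_cancel norm_mult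
          by (intro power_mono) (auto intro!: mult_left_le)
      qed
      then show ?thesis unfolding norm_mult E_def by (intro mult_mono nerr) (auto intro!: sum_nonneg)
    qed
    ultimately have "norm (- (s ^ Suc K)) + norm ((\<Sum>k\<le>K. s ^ k) * err)
        \<le> \<bar>\<theta>\<bar> ^ Suc K * x powr \<beta> + E * (C/b * x powr \<beta>)"
      by linarith
    then have num: "norm (singular_part b \<theta> \<beta> K z * w z - 1) \<le> (\<bar>\<theta>\<bar> ^ Suc K + E * (C/b)) * x powr \<beta>"
      unfolding sw distrib_right mult.assoc by (rule order_trans[OF norm_triangle_ineq])
    have sw': "1 / w z - singular_part b \<theta> \<beta> K z = - (singular_part b \<theta> \<beta> K z * w z - 1) / w z"
      using w0 by (simp add: field_simps)
    have "norm (1 / w z - singular_part b \<theta> \<beta> K z) = norm (singular_part b \<theta> \<beta> K z * w z - 1) / norm (w z)"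
      unfolding sw' norm_divide norm_minus_cancel ..
    also have "\<dots> \<le> ((\<bar>\<theta>\<bar> ^ Suc K + E * (C/b)) * x powr \<beta>) / (b/2 * x powr \<beta>)"
      by (intro frac_le num nw) (use b x E0 C in auto)
    also have "\<dots> = C1" unfolding C1_def using x b by (simp add: field_simps)
    finally show ?thesis using nw by (simp add: x_def u_def)
  qed
  show thesis
    by (rule that[of \<delta> "b/2" C1]) (use both \<delta>0 b C E0 in \<open>auto simp: \<delta>_def C1_def\<close>)
qed

text \<open>The mean value estimate gives the factor \<open>|z - z'| |1 - z| powr (- a - 1)\<close>; it is weakened to the
\<open>\<beta>\<close>-Hoelder form that \<open>T(z)\<close> itself satisfies, using \<open>|z - z'| \<le> |1 - z|\<close>.\<close>

lemma one_minus_powr_lipschitz: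
  fixes a \<beta> :: real
  assumes \<beta>: "0 < \<beta>" "\<beta> < 1" and a: "a \<le> \<beta>"
  obtains C where "C \<ge> 0"
    "\<And>z z' :: complex. norm z < 1 \<Longrightarrow> norm z' < 1 \<Longrightarrow> norm (z - z') \<le> norm (1 - z) / 2 \<Longrightarrow>
      norm ((1 - z') powr (- of_real a) - (1 - z) powr (- of_real a))
        \<le> C * norm (z - z') powr \<beta> * norm (1 - z) powr (- 2 * \<beta>)"
proof -
  define B where "B = \<bar>a\<bar> * ((1/2) powr (-a-1) + (3/2) powr (-a-1))"
  have B0: "B \<ge> 0" by (simp add: B_def)
  have "norm ((1 - z') powr (- of_real a) - (1 - z) powr (- of_real a))
        \<le> B * 2 powr (\<beta> - a) * norm (z - z') powr \<beta> * norm (1 - z) powr (- 2 * \<beta>)"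
    if z: "norm z < 1" "norm z' < 1" "norm (z - z') \<le> norm (1 - z) / 2" for z z' :: complex
  proof -
    define h where "h = norm (1 - z)"
    have h: "0 < h" "h \<le> 2" using z norm_triangle_ineq4[of 1 z] by (auto simp: h_def)
    have D: "norm (of_real a * (1 - \<xi>) powr (- of_real a - 1)) \<le> B * h powr (-a-1)"
      and DD: "((\<lambda>\<xi>. (1 - \<xi>) powr (- of_real a)) has_field_derivative of_real a * (1 - \<xi>) powr (- of_real a - 1)) (at \<xi> within S)"
      if \<xi>: "\<xi> \<in> closed_segment z z'" for \<xi> S
    proof -
      have "closed_segment z z' \<subseteq> ball 0 1"
        by (rule closed_segment_subset) (use z in auto)
      then have n1: "norm \<xi> < 1" using \<xi> by auto
      then have "1 - \<xi> \<notin> \<real>\<^sub>\<le>\<^sub>0" using complex_Re_le_cmod[of \<xi>] by (auto simp: complex_nonpos_Reals_iff)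
      then show "((\<lambda>\<xi>. (1 - \<xi>) powr (- of_real a)) has_field_derivative of_real a * (1 - \<xi>) powr (- of_real a - 1)) (at \<xi> within S)"
        by (auto intro!: derivative_eq_intros)
      have "dist \<xi> z \<le> dist z z'" using \<xi> by (metis dist_commute dist_in_closed_segment(1))
      then have d: "norm (\<xi> - z) \<le> h/2" using z(3) by (simp add: dist_norm h_def)
      have lo: "norm (1 - \<xi>) \<ge> h/2" using norm_triangle_ineq2[of "1 - z" "\<xi> - z"] d by (simp add: h_def)
      have hi: "norm (1 - \<xi>) \<le> 3*h/2" using norm_triangle_ineq4[of "1 - z" "\<xi> - z"] d by (simp add: h_def)
      have "norm (1 - \<xi>) powr (-a-1) \<le> (h/2) powr (-a-1) + (3*h/2) powr (-a-1)"
      proof (cases "-a-1 \<ge> 0")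
        case True
        then have "norm (1 - \<xi>) powr (-a-1) \<le> (3*h/2) powr (-a-1)" using hi by (intro powr_mono2) auto
        then show ?thesis by (simp add: add_increasing)
      next
        case False
        then have "norm (1 - \<xi>) powr (-a-1) \<le> (h/2) powr (-a-1)" using lo h by (intro powr_mono2') auto
        then show ?thesis by (simp add: add_increasing2)
      qed
      also have "(h/2) powr (-a-1) = (1/2) powr (-a-1) * h powr (-a-1)"
        using h powr_mult[of "1/2" h "-a-1"] by simp
      also have "(3*h/2) powr (-a-1) = (3/2) powr (-a-1) * h powr (-a-1)"
        using h powr_mult[of "3/2" h "-a-1"] by simp
      finally have "\<bar>a\<bar> * norm (1 - \<xi>) powr (-a-1) \<le> \<bar>a\<bar> * ((1/2) powr (-a-1) * h powr (-a-1) + (3/2) powr (-a-1) * h powr (-a-1))"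
        by (intro mult_left_mono) auto
      moreover have "norm ((1 - \<xi>) powr (- of_real a - 1)) = norm (1 - \<xi>) powr (-a-1)"
        using norm_powr_of_real[of "1-\<xi>" "-a-1"] by simp
      ultimately show "norm (of_real a * (1 - \<xi>) powr (- of_real a - 1)) \<le> B * h powr (-a-1)"
        by (simp add: B_def norm_mult algebra_simps)
    qed
    have "norm ((1 - z') powr (- of_real a) - (1 - z) powr (- of_real a)) \<le> B * h powr (-a-1) * norm (z' - z)"
      by (rule field_differentiable_bound[OF convex_closed_segment[of z z'] DD D]) auto
    also have "norm (z' - z) = norm (z - z') powr \<beta> * norm (z - z') powr (1-\<beta>)"
      by (cases "z = z'") (simp_all add: powr_add[symmetric] norm_minus_commute)
    also have "B * h powr (-a-1) * (norm (z - z') powr \<beta> * norm (z - z') powr (1-\<beta>))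
        \<le> B * h powr (-a-1) * (norm (z - z') powr \<beta> * h powr (1-\<beta>))"
    proof (intro mult_left_mono powr_mono2)
      show "norm (z - z') \<le> h" using z(3) h(1) unfolding h_def by linarith
    qed (use \<beta> B0 in auto)
    also have "B * h powr (-a-1) * (norm (z - z') powr \<beta> * h powr (1-\<beta>))
        = B * norm (z - z') powr \<beta> * h powr (- 2 * \<beta>) * h powr (\<beta> - a)"
    proof -
      have "h powr (-a-1) * h powr (1-\<beta>) = h powr (- 2 * \<beta>) * h powr (\<beta> - a)"
        unfolding powr_add[symmetric] by (rule arg_cong[where f = "(powr) h"]) simp
      then show ?thesis by (simp add: mult_ac)
    qed
    also have "\<dots> \<le> B * norm (z - z') powr \<beta> * h powr (- 2 * \<beta>) * 2 powr (\<beta> - a)"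
      using h a B0 by (intro mult_left_mono powr_mono2) auto
    finally show ?thesis using B0 by (simp add: h_def mult_ac)
  qed
  then show thesis using that[of "B * 2 powr (\<beta> - a)"] B0 by simp
qed

lemma singular_part_lipschitz:
  fixes b \<theta> \<beta> :: real
  assumes \<beta>: "0 < \<beta>" "\<beta> < 1"
  obtains C where "C \<ge> 0"
    "\<And>z z' :: complex. norm z < 1 \<Longrightarrow> norm z' < 1 \<Longrightarrow> norm (z - z') \<le> norm (1 - z) / 2 \<Longrightarrow>
      norm (singular_part b \<theta> \<beta> K z' - singular_part b \<theta> \<beta> K z)
        \<le> C * norm (z - z') powr \<beta> * norm (1 - z) powr (- 2 * \<beta>)"
proof -
  have "\<exists>C\<ge>0. \<forall>z z' :: complex. norm z < 1 \<longrightarrow> norm z' < 1 \<longrightarrow> norm (z - z') \<le> norm (1 - z) / 2 \<longrightarrow>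
      norm ((1 - z') powr (- of_real (\<beta> - real k * (1-\<beta>))) - (1 - z) powr (- of_real (\<beta> - real k * (1-\<beta>))))
        \<le> C * norm (z - z') powr \<beta> * norm (1 - z) powr (- 2 * \<beta>)" for k
    by (rule one_minus_powr_lipschitz[OF \<beta>, of "\<beta> - real k * (1-\<beta>)"]) (use \<beta> in auto)
  then obtain C where C: "\<And>k. C k \<ge> 0"
    "\<And>k (z::complex) z'. norm z < 1 \<Longrightarrow> norm z' < 1 \<Longrightarrow> norm (z - z') \<le> norm (1 - z) / 2 \<Longrightarrow>
      norm ((1 - z') powr (- of_real (\<beta> - real k * (1-\<beta>))) - (1 - z) powr (- of_real (\<beta> - real k * (1-\<beta>))))
        \<le> C k * norm (z - z') powr \<beta> * norm (1 - z) powr (- 2 * \<beta>)"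
    by metis
  define A where "A k = \<bar>(-\<theta>)^k / b\<bar>" for k
  show thesis
  proof (rule that[of "\<Sum>k\<le>K. A k * C k"])
    show "(\<Sum>k\<le>K. A k * C k) \<ge> 0" by (intro sum_nonneg mult_nonneg_nonneg C) (auto simp: A_def)
    fix z z' :: complex assume z: "norm z < 1" "norm z' < 1" "norm (z - z') \<le> norm (1 - z) / 2"
    define D where "D k = (1 - z') powr (- of_real (\<beta> - real k * (1-\<beta>))) - (1 - z) powr (- of_real (\<beta> - real k * (1-\<beta>)))" for k
    define X where "X = norm (z - z') powr \<beta> * norm (1 - z) powr (- 2 * \<beta>)"
    have D: "norm (D k) \<le> C k * X" for k
      using C(2)[OF z, of k] unfolding D_def X_def by (simp only: mult.assoc)
    have "singular_part b \<theta> \<beta> K z' - singular_part b \<theta> \<beta> K z = (\<Sum>k\<le>K. of_real ((- \<theta>) ^ k / b) * D k)"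
      unfolding singular_part_def D_def right_diff_distrib sum_subtractf ..
    moreover have "norm (\<Sum>k\<le>K. of_real ((- \<theta>) ^ k / b) * D k) \<le> (\<Sum>k\<le>K. A k * C k * X)"
    proof (rule sum_norm_le)
      show "norm (of_real ((- \<theta>) ^ k / b) * D k) \<le> A k * C k * X" for k
        unfolding norm_mult norm_of_real A_def mult.assoc by (intro mult_left_mono D) auto
    qed
    ultimately show "norm (singular_part b \<theta> \<beta> K z' - singular_part b \<theta> \<beta> K z)
        \<le> (\<Sum>k\<le>K. A k * C k) * norm (z - z') powr \<beta> * norm (1 - z) powr (- 2 * \<beta>)"
      by (simp only: sum_distrib_right X_def mult.assoc)
  qed
qed

lemma singular_part_bound:
  fixes b \<theta> \<beta> :: real
  assumes \<beta>: "0 < \<beta>" "\<beta> < 1"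
  obtains C where "C \<ge> 0" "\<And>z. norm z < 1 \<Longrightarrow> norm (singular_part b \<theta> \<beta> K z) \<le> C * norm (1 - z) powr - \<beta>"
proof
  define C where "C = (\<Sum>k\<le>K. \<bar>(-\<theta>)^k / b\<bar> * 2 powr (real k * (1-\<beta>)))"
  show "C \<ge> 0" unfolding C_def by (intro sum_nonneg) auto
  fix z :: complex assume z: "norm z < 1"
  define h where "h = norm (1 - z)"
  have h: "0 < h" "h \<le> 2" using z norm_triangle_ineq4[of 1 z] by (auto simp: h_def)
  have "norm (singular_part b \<theta> \<beta> K z) \<le> (\<Sum>k\<le>K. \<bar>(-\<theta>)^k / b\<bar> * 2 powr (real k * (1-\<beta>)) * h powr - \<beta>)"
    unfolding singular_part_def
  proof (rule sum_norm_le)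
    fix k
    have "norm ((1 - z) powr (- of_real (\<beta> - real k * (1-\<beta>)))) = h powr (- (\<beta> - real k * (1-\<beta>)))"
      using norm_powr_of_real[of "1 - z" "- (\<beta> - real k * (1-\<beta>))"] by (simp add: h_def)
    also have "\<dots> = h powr (real k * (1-\<beta>)) * h powr - \<beta>"
      by (simp add: powr_add[symmetric] algebra_simps)
    also have "\<dots> \<le> 2 powr (real k * (1-\<beta>)) * h powr - \<beta>"
      using h \<beta> by (intro mult_right_mono powr_mono2) auto
    finally show "norm (of_real ((- \<theta>) ^ k / b) * (1 - z) powr (- of_real (\<beta> - real k * (1-\<beta>))))
      \<le> \<bar>(-\<theta>)^k / b\<bar> * 2 powr (real k * (1-\<beta>)) * h powr - \<beta>"
      unfolding norm_mult norm_of_real mult.assoc by (intro mult_left_mono) auto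
  qed
  then show "norm (singular_part b \<theta> \<beta> K z) \<le> C * norm (1 - z) powr - \<beta>"
    by (simp add: C_def sum_distrib_right h_def)
qed

section \<open>The oscillatory constants\<close>

text \<open>Jordan's inequality, from the concavity of the cosine on \<open>{0..pi/2}\<close>.\<close>

lemma cos_ge_linear:
  fixes x :: real
  assumes "0 \<le> x" "x \<le> pi / 2" shows "cos x \<ge> 1 - 2 * x / pi"
proof -
  have "convex_on {0..pi/2} (\<lambda>x::real. - cos x)"
  proof (rule f''_ge0_imp_convex)
    show "convex {0..pi/2}" by (rule convex_real_interval)
    show "((\<lambda>x. - cos x) has_real_derivative sin x) (at x)" for x :: real
      by (auto intro!: derivative_eq_intros)
    show "(sin has_real_derivative cos x) (at x)" for x :: real
      by (auto intro!: derivative_eq_intros)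
    show "0 \<le> cos x" if "x \<in> {0..pi/2}" for x
      using that by (intro cos_ge_zero) auto
  qed
  then have "- cos ((1 - 2 * x / pi) *\<^sub>R 0 + (2 * x / pi) *\<^sub>R (pi/2)) \<le> (1 - 2 * x / pi) * (- cos 0) + (2 * x / pi) * (- cos (pi/2))"
    by (rule convex_onD) (use assms in \<open>auto simp: divide_le_eq\<close>)
  then show ?thesis by simp
qed

text \<open>A Henstock-Kurzweil integral over a half-line is an improper integral, even when it converges only
conditionally.\<close>

lemma has_integral_improper_at_top:
  fixes f :: "real \<Rightarrow> 'a::banach"
  assumes int: "\<And>b. b \<ge> 0 \<Longrightarrow> f integrable_on {0..b}"
    and lim: "((\<lambda>b. integral {0..b} f) \<longlongrightarrow> I) at_top"
  shows "(f has_integral I) {0<..}"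
proof -
  have "(f has_integral I) {0..}"
    unfolding has_integral_alt'
  proof (intro conjI allI impI)
    fix a b :: real
    have Icc: "{0..} \<inter> cbox a b = {max a 0..b}" by auto
    have "f integrable_on {max a 0..b}"
    proof (cases "max a 0 \<le> b")
      case True
      then show ?thesis by (intro integrable_subinterval_real[OF int[of b]]) auto
    next
      case False
      then have e: "{max a 0..b} = {}" by auto
      show ?thesis unfolding e by (rule has_integral_integrable[OF has_integral_empty])
    qed
    then show "(\<lambda>x. if x \<in> {0..} then f x else 0) integrable_on cbox a b"
      by (simp only: integrable_restrict_Int Icc)
  next
    fix e :: real assume e: "e > 0"
    then obtain B where B: "\<And>b. b \<ge> B \<Longrightarrow> dist (integral {0..b} f) I < e"
      using tendstoD[OF lim e] by (auto simp: eventually_at_top_linorder)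
    show "\<exists>B>0. \<forall>a b. ball 0 B \<subseteq> cbox a b \<longrightarrow> norm (integral (cbox a b) (\<lambda>x. if x \<in> {0..} then f x else 0) - I) < e"
    proof (intro exI[of _ "max B 1"] conjI allI impI)
      fix a b :: real assume sub: "ball 0 (max B 1) \<subseteq> cbox a b"
      have "ball (0::real) (max B 1) = {- max B 1 <..< max B 1}" by (auto simp: dist_real_def)
      with sub have "{- max B 1 <..< max B 1} \<subseteq> {a..b}" by simp
      then have ab: "a \<le> - max B 1" "max B 1 \<le> b"
        unfolding greaterThanLessThan_subseteq_atLeastAtMost_iff by auto
      have "{0..} \<inter> cbox a b = {0..b}" using ab by auto
      then have "integral (cbox a b) (\<lambda>x. if x \<in> {0..} then f x else 0) = integral {0..b} f"
        by (simp only: integral_restrict_Int)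
      then show "norm (integral (cbox a b) (\<lambda>x. if x \<in> {0..} then f x else 0) - I) < e"
        using B[of b] ab by (simp add: dist_norm)
    qed simp
  qed
  moreover have "negligible {x \<in> {0<..} - {0..}. f x \<noteq> 0}"
    by (rule negligible_subset[OF negligible_empty]) auto
  moreover have "negligible {x \<in> {0..} - {0<..}. f x \<noteq> 0}"
    by (rule negligible_subset[OF negligible_sing[of 0]]) auto
  ultimately show ?thesis
    using has_integral_spike_set_eq[of "{0<..}" "{0..}" f I] by blast
qed

text \<open>The entire function \<open>w powr (p - 1) \<gamma>(1 - p, w)\<close>, where \<open>\<gamma>\<close> is the lower incomplete Gamma
function. Being entire, it can be evaluated along any ray without crossing a branch cut.\<close>

definition inc_gamma :: "real \<Rightarrow> complex \<Rightarrow> complex" where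
  "inc_gamma p w = (\<Sum>k. of_real ((-1) ^ k / (fact k * (real k + 1 - p))) * w ^ k)"

lemma inc_gamma_deriv:
  assumes p: "0 < p" "p < 1"
  obtains D where "\<And>w. (inc_gamma p has_field_derivative D w) (at w)"
    "\<And>w. of_real (1 - p) * inc_gamma p w + w * D w = exp (- w)"
proof -
  define c where "c k = complex_of_real ((-1) ^ k / (fact k * (real k + 1 - p)))" for k
  have le: "norm (c k * w ^ k) \<le> 1 / (1 - p) * (norm w ^ k /\<^sub>R fact k)" for k w
  proof -
    have "1 / (real k + 1 - p) \<le> 1 / (1 - p)" using p by (intro divide_left_mono) auto
    then have "1 / (real k + 1 - p) * (norm w ^ k / fact k) \<le> 1 / (1 - p) * (norm w ^ k / fact k)"
      by (intro mult_right_mono) auto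
    moreover have "norm (c k * w ^ k) = 1 / (real k + 1 - p) * (norm w ^ k / fact k)"
      unfolding c_def norm_mult norm_of_real norm_power using p by (simp add: abs_divide abs_mult power_abs)
    ultimately show ?thesis by (simp add: divide_inverse mult_ac)
  qed
  have sm: "summable (\<lambda>k. c k * w ^ k)" for w
    by (rule summable_comparison_test'[OF summable_mult[OF summable_exp_generic[of "norm w"], of "1/(1-p)"] le])
  define D where "D w = (\<Sum>n. diffs c n * w ^ n)" for w
  have D: "(inc_gamma p has_field_derivative D w) (at w)" for w
    using termdiffs_strong_converges_everywhere[of c w, OF sm]
    unfolding D_def inc_gamma_def[abs_def] c_def .
  have "of_real (1 - p) * inc_gamma p w + w * D w = exp (- w)" for w
  proof -
    have s1: "(\<lambda>k. of_real (1 - p) * (c k * w ^ k)) sums (of_real (1 - p) * inc_gamma p w)"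
      unfolding inc_gamma_def c_def[symmetric] by (intro sums_mult summable_sums sm)
    have sd: "summable (\<lambda>n. diffs c n * w ^ n)"
      by (rule termdiff_converges_all[OF sm])
    have "(\<lambda>k. w * (diffs c k * w ^ k)) sums (w * D w)"
      unfolding D_def by (intro sums_mult summable_sums sd)
    moreover have "w * (diffs c k * w ^ k) = of_nat (Suc k) * c (Suc k) * w ^ Suc k" for k
      by (simp add: diffs_def)
    ultimately have "(\<lambda>k. of_nat (Suc k) * c (Suc k) * w ^ Suc k) sums (w * D w)" by simp
    then have s2: "(\<lambda>k. of_nat k * c k * w ^ k) sums (w * D w)"
      using sums_Suc_iff[of "\<lambda>k. of_nat k * c k * w ^ k" "w * D w"] by simp
    have "(\<lambda>k. of_real (1 - p) * (c k * w ^ k) + of_nat k * c k * w ^ k) sums (of_real (1 - p) * inc_gamma p w + w * D w)"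
      by (rule sums_add[OF s1 s2])
    moreover have "of_real (1 - p) * (c k * w ^ k) + of_nat k * c k * w ^ k = (- w) ^ k /\<^sub>R fact k" for k
    proof -
      have "(1 - p) * ((-1) ^ k / (fact k * (real k + 1 - p))) + real k * ((-1) ^ k / (fact k * (real k + 1 - p)))
          = ((1 - p) + real k) * ((-1) ^ k / (fact k * (real k + 1 - p)))"
        by (rule distrib_right[symmetric])
      also have "\<dots> = (-1) ^ k / fact k"
      proof -
        define d where "d = real k + 1 - p"
        have "d \<noteq> 0" "(1 - p) + real k = d" using p by (auto simp: d_def)
        then show ?thesis unfolding d_def[symmetric] by simp
      qed
      finally have e: "(1 - p) * ((-1) ^ k / (fact k * (real k + 1 - p))) + real k * ((-1) ^ k / (fact k * (real k + 1 - p)))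
          = (-1) ^ k / fact k" .
      have "of_real (1 - p) * (c k * w ^ k) + of_nat k * c k * w ^ k
         = of_real ((1 - p) * ((-1) ^ k / (fact k * (real k + 1 - p))) + real k * ((-1) ^ k / (fact k * (real k + 1 - p)))) * w ^ k"
        by (simp add: c_def distrib_right mult.assoc)
      also have "\<dots> = (- w) ^ k /\<^sub>R fact k" unfolding e by (simp add: power_minus[of w] scaleR_conv_of_real field_simps)
      finally show ?thesis .
    qed
    ultimately have "(\<lambda>k. (- w) ^ k /\<^sub>R fact k) sums (of_real (1 - p) * inc_gamma p w + w * D w)" by simp
    then show ?thesis using exp_converges[of "- w"] sums_unique2 by blast
  qed
  then show thesis using that D by blast
qed

lemma inc_gamma_integral:
  assumes p: "0 < p" "p < 1" and b: "b \<ge> 0"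
  shows "((\<lambda>x. exp (- s * of_real x) * of_real (x powr - p)) has_integral
     of_real (b powr (1 - p)) * inc_gamma p (s * of_real b)) {0..b}"
proof -
  obtain D where D: "\<And>w. (inc_gamma p has_field_derivative D w) (at w)"
    "\<And>w. of_real (1 - p) * inc_gamma p w + w * D w = exp (- w)"
    by (rule inc_gamma_deriv[OF p]) blast
  have contM: "continuous_on UNIV (inc_gamma p)"
    by (intro continuous_at_imp_continuous_on ballI DERIV_isCont[OF D(1)])
  define F where "F x = of_real (x powr (1 - p)) * inc_gamma p (s * of_real x)" for x
  have "((\<lambda>x. exp (- s * of_real x) * of_real (x powr - p)) has_integral (F b - F 0)) {0..b}"
  proof (rule fundamental_theorem_of_calculus_interior[OF b])
    show "continuous_on {0..b} F"
      unfolding F_def using p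
      by (intro continuous_intros continuous_on_compose2[OF contM] continuous_on_powr') auto
    fix x assume x: "x \<in> {0<..<b}"
    have d1: "((\<lambda>x. complex_of_real (x powr (1 - p))) has_vector_derivative of_real ((1 - p) * x powr (- p))) (at x)"
      using has_real_derivative_powr[of x "1 - p"] x
      by (intro has_vector_derivative_of_real) (simp add: has_real_derivative_iff_has_vector_derivative)
    have d2: "((\<lambda>x. inc_gamma p (s * of_real x)) has_vector_derivative (s * D (s * of_real x))) (at x)"
    proof -
      have "((\<lambda>x. s * of_real x) has_vector_derivative s) (at x)"
        by (auto intro!: derivative_eq_intros)
      from field_vector_diff_chain_at[OF this D(1)] show ?thesis by (simp add: o_def)
    qed
    have "(F has_vector_derivative (of_real (x powr (1 - p)) * (s * D (s * of_real x)) + of_real ((1 - p) * x powr (- p)) * inc_gamma p (s * of_real x))) (at x)"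
      unfolding F_def by (rule has_vector_derivative_mult[OF d1 d2])
    also have "x powr (1 - p) = x powr (- p) * x"
      using powr_add[of x "- p" 1] x by simp
    also have "of_real (x powr (- p) * x) * (s * D (s * of_real x)) + of_real ((1 - p) * x powr (- p)) * inc_gamma p (s * of_real x)
        = of_real (x powr - p) * (of_real (1 - p) * inc_gamma p (s * of_real x) + (s * of_real x) * D (s * of_real x))"
      by (simp add: algebra_simps)
    also have "\<dots> = exp (- s * of_real x) * of_real (x powr - p)" unfolding D(2) by simp
    finally show "(F has_vector_derivative exp (- s * of_real x) * of_real (x powr - p)) (at x)" .
  qed
  then show ?thesis by (simp add: F_def)
qed

lemma inc_gamma_real_limit:
  assumes p: "0 < p" "p < 1"
  shows "((\<lambda>b. of_real (b powr (1 - p)) * inc_gamma p (of_real b)) \<longlongrightarrow> of_real (Gamma (1 - p))) at_top"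
proof -
  define f where "f t = t powr (1 - p - 1) / exp t" for t :: real
  have G: "(f has_integral Gamma (1 - p)) {0..}"
    unfolding f_def by (rule Gamma_integral_real) (use p in auto)
  have ev: "of_real (b powr (1 - p)) * inc_gamma p (of_real b) = of_real (integral {0..b} f)" if "b \<ge> 0" for b
  proof -
    have "((\<lambda>x. exp (- 1 * complex_of_real x) * of_real (x powr - p)) has_integral
     of_real (b powr (1 - p)) * inc_gamma p (1 * of_real b)) {0..b}"
      by (rule inc_gamma_integral[OF p that])
    moreover have "exp (- 1 * complex_of_real x) * of_real (x powr - p) = of_real (f x)" for x
      by (simp add: f_def exp_minus field_simps flip: exp_of_real)
    ultimately have h: "((\<lambda>x. complex_of_real (f x)) has_integral of_real (b powr (1 - p)) * inc_gamma p (of_real b)) {0..b}" by simp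
    have "f integrable_on {0..}" using G by blast
    then have "f integrable_on {0..b}" by (rule integrable_on_subinterval) auto
    then have "((\<lambda>x. complex_of_real (f x)) has_integral of_real (integral {0..b} f)) {0..b}"
      by (intro has_integral_of_real integrable_integral)
    then show ?thesis using h has_integral_unique by blast
  qed
  have "((\<lambda>b. integral {0..b} f) \<longlongrightarrow> Gamma (1 - p)) at_top"
  proof (rule tendstoI)
    fix e :: real assume "e > 0"
    then obtain B where B: "B > 0" "\<And>a b. ball 0 B \<subseteq> cbox a b \<Longrightarrow>
        norm (integral (cbox a b) (\<lambda>x. if x \<in> {0..} then f x else 0) - Gamma (1-p)) < e"
      using G unfolding has_integral_alt' by meson
    show "eventually (\<lambda>b. dist (integral {0..b} f) (Gamma (1 - p)) < e) at_top"
      using eventually_ge_at_top[of B]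
    proof eventually_elim
      case (elim b)
      have "ball 0 B \<subseteq> cbox (- B) b" using elim by (auto simp: dist_real_def)
      from B(2)[OF this] have "norm (integral (cbox (-B) b) (\<lambda>x. if x \<in> {0..} then f x else 0) - Gamma (1-p)) < e" .
      moreover have "{0..} \<inter> cbox (-B) b = {0..b}" using B(1) by auto
      ultimately show ?case by (simp only: integral_restrict_Int dist_norm)
    qed
  qed
  then have "((\<lambda>b. complex_of_real (integral {0..b} f)) \<longlongrightarrow> of_real (Gamma (1 - p))) at_top"
    by (intro tendsto_of_real)
  then show ?thesis
    by (rule Lim_transform_eventually, intro eventually_mono[OF eventually_ge_at_top[of 0]])
       (rule ev[symmetric])
qed

text \<open>The quantity \<open>cis (\<tau> (1 - p)) * inc_gamma p (b cis \<tau>)\<close> has \<open>\<tau>\<close>-derivative of norm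
\<open>exp (- b cos \<tau>)\<close> by the differential equation of \<open>inc_gamma\<close>; Jordan's inequality makes the total
variation over the quarter turn \<open>O(1/b)\<close>. This replaces the usual contour rotation.\<close>

lemma inc_gamma_rotation:
  assumes p: "0 < p" "p < 1" and b: "b > 0"
  shows "norm (cis (pi / 2 * (1 - p)) * inc_gamma p (of_real b * \<i>) - inc_gamma p (of_real b)) \<le> pi / (2 * b)"
proof -
  obtain D where D: "\<And>w. (inc_gamma p has_field_derivative D w) (at w)"
    "\<And>w. of_real (1 - p) * inc_gamma p w + w * D w = exp (- w)"
    by (rule inc_gamma_deriv[OF p]) blast
  have contM: "continuous_on UNIV (inc_gamma p)"
    by (intro continuous_at_imp_continuous_on ballI DERIV_isCont[OF D(1)])
  define F where "F \<tau> = cis (\<tau> * (1 - p)) * inc_gamma p (of_real b * cis \<tau>)" for \<tau>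
  define \<psi> where "\<psi> \<tau> = pi / (2 * b) * exp (- b * (1 - 2 * \<tau> / pi))" for \<tau>
  have "norm (F (pi/2) - F 0) \<le> \<psi> (pi/2) - \<psi> 0"
  proof (rule differentiable_bound_general)
    show "continuous_on {0..pi/2} F" unfolding F_def
      by (intro continuous_intros continuous_on_compose2[OF contM]) auto
    show "continuous_on {0..pi/2} \<psi>" unfolding \<psi>_def by (intro continuous_intros) auto
    fix \<tau> :: real assume \<tau>: "0 < \<tau>" "\<tau> < pi/2"
    show "(\<psi> has_vector_derivative exp (- b * (1 - 2 * \<tau> / pi))) (at \<tau>)"
      unfolding has_real_derivative_iff_has_vector_derivative[symmetric] \<psi>_def
      using b by (auto intro!: derivative_eq_intros simp: field_simps)
    define w where "w = of_real b * cis \<tau>"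
    have d1: "((\<lambda>\<tau>. cis (\<tau> * (1 - p))) has_vector_derivative (\<i> * of_real (1 - p) * cis (\<tau> * (1 - p)))) (at \<tau>)"
    proof -
      have "((\<lambda>z. exp (\<i> * (z * of_real (1 - p)))) has_field_derivative
          \<i> * of_real (1 - p) * exp (\<i> * (of_real \<tau> * of_real (1 - p)))) (at (of_real \<tau>))"
        by (auto intro!: derivative_eq_intros)
      from has_vector_derivative_real_field[OF this] show ?thesis
        unfolding cis_conv_exp of_real_mult .
    qed
    have d2: "((\<lambda>\<tau>. inc_gamma p (of_real b * cis \<tau>)) has_vector_derivative (\<i> * w * D w)) (at \<tau>)"
    proof -
      have "((\<lambda>\<tau>. of_real b * cis \<tau>) has_vector_derivative (\<i> * w)) (at \<tau>)"
      proof -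
        have "((\<lambda>z. of_real b * exp (\<i> * z)) has_field_derivative
            \<i> * (of_real b * exp (\<i> * of_real \<tau>))) (at (of_real \<tau>))"
          by (auto intro!: derivative_eq_intros)
        from has_vector_derivative_real_field[OF this] show ?thesis
          unfolding cis_conv_exp w_def .
      qed
      from field_vector_diff_chain_at[OF this D(1)] show ?thesis by (simp add: o_def w_def)
    qed
    have "(F has_vector_derivative (cis (\<tau> * (1 - p)) * (\<i> * w * D w) + \<i> * of_real (1 - p) * cis (\<tau> * (1 - p)) * inc_gamma p w)) (at \<tau>)"
      unfolding F_def w_def by (rule has_vector_derivative_mult[OF d1 d2[unfolded w_def]])
    also have "cis (\<tau> * (1 - p)) * (\<i> * w * D w) + \<i> * of_real (1 - p) * cis (\<tau> * (1 - p)) * inc_gamma p w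
        = \<i> * cis (\<tau> * (1 - p)) * (of_real (1 - p) * inc_gamma p w + w * D w)"
      by (simp add: algebra_simps)
    also have "\<dots> = \<i> * cis (\<tau> * (1 - p)) * exp (- w)" unfolding D(2) ..
    finally show "(F has_vector_derivative (\<i> * cis (\<tau> * (1 - p)) * exp (- (of_real b * cis \<tau>)))) (at \<tau>)" unfolding w_def .
    have "b * (1 - 2 * \<tau> / pi) \<le> b * cos \<tau>" using \<tau> b by (intro mult_left_mono cos_ge_linear) auto
    then show "norm (\<i> * cis (\<tau> * (1 - p)) * exp (- (of_real b * cis \<tau>))) \<le> exp (- b * (1 - 2 * \<tau> / pi))"
      by (simp add: norm_mult)
  qed auto
  also have "\<psi> (pi/2) - \<psi> 0 \<le> pi / (2 * b)" using b by (simp add: \<psi>_def)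
  finally show ?thesis by (simp add: F_def)
qed

text \<open>Rotating the ray of integration onto the positive real axis turns the integral into \<open>Gamma (1 - p)\<close>.\<close>

lemma xi_minus_eq:
  assumes p: "0 < p" "p < 1"
  shows "xi_minus p = of_real (Gamma (1 - p)) * cis (- (pi / 2 * (1 - p)))"
proof -
  define \<omega> where "\<omega> = cis (pi / 2 * (1 - p))"
  let ?J = "\<lambda>b. of_real (b powr (1 - p)) * inc_gamma p (\<i> * of_real b)"
  have "((\<lambda>b. \<omega> * ?J b - of_real (b powr (1 - p)) * inc_gamma p (of_real b)) \<longlongrightarrow> 0) at_top"
  proof (rule Lim_null_comparison)
    show "eventually (\<lambda>b. norm (\<omega> * ?J b - of_real (b powr (1 - p)) * inc_gamma p (of_real b)) \<le> pi / 2 * b powr (- p)) at_top"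
      using eventually_gt_at_top[of 0]
    proof eventually_elim
      case (elim b)
      have "\<omega> * ?J b - of_real (b powr (1 - p)) * inc_gamma p (of_real b)
         = of_real (b powr (1 - p)) * (\<omega> * inc_gamma p (of_real b * \<i>) - inc_gamma p (of_real b))"
        by (simp add: algebra_simps)
      also have "norm \<dots> \<le> b powr (1 - p) * (pi / (2 * b))"
        unfolding norm_mult \<omega>_def norm_of_real abs_of_nonneg[OF powr_ge_zero]
        by (intro mult_left_mono inc_gamma_rotation[OF p elim]) auto
      also have "b powr (1 - p) * (pi / (2 * b)) = pi / 2 * b powr (- p)"
        using powr_add[of b "-p" 1] elim by simp
      finally show ?case .
    qed
    have "((\<lambda>b. pi / 2 * b powr (- p)) \<longlongrightarrow> pi / 2 * 0) at_top"
      using p by (intro tendsto_intros tendsto_neg_powr filterlim_ident) auto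
    then show "((\<lambda>b. pi / 2 * b powr (- p)) \<longlongrightarrow> 0) at_top" by simp
  qed
  from tendsto_add[OF this inc_gamma_real_limit[OF p]]
  have "((\<lambda>b. \<omega> * ?J b) \<longlongrightarrow> of_real (Gamma (1 - p))) at_top" by simp
  from tendsto_mult[OF tendsto_const this, of "cnj \<omega>"]
  have "((\<lambda>b. (cnj \<omega> * \<omega>) * ?J b) \<longlongrightarrow> cnj \<omega> * of_real (Gamma (1 - p))) at_top" by (simp add: mult.assoc)
  moreover have "cnj \<omega> * \<omega> = 1" by (simp add: \<omega>_def cis_cnj cis_mult)
  moreover have "cnj \<omega> * of_real (Gamma (1 - p)) = of_real (Gamma (1 - p)) * cis (- (pi / 2 * (1 - p)))"
    by (simp add: \<omega>_def cis_cnj)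
  ultimately have lim: "(?J \<longlongrightarrow> of_real (Gamma (1 - p)) * cis (- (pi / 2 * (1 - p)))) at_top" by simp
  have hi: "((\<lambda>\<sigma>::real. exp (- \<i> * of_real \<sigma>) * of_real (\<sigma> powr - p)) has_integral ?J b) {0..b}" if "b \<ge> 0" for b
    using inc_gamma_integral[OF p that, of \<i>] by simp
  show ?thesis unfolding xi_minus_def
  proof (intro integral_unique has_integral_improper_at_top)
    show "(\<lambda>\<sigma>::real. exp (- \<i> * of_real \<sigma>) * of_real (\<sigma> powr - p)) integrable_on {0..b}" if "b \<ge> 0" for b
      using hi[OF that] by blast
    show "((\<lambda>b. integral {0..b} (\<lambda>\<sigma>::real. exp (- \<i> * of_real \<sigma>) * of_real (\<sigma> powr - p)))
        \<longlongrightarrow> of_real (Gamma (1 - p)) * cis (- (pi / 2 * (1 - p)))) at_top"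
      by (rule Lim_transform_eventually[OF lim], rule eventually_mono[OF eventually_ge_at_top[of 0]])
         (rule integral_unique[OF hi, symmetric])
  qed
qed

lemma c_const_eq:
  assumes "0 < \<beta>" "\<beta> < 1"
  shows "c_const \<beta> = - \<i> * of_real (Gamma (1 - \<beta>)) * cis (pi / 2 * (1 - \<beta>))"
proof -
  have "integral {0<..} (\<lambda>\<sigma>::real. exp (\<i> * of_real \<sigma>) * of_real (\<sigma> powr - \<beta>)) = cnj (xi_minus \<beta>)"
    unfolding xi_minus_def integral_cnj
    by (simp add: exp_cnj)
  then show ?thesis unfolding c_const_def xi_minus_eq[OF assms] by (simp add: cis_cnj)
qed

lemma Gamma_reflection_real:
  assumes "0 < x" "x < (1::real)" shows "rGamma x = Gamma (1 - x) * sin (pi * x) / pi"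
proof -
  have "of_real (Gamma x * Gamma (1 - x)) = (of_real (pi / sin (pi * x)) :: complex)"
  proof -
    have e1: "1 - complex_of_real x = of_real (1 - x)" by simp
    have e2: "sin (of_real pi * complex_of_real x) = of_real (sin (pi * x))"
      unfolding of_real_mult[symmetric] sin_of_real ..
    show ?thesis
      using Gamma_reflection_complex[of "of_real x"] unfolding e1 e2 Gamma_complex_of_real by simp
  qed
  then have "Gamma x * Gamma (1 - x) = pi / sin (pi * x)" using of_real_eq_iff by blast
  moreover have "Gamma x > 0" using assms by (intro Gamma_real_pos)
  moreover have "sin (pi * x) > 0" using assms by (intro sin_gt_zero) auto
  ultimately show ?thesis by (simp add: rGamma_inverse_Gamma field_simps)
qed

lemma d_const_eq:
  assumes "0 < \<beta>" "\<beta> < 1"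
  shows "d_const \<beta> = rGamma \<beta> / Gamma (1 - \<beta>)"
proof -
  have "Gamma (1 - \<beta>) > 0" using assms by (intro Gamma_real_pos) auto
  then show ?thesis unfolding Gamma_reflection_real[OF assms] d_const_def by (simp add: mult.commute)
qed

text \<open>With \<open>c_const \<beta>\<close> and \<open>xi_minus (2 \<beta> - 1)\<close> evaluated, the phases combine to
\<open>- \<i> cis (- 2 pi (1 - \<beta>))\<close>, whose real part is the sine in the reflection formula for
\<open>rGamma (2 \<beta> - 1)\<close>.\<close>

lemma d1_const_eq:
  assumes \<beta>: "1/2 < \<beta>" "\<beta> < 1"
  shows "d1_const M Y \<phi> c \<beta> = - cH_const M Y \<phi> c \<beta> * rGamma (2 * \<beta> - 1) / (Gamma (1 - \<beta>))\<^sup>2"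
proof -
  define G where "G = Gamma (1 - \<beta>)"
  define cH where "cH = cH_const M Y \<phi> c \<beta>"
  define y where "y = pi * (1 - \<beta>)"
  have G: "G > 0" unfolding G_def using \<beta> by (intro Gamma_real_pos) auto
  have c: "c_const \<beta> = - \<i> * of_real G * cis (y / 2)" using c_const_eq[of \<beta>] \<beta> by (simp add: G_def y_def)
  have xi: "xi_minus (2 * \<beta> - 1) = of_real (Gamma (2 - 2 * \<beta>)) * cis (- y)"
  proof -
    have "pi / 2 * (1 - (2 * \<beta> - 1)) = y" by (simp add: y_def field_simps)
    then show ?thesis using xi_minus_eq[of "2 * \<beta> - 1"] \<beta> by simp
  qed
  have "e0_const M Y \<phi> c \<beta> * xi_minus (2 * \<beta> - 1) / c_const \<beta>
      = \<i> * of_real cH * of_real (Gamma (2 - 2 * \<beta>)) * cis (- y) / (c_const \<beta> * c_const \<beta>)"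
    unfolding e0_const_def xi cH_def by (simp add: field_simps)
  also have "c_const \<beta> * c_const \<beta> = - of_real (G\<^sup>2) * cis y"
    unfolding c by (simp add: power2_eq_square cis_mult mult_ac)
  also have "\<i> * of_real cH * of_real (Gamma (2 - 2 * \<beta>)) * cis (- y) / (- of_real (G\<^sup>2) * cis y)
      = of_real (cH * Gamma (2 - 2 * \<beta>) / G\<^sup>2) * (- \<i> * cis (- (2 * y)))"
  proof -
    have "cis (- y) = cis (- (2 * y)) * cis y" by (simp add: cis_mult)
    then show ?thesis using G by (simp add: field_simps)
  qed
  finally have re: "Re (e0_const M Y \<phi> c \<beta> * xi_minus (2 * \<beta> - 1) / c_const \<beta>) = cH * Gamma (2 - 2 * \<beta>) / G\<^sup>2 * sin (- (2 * y))"
    by simp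
  have s: "sin (- (2 * y)) = - sin (pi * (2 * \<beta> - 1))"
  proof -
    have e: "- (2 * y) = pi * (2 * \<beta> - 1) - pi" by (simp add: y_def algebra_simps)
    show ?thesis unfolding e by (simp add: sin_diff)
  qed
  have "1 - (2 * \<beta> - 1) = 2 - 2 * \<beta>" by simp
  then have r: "rGamma (2 * \<beta> - 1) = Gamma (2 - 2 * \<beta>) * sin (pi * (2 * \<beta> - 1)) / pi"
    using Gamma_reflection_real[of "2 * \<beta> - 1"] \<beta> by simp
  show ?thesis unfolding d1_const_def re s r cH_def[symmetric] G_def[symmetric] by simp
qed

lemma sum_bincoef:
  assumes "a \<noteq> 0" shows "(\<Sum>n<N. bincoef a n) = bincoef a N * (real N / a)"
proof (induction N)
  case (Suc N)
  have "bincoef a (Suc N) * (real (Suc N) / a) = bincoef a N * ((a + real N) / a)"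
  proof -
    have "bincoef a (Suc N) = bincoef a N * (a + real N) / real (Suc N)"
      by (simp add: bincoef_def pochhammer_Suc mult_ac)
    then show ?thesis by simp
  qed
  also have "\<dots> = bincoef a N * (real N / a) + bincoef a N"
    using assms by (simp add: field_simps)
  finally show ?case using Suc by simp
qed simp

lemma step_integral:
  fixes t :: "nat \<Rightarrow> real"
  shows "((\<lambda>x. t (nat \<lfloor>x\<rfloor>)) has_integral (\<Sum>n<N. t n)) {0..real N}"
proof (induction N)
  case (Suc N)
  have "((\<lambda>x. t (nat \<lfloor>x\<rfloor>)) has_integral t N) {real N..real (Suc N)}"
  proof (rule has_integral_spike_finite)
    show "finite {real (Suc N)}" by simp
    show "((\<lambda>x. t N) has_integral t N) {real N..real (Suc N)}"
      using has_integral_const_real[of "t N" "real N" "real (Suc N)"] by simp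
    fix x assume "x \<in> {real N..real (Suc N)} - {real (Suc N)}"
    then have "real N \<le> x" "x < real N + 1" by auto
    then have "\<lfloor>x\<rfloor> = int N" by linarith
    then show "t (nat \<lfloor>x\<rfloor>) = t N" by simp
  qed
  from has_integral_combine[OF _ _ Suc this] show ?case by simp
qed (simp add: has_integral_refl)

text \<open>On \<open>{0..N}\<close> the integral is \<open>(\<Sum>n<N. t n) / c - N powr (1 - \<beta>) / (1 - \<beta>)\<close>. The partial sums of the
binomial coefficients are explicit, and by the rate of \<open>bincoef\<close> they cancel the power of \<open>N\<close> in the limit.\<close>

lemma cH_eq_suminf:
  fixes t H :: "nat \<Rightarrow> real"
  assumes \<beta>: "1/2 < \<beta>" "\<beta> < 1" and c: "c > 0"
    and t: "\<And>n. n \<ge> 1 \<Longrightarrow> t n = c * (real n powr - \<beta> + H n)"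
    and H: "H \<in> O(\<lambda>n. real n powr (- 2 * \<beta>))"
    and t_lim: "t \<longlonglongrightarrow> 0"
  shows "((\<lambda>x. (1 / c) * t (nat \<lfloor>x\<rfloor>) - x powr - \<beta>) has_integral suminf (tail_defect t c \<beta>)) {0<..}"
proof -
  define f where "f x = (1 / c) * t (nat \<lfloor>x\<rfloor>) - x powr - \<beta>" for x
  define J where "J N = (1 / c) * (\<Sum>n<N. t n) - real N powr (1 - \<beta>) / (1 - \<beta>)" for N
  have fN: "(f has_integral J N) {0..real N}" for N
  proof -
    have "((\<lambda>x. x powr - \<beta>) has_integral (real N powr (- \<beta> + 1) / (- \<beta> + 1))) {0..real N}"
      using \<beta> by (intro has_integral_powr_from_0) auto
    then have "((\<lambda>x. x powr - \<beta>) has_integral (real N powr (1 - \<beta>) / (1 - \<beta>))) {0..real N}"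
      by (simp add: add.commute)
    from has_integral_diff[OF has_integral_mult_right[OF step_integral[of t N], of "1 / c"] this]
    show ?thesis unfolding f_def J_def .
  qed
  obtain C where C: "C \<ge> 0" "\<And>n. n \<ge> 1 \<Longrightarrow> \<bar>tail_defect t c \<beta> n\<bar> \<le> C * real n powr -(2 * \<beta>)"
    using tail_defect_bound[OF \<beta> c t H] by blast
  have "summable (\<lambda>n. \<bar>tail_defect t c \<beta> n\<bar>)"
    by (rule power_series_at_1_holder(1)[OF _ _ C(2)]) (use \<beta> in auto)
  then have sm: "summable (tail_defect t c \<beta>)" by (rule summable_rabs_cancel)
  obtain C2 where C2: "C2 \<ge> 0" "\<And>n. n \<ge> 1 \<Longrightarrow>
      \<bar>bincoef (1-\<beta>) n - rGamma (1-\<beta>) * real n powr (1-\<beta> - 1)\<bar> \<le> C2 * real n powr (1-\<beta> - 2)"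
    using bincoef_rate[of "1-\<beta>"] \<beta> by auto
  have G: "Gamma (1-\<beta>) > 0" using \<beta> by (intro Gamma_real_pos) auto
  define E where "E N = real N / (1 - \<beta>) * (Gamma (1 - \<beta>) * bincoef (1 - \<beta>) N - real N powr - \<beta>)" for N
  have J: "J N = (\<Sum>n<N. tail_defect t c \<beta> n) + E N" for N
  proof -
    have "(\<Sum>n<N. tail_defect t c \<beta> n) = (1 / c) * (\<Sum>n<N. t n) - Gamma (1 - \<beta>) * (bincoef (1 - \<beta>) N * (real N / (1 - \<beta>)))"
      using sum_bincoef[of "1 - \<beta>" N] \<beta>
      by (simp add: tail_defect_def sum_subtractf sum_distrib_left[symmetric] sum_divide_distrib[symmetric])
    moreover have "real N powr (1 - \<beta>) = real N * real N powr - \<beta>"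
      using powr_add[of "real N" 1 "- \<beta>"] by simp
    ultimately show ?thesis unfolding J_def E_def by (simp add: right_diff_distrib mult_ac)
  qed
  have "E \<longlonglongrightarrow> 0"
  proof (rule Lim_null_comparison)
    show "eventually (\<lambda>N. norm (E N) \<le> Gamma (1 - \<beta>) * C2 / (1 - \<beta>) * real N powr - \<beta>) sequentially"
      using eventually_ge_at_top[of 1]
    proof eventually_elim
      case (elim N)
      have "Gamma (1-\<beta>) * rGamma (1-\<beta>) = 1" using G by (simp add: rGamma_inverse_Gamma)
      then have "Gamma (1 - \<beta>) * bincoef (1 - \<beta>) N - real N powr - \<beta>
         = Gamma (1 - \<beta>) * (bincoef (1-\<beta>) N - rGamma (1-\<beta>) * real N powr (1-\<beta> - 1))"
        by (simp add: right_diff_distrib mult.assoc[symmetric])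
      then have "norm (E N) = real N / (1 - \<beta>) * (Gamma (1 - \<beta>) * \<bar>bincoef (1-\<beta>) N - rGamma (1-\<beta>) * real N powr (1-\<beta> - 1)\<bar>)"
        using \<beta> G by (simp add: E_def abs_mult)
      also have "\<dots> \<le> real N / (1 - \<beta>) * (Gamma (1 - \<beta>) * (C2 * real N powr (1-\<beta> - 2)))"
        using \<beta> G by (intro mult_left_mono C2(2) elim) auto
      also have "\<dots> = Gamma (1 - \<beta>) * C2 / (1 - \<beta>) * (real N * real N powr (1-\<beta> - 2))" by simp
      also have "real N * real N powr (1-\<beta> - 2) = real N powr - \<beta>"
        using powr_add[of "real N" 1 "1-\<beta> - 2"] elim by simp
      finally show ?case .
    qed
    have "(\<lambda>N. Gamma (1 - \<beta>) * C2 / (1 - \<beta>) * real N powr - \<beta>) \<longlonglongrightarrow> Gamma (1 - \<beta>) * C2 / (1 - \<beta>) * 0"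
      using \<beta> by (intro tendsto_intros tendsto_neg_powr filterlim_real_sequentially) auto
    then show "(\<lambda>N. Gamma (1 - \<beta>) * C2 / (1 - \<beta>) * real N powr - \<beta>) \<longlonglongrightarrow> 0" by simp
  qed
  from tendsto_add[OF summable_LIMSEQ[OF sm] this]
  have J_lim: "J \<longlonglongrightarrow> suminf (tail_defect t c \<beta>)" unfolding J[abs_def] by simp
  have int: "f integrable_on {0..b}" if "b \<ge> 0" for b
    by (rule integrable_subinterval_real[OF has_integral_integrable[OF fN[of "nat \<lceil>b\<rceil>"]]]) (use that in auto)
  define B where "B N = \<bar>t N\<bar> / c + real N powr - \<beta>" for N
  have B_lim: "B \<longlonglongrightarrow> 0"
  proof -
    have "B \<longlonglongrightarrow> \<bar>0\<bar> / c + 0"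
      unfolding B_def using \<beta> c
      by (intro tendsto_intros t_lim tendsto_neg_powr filterlim_real_sequentially) auto
    then show ?thesis by simp
  qed
  have near: "\<bar>integral {0..b} f - J (nat \<lfloor>b\<rfloor>)\<bar> \<le> B (nat \<lfloor>b\<rfloor>)" if b: "b \<ge> 1" for b
  proof -
    define N where "N = nat \<lfloor>b\<rfloor>"
    have N: "N \<ge> 1" "real N \<le> b" "b < real N + 1" using b unfolding N_def by linarith+
    have "integral {0..real N} f + integral {real N..b} f = integral {0..b} f"
      by (rule Henstock_Kurzweil_Integration.integral_combine) (use N b int in auto)
    then have "integral {0..b} f - J N = integral {real N..b} f"
      using integral_unique[OF fN[of N]] by simp
    moreover have "norm (integral {real N..b} f) \<le> integral {real N..b} (\<lambda>x. B N)"
    proof (rule Henstock_Kurzweil_Integration.integral_norm_bound_integral)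
      show "f integrable_on {real N..b}"
        by (rule integrable_subinterval_real[OF int[of b]]) (use b N in auto)
      show "(\<lambda>x. B N) integrable_on {real N..b}" by (intro integrable_continuous_real continuous_intros)
      fix x assume x: "x \<in> {real N..b}"
      then have "\<lfloor>x\<rfloor> = int N" using N by (auto simp: floor_eq_iff)
      then have "f x = t N / c - x powr - \<beta>" by (simp add: f_def)
      moreover have "x powr - \<beta> \<le> real N powr - \<beta>" using x N \<beta> by (intro powr_mono2') auto
      ultimately show "norm (f x) \<le> B N"
        using c abs_triangle_ineq4[of "t N / c" "x powr - \<beta>"] by (simp add: B_def)
    qed
    moreover have "integral {real N..b} (\<lambda>x. B N) \<le> B N"
    proof -
      have "integral {real N..b} (\<lambda>x. B N) = (b - real N) * B N" using N by simp
      also have "\<dots> \<le> 1 * B N" using N c by (intro mult_right_mono) (auto simp: B_def)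
      finally show ?thesis by simp
    qed
    ultimately show ?thesis unfolding N_def by simp
  qed
  have fl: "filterlim (\<lambda>b::real. nat \<lfloor>b\<rfloor>) at_top at_top"
    by (intro filterlim_compose[OF filterlim_nat_sequentially filterlim_floor_sequentially])
  have "((\<lambda>b. integral {0..b} f - J (nat \<lfloor>b\<rfloor>)) \<longlongrightarrow> 0) at_top"
  proof (rule Lim_null_comparison)
    show "eventually (\<lambda>b. norm (integral {0..b} f - J (nat \<lfloor>b\<rfloor>)) \<le> B (nat \<lfloor>b\<rfloor>)) at_top"
      using eventually_ge_at_top[of 1] by eventually_elim (use near in auto)
    show "((\<lambda>b::real. B (nat \<lfloor>b\<rfloor>)) \<longlongrightarrow> 0) at_top" by (rule filterlim_compose[OF B_lim fl])
  qed
  from tendsto_add[OF this filterlim_compose[OF J_lim fl]]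
  have "((\<lambda>b. integral {0..b} f) \<longlongrightarrow> suminf (tail_defect t c \<beta>)) at_top" by simp
  from has_integral_improper_at_top[OF int this] show ?thesis unfolding f_def .
qed

section \<open>Decay of Fourier coefficients\<close>

lemma integral_periodic_shift:
  fixes F :: "real \<Rightarrow> 'v::banach"
  assumes F: "continuous_on UNIV F" and per: "\<And>x. F (x + 2 * pi) = F x" and h: "0 \<le> h" "h \<le> 2 * pi"
  shows "integral {-pi..pi} (\<lambda>x. F (x + h)) = integral {-pi..pi} F"
proof -
  have int: "F integrable_on {a..b}" for a b
    by (intro integrable_continuous_real continuous_on_subset[OF F]) auto
  have "integral {-pi..pi} (\<lambda>x. F (x + h)) = integral {-pi+h..pi+h} F"
    using integral_shift_real_ivl[of "-pi+h" h "pi+h" F] by simp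
  also have "\<dots> = integral {-pi+h..pi} F + integral {pi..pi+h} F"
    by (rule Henstock_Kurzweil_Integration.integral_combine[symmetric]) (use h int in auto)
  also have "integral {pi..pi+h} F = integral {-pi..-pi+h} F"
  proof -
    have "integral {-pi..-pi+h} (\<lambda>x. F (x + 2*pi)) = integral {pi..pi+h} F"
      using integral_shift_real_ivl[of pi "2*pi" "pi+h" F] by simp
    then show ?thesis unfolding per by simp
  qed
  also have "integral {-pi+h..pi} F + integral {-pi..-pi+h} F = integral {-pi..pi} F"
    using Henstock_Kurzweil_Integration.integral_combine[of "-pi" "-pi+h" pi F] h int by (simp add: add.commute)
  finally show ?thesis .
qed

text \<open>A shift by \<open>h = \<pi> / n\<close> changes the sign of the exponential, so twice the integral is the integral of
\<open>g(x) - g(x + h)\<close> against it. On \<open>|x| \<le> a\<close> boundedness of \<open>g\<close> contributes \<open>O(a)\<close>; outside, the Hoelder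
bound contributes \<open>O(h powr \<beta> * a powr (1 - 2 * \<beta>))\<close>. Both equal \<open>n powr - (1/2)\<close> for
\<open>a = n powr - (1/2)\<close>. The constant must not depend on \<open>g\<close>, because \<open>g\<close> will vary with \<open>n\<close>.\<close>

lemma fourier_coefficient_decay:
  fixes \<beta> K :: real
  assumes \<beta>: "1/2 < \<beta>" "\<beta> < 1" and K: "K \<ge> 0"
  obtains C where "C \<ge> 0"
    and "\<And>(g :: real \<Rightarrow> ('b::banach \<times> 'b) \<Rightarrow>\<^sub>L ('b \<times> 'b)) n.
      n \<ge> 1 \<Longrightarrow> continuous_on UNIV g \<Longrightarrow> (\<And>x. g (x + 2 * pi) = g x) \<Longrightarrow> (\<And>x. norm (g x) \<le> K) \<Longrightarrow>
      (\<And>x h. \<bar>x\<bar> \<le> pi \<Longrightarrow> h > 0 \<Longrightarrow> 2 * pi * h \<le> \<bar>x\<bar> \<Longrightarrow>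
         norm (g (x + h) - g x) \<le> K * h powr \<beta> * \<bar>x\<bar> powr (- 2 * \<beta>)) \<Longrightarrow>
      norm (integral {-pi..pi} (\<lambda>x. cscale (cis (- real n * x)) o\<^sub>L g x)) \<le> C * real n powr - (1/2)"
proof -
  define C1 where "C1 = 8 * K + 4 * K * pi powr \<beta> / (2 * \<beta> - 1)"
  define C where "C = C1 + 4 * pi * K * 20"
  have C1: "C1 \<ge> 0" unfolding C1_def using K \<beta> by (intro add_nonneg_nonneg divide_nonneg_nonneg) auto
  have C0: "C \<ge> 0" unfolding C_def using C1 K by auto
  have "norm (integral {-pi..pi} (\<lambda>x. cscale (cis (- real n * x)) o\<^sub>L g x)) \<le> C * real n powr - (1/2)"
    if n: "n \<ge> 1" and g: "continuous_on UNIV g" and per: "\<And>x. g (x + 2 * pi) = g x"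
      and gK: "\<And>x. norm (g x) \<le> K"
      and hol: "\<And>x h. \<bar>x\<bar> \<le> pi \<Longrightarrow> h > 0 \<Longrightarrow> 2 * pi * h \<le> \<bar>x\<bar> \<Longrightarrow>
         norm (g (x + h) - g x) \<le> K * h powr \<beta> * \<bar>x\<bar> powr (- 2 * \<beta>)"
    for g :: "real \<Rightarrow> ('b \<times> 'b) \<Rightarrow>\<^sub>L ('b \<times> 'b)" and n :: nat
  proof -
    define F where "F x = cscale (cis (- real n * x)) o\<^sub>L g x" for x
    have g': "continuous_on S g" for S by (rule continuous_on_subset[OF g]) auto
    have F': "continuous_on S F" for S unfolding F_def by (intro continuous_intros g')
    have nc: "norm (cscale (cis y) o\<^sub>L A) \<le> 2 * norm A" for y and A :: "('b \<times> 'b) \<Rightarrow>\<^sub>L ('b \<times> 'b)"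
      by (rule order_trans[OF norm_blinfun_compose]) (use norm_cscale_le[of "cis y"] in \<open>auto intro!: mult_right_mono\<close>)
    show ?thesis
    \<comment> \<open>For \<open>n \<ge> 400\<close> the shift \<open>\<pi> / n\<close> is small compared with the cut-off \<open>n powr - (1/2)\<close>, as \<open>2 \<pi>\<^sup>2 \<le> 20 = sqrt 400\<close>.\<close>
    proof (cases "n < 400")
      case True
      have "norm (integral {-pi..pi} F) \<le> (2 * K) * (pi - - pi)"
        by (rule integral_bound[OF _ F']) (use order_trans[OF nc mult_left_mono[OF gK]] in \<open>auto simp: F_def\<close>)
      also have "\<dots> = (4 * pi * K * 20) * (1/20)" by simp
      also have "\<dots> \<le> C * real n powr -(1/2)"
      proof (intro mult_mono)
        have "real n powr (1/2) \<le> 400 powr (1/2)" using True by (intro powr_mono2) auto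
        also have "\<dots> = (20::real)" using powr_half_sqrt[of 400] real_sqrt_unique[of 20 400] by simp
        finally show "1/20 \<le> real n powr -(1/2)"
          using n by (simp add: powr_minus divide_simps)
      qed (use K C1 in \<open>auto simp: C_def\<close>)
      finally show ?thesis unfolding F_def .
    next
      case False
      define h where "h = pi / real n"
      define a where "a = real n powr -(1/2)"
      have h0: "h > 0" using n by (simp add: h_def)
      have a0: "a > 0" using n by (simp add: a_def)
      have a2: "a * a = 1 / real n" unfolding a_def using n by (simp add: powr_add[symmetric] powr_minus_divide)
      have a_le: "a \<le> 1/20"
      proof -
        have "(400::real) powr (1/2) \<le> real n powr (1/2)" using False by (intro powr_mono2) auto
        moreover have "(400::real) powr (1/2) = 20" using powr_half_sqrt[of 400] real_sqrt_unique[of 20 400] by simp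
        ultimately show ?thesis unfolding a_def using n by (simp add: powr_minus divide_simps)
      qed
      have "2 * pi * h = 2 * pi^2 * (a * a)" by (simp add: h_def a2 power2_eq_square)
      also have "\<dots> \<le> 20 * (a * a)"
      proof (intro mult_right_mono)
        have "pi < 3.15" using pi_approx by simp
        then have "pi^2 \<le> 3.15^2" by (intro power_mono) auto
        then show "2 * pi^2 \<le> 20" by (simp add: power2_eq_square)
      qed (use a0 in auto)
      also have "\<dots> \<le> 20 * (a * (1/20))" using a_le a0 by (intro mult_left_mono) auto
      finally have ah: "2 * pi * h \<le> a" by simp
      have a_pi: "a \<le> pi" using a_le pi_gt3 by linarith
      have h_le: "h \<le> 2 * pi"
      proof -
        have "1 * h \<le> 2 * pi * h" using h0 pi_gt3 by (intro mult_right_mono) auto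
        then show ?thesis using ah a_pi pi_gt3 by linarith
      qed
      have shiftF: "F (x + h) = - (cscale (cis (- real n * x)) o\<^sub>L g (x + h))" for x
      proof -
        have "cis (- real n * (x + h)) = cis (- real n * x) * cis (- pi)"
          using n by (simp add: cis_mult h_def distrib_left)
        also have "\<dots> = - cis (- real n * x)" by (simp add: complex_eq_iff)
        finally show ?thesis unfolding F_def
          by (simp add: cscale_minus bounded_bilinear.minus_left[OF bounded_bilinear_blinfun_compose])
      qed
      define D where "D x = cscale (cis (- real n * x)) o\<^sub>L (g x - g (x + h))" for x
      have D': "continuous_on S D" for S
        unfolding D_def
        by (intro continuous_intros g' continuous_on_compose2[OF g, of S "\<lambda>x. x + h"]) auto
      have D_eq: "D x = F x + F (x + h)" for x
        unfolding shiftF by (simp add: D_def F_def bounded_bilinear.diff_right[OF bounded_bilinear_blinfun_compose])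
      have perF: "F (x + 2 * pi) = F x" for x
      proof -
        have "cis (- real n * (x + 2*pi)) = cis (- real n * x) * cis (2 * pi * - real n)"
          by (simp add: cis_mult algebra_simps)
        also have "cis (2 * pi * - real n) = 1" by (rule cis_multiple_2pi) auto
        finally show ?thesis by (simp add: F_def per)
      qed
      have "integral {-pi..pi} (\<lambda>x. F (x + h)) = integral {-pi..pi} F"
        by (rule integral_periodic_shift[OF F' perF]) (use h0 h_le in auto)
      moreover have "integral {-pi..pi} D = integral {-pi..pi} F + integral {-pi..pi} (\<lambda>x. F (x + h))"
        unfolding D_eq
        by (rule Henstock_Kurzweil_Integration.integral_add) (auto intro!: integrable_continuous_real F' continuous_on_compose2[OF F'[of UNIV]] continuous_intros)
      ultimately have two: "integral {-pi..pi} D = 2 *\<^sub>R integral {-pi..pi} F" by (simp add: scaleR_2)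
      have D_le: "norm (D x) \<le> 4 * K" for x
      proof -
        have "norm (g x - g (x + h)) \<le> K + K" by (rule order_trans[OF norm_triangle_ineq4 add_mono[OF gK gK]])
        then show ?thesis unfolding D_def using nc[of "- real n * x" "g x - g (x + h)"] by linarith
      qed
      have D_hol: "norm (D x) \<le> (2 * K * h powr \<beta>) * \<bar>x\<bar> powr (- 2 * \<beta>)" if "a \<le> \<bar>x\<bar>" "\<bar>x\<bar> \<le> pi" for x
      proof -
        have "norm (D x) \<le> 2 * norm (g x - g (x+h))" unfolding D_def by (rule nc)
        also have "\<dots> \<le> 2 * (K * h powr \<beta> * \<bar>x\<bar> powr (- 2 * \<beta>))"
          using hol[OF that(2) h0] ah that(1) by (simp add: norm_minus_commute)
        finally show ?thesis by simp
      qed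
      define J where "J = (2 * K * h powr \<beta>) * integral {a..pi} (\<lambda>x. x powr (- 2 * \<beta>))"
      have FTC: "((\<lambda>x. x powr (- 2 * \<beta>)) has_integral (pi powr (1 - 2*\<beta>) / (1 - 2*\<beta>) - a powr (1 - 2*\<beta>) / (1 - 2*\<beta>))) {a..pi}"
      proof (rule fundamental_theorem_of_calculus)
        show "((\<lambda>x. x powr (1 - 2 * \<beta>) / (1 - 2 * \<beta>)) has_vector_derivative x powr (- 2 * \<beta>)) (at x within {a..pi})"
          if "x \<in> {a..pi}" for x
        proof -
          have "((\<lambda>x. x powr (1 - 2*\<beta>)) has_real_derivative (1 - 2*\<beta>) * x powr (1 - 2*\<beta> - 1)) (at x within {a..pi})"
            by (rule has_field_derivative_at_within[OF has_real_derivative_powr]) (use that a0 in auto)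
          from DERIV_cdivide[OF this, of "1 - 2*\<beta>"] show ?thesis
            unfolding has_real_derivative_iff_has_vector_derivative[symmetric] using \<beta> by simp
        qed
      qed (use a_pi in auto)
      have J: "J \<le> (2 * K * h powr \<beta>) * (a powr (1 - 2*\<beta>) / (2*\<beta> - 1))"
        unfolding J_def integral_unique[OF FTC]
      proof (intro mult_left_mono)
        have e: "x / (1 - 2*\<beta>) = - (x / (2*\<beta> - 1))" for x
          using minus_divide_right[of x "2*\<beta> - 1"] by simp
        have "pi powr (1 - 2*\<beta>) / (2*\<beta> - 1) \<ge> 0" using \<beta> by simp
        then show "pi powr (1 - 2*\<beta>) / (1 - 2*\<beta>) - a powr (1 - 2*\<beta>) / (1 - 2*\<beta>) \<le> a powr (1 - 2*\<beta>) / (2*\<beta> - 1)"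
          unfolding e by simp
      qed (use K in auto)
      have ip: "(\<lambda>x. (2 * K * h powr \<beta>) * x powr (- 2 * \<beta>)) integrable_on {a..pi}"
        using has_integral_mult_right[OF FTC] by (auto simp: integrable_on_def)
      have right: "norm (integral {a..pi} D) \<le> J"
        unfolding J_def Henstock_Kurzweil_Integration.integral_mult_right[symmetric]
      proof (rule Henstock_Kurzweil_Integration.integral_norm_bound_integral[OF integrable_continuous_real[OF D'] ip])
        show "norm (D x) \<le> 2 * K * h powr \<beta> * x powr (- 2 * \<beta>)" if "x \<in> {a..pi}" for x
          using D_hol[of x] that a0 by auto
      qed
      have left: "norm (integral {-pi..-a} D) \<le> J"
      proof -
        have "integral {-pi..-a} D = integral {a..pi} (\<lambda>x. D (- x))"
          using Henstock_Kurzweil_Integration.integral_reflect_real[of pi a "\<lambda>x. D (-x)"] by simp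
        moreover have "norm (integral {a..pi} (\<lambda>x. D (- x))) \<le> J"
          unfolding J_def Henstock_Kurzweil_Integration.integral_mult_right[symmetric]
        proof (rule Henstock_Kurzweil_Integration.integral_norm_bound_integral[OF _ ip])
          show "(\<lambda>x. D (- x)) integrable_on {a..pi}"
            by (intro integrable_continuous_real continuous_on_compose2[OF D'[of UNIV]] continuous_intros) auto
          show "norm (D (- x)) \<le> 2 * K * h powr \<beta> * x powr (- 2 * \<beta>)" if "x \<in> {a..pi}" for x
            using D_hol[of "-x"] that a0 by auto
        qed
        ultimately show ?thesis by simp
      qed
      have mid: "norm (integral {-a..a} D) \<le> 4 * K * (a - - a)"
        by (rule integral_bound[OF _ D']) (use a0 D_le in auto)
      have Dint: "D integrable_on {x..y}" for x y by (intro integrable_continuous_real D')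
      have "integral {-pi..pi} D = integral {-pi..-a} D + (integral {-a..a} D + integral {a..pi} D)"
        using Henstock_Kurzweil_Integration.integral_combine[of "-pi" "-a" pi D] Henstock_Kurzweil_Integration.integral_combine[of "-a" a pi D] Dint a0 a_pi by simp
      then have "norm (integral {-pi..pi} D) \<le> J + (4 * K * (a - - a) + J)"
        using left mid right by (metis (no_types, lifting) add_mono norm_triangle_mono)
      then have "norm (2 *\<^sub>R integral {-pi..pi} F) \<le> 8 * K * a + 2 * J"
        unfolding two by simp
      then have "norm (integral {-pi..pi} F) \<le> 4 * K * a + J" by simp
      also have "J \<le> (2 * K * h powr \<beta>) * (a powr (1 - 2*\<beta>) / (2*\<beta> - 1))" by (rule J)
      also have "\<dots> = 2 * K / (2*\<beta> - 1) * (h powr \<beta> * a powr (1 - 2*\<beta>))" by simp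
      also have "h = pi * (a * a)" by (simp add: h_def a2)
      also have "(pi * (a * a)) powr \<beta> * a powr (1 - 2*\<beta>) = pi powr \<beta> * a"
      proof -
        have "(a * a) powr \<beta> * a powr (1 - 2*\<beta>) = a powr (\<beta> + \<beta> + (1 - 2*\<beta>))"
          using a0 by (simp only: powr_mult powr_add)
        also have "\<dots> = a" using a0 by simp
        finally show ?thesis using a0 by (simp add: powr_mult mult.assoc)
      qed
      finally have "norm (integral {-pi..pi} F) \<le> (4 * K + 2 * K * pi powr \<beta> / (2*\<beta> - 1)) * a"
        by (simp add: algebra_simps)
      also have "\<dots> \<le> C * a"
      proof (intro mult_right_mono)
        have "2 * K * pi powr \<beta> / (2*\<beta> - 1) \<ge> 0" using K \<beta> by auto
        then have "4 * K + 2 * K * pi powr \<beta> / (2*\<beta> - 1) \<le> C1" unfolding C1_def using K by simp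
        also have "C1 \<le> C" unfolding C_def using K by simp
        finally show "4 * K + 2 * K * pi powr \<beta> / (2*\<beta> - 1) \<le> C" .
      qed (use a0 in auto)
      finally show ?thesis unfolding F_def a_def .
    qed
  qed
  then show thesis using that[OF C0] by blast
qed

lemma one_minus_rcis_ge:
  assumes \<rho>: "1/2 \<le> \<rho>" "\<rho> \<le> 1" and x: "\<bar>x\<bar> \<le> pi"
  shows "norm (1 - of_real \<rho> * cis x) \<ge> \<bar>x\<bar> / pi"
proof -
  define y where "y = \<bar>x\<bar>"
  have y: "0 \<le> y" "y \<le> pi" using x by (auto simp: y_def)
  have "sin (y / 2) = cos (pi/2 - y/2)" by (simp add: cos_diff)
  also have "\<dots> \<ge> 1 - 2 * (pi/2 - y/2) / pi" using y by (intro cos_ge_linear) auto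
  also have "1 - 2 * (pi/2 - y/2) / pi = y / pi" by (simp add: field_simps)
  finally have s: "sin (y/2) \<ge> y / pi" .
  have "(y / pi)^2 \<le> (sin (y/2))^2" using s y by (intro power_mono) auto
  also have "2 * (sin (y/2))^2 = 1 - cos y" using cos_double_sin[of "y/2"] by simp
  finally have c: "2 * (y / pi)^2 \<le> 1 - cos x" by (simp add: y_def)
  have "(norm (1 - of_real \<rho> * cis x))^2 = (1 - \<rho>)^2 + 2 * \<rho> * (1 - cos x)"
  proof -
    have "(norm (1 - of_real \<rho> * cis x))^2 = (1 - \<rho> * cos x)^2 + (\<rho> * sin x)^2"
      by (simp add: cmod_power2)
    also have "\<dots> = 1 - 2 * \<rho> * cos x + \<rho>^2 * ((sin x)^2 + (cos x)^2)"
      by algebra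
    also have "\<dots> = 1 - 2 * \<rho> * cos x + \<rho>^2" by (simp only: sin_cos_squared_add mult_1_right)
    finally show ?thesis by (simp add: power2_eq_square algebra_simps)
  qed
  also have "\<dots> \<ge> 0 + 1 * (1 - cos x)" using \<rho> by (intro add_mono mult_right_mono) auto
  finally have 1: "1 - cos x \<le> (norm (1 - of_real \<rho> * cis x))^2" by simp
  have "(y / pi)^2 \<le> 2 * (y / pi)^2" by simp
  from order_trans[OF order_trans[OF this c] 1]
  have "(y / pi)^2 \<le> (norm (1 - of_real \<rho> * cis x))^2" .
  then show ?thesis unfolding y_def by (rule power2_le_imp_le) simp
qed

lemma has_integral_cis_int:
  "((\<lambda>x. cis (of_int k * x)) has_integral (if k = 0 then 2 * of_real pi else 0)) {-pi..pi}"
proof (cases "k = 0")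
  case True
  then show ?thesis using has_integral_const_real[of "1::complex" "-pi" pi] by (simp add: scaleR_conv_of_real)
next
  case False
  define F where "F x = cis (of_int k * x) / (\<i> * of_int k)" for x
  have "((\<lambda>x. cis (of_int k * x)) has_integral (F pi - F (-pi))) {-pi..pi}"
  proof (rule fundamental_theorem_of_calculus)
    fix x
    have "((\<lambda>z. exp (\<i> * (of_int k * z)) / (\<i> * of_int k)) has_field_derivative exp (\<i> * (of_int k * of_real x))) (at (of_real x))"
      using False by (auto intro!: derivative_eq_intros simp: field_simps)
    from has_vector_derivative_real_field[OF this]
    show "(F has_vector_derivative cis (of_int k * x)) (at x within {-pi..pi})"
      unfolding F_def cis_conv_exp by simp
  qed simp
  moreover have "cis (of_int k * pi) = cis (of_int k * - pi)"
  proof -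
    have "cis (of_int k * pi) = cis (of_int k * - pi) * cis (2 * pi * of_int k)"
      by (simp add: cis_mult algebra_simps)
    also have "cis (2 * pi * of_int k) = 1" by (rule cis_multiple_2pi) auto
    finally show ?thesis by simp
  qed
  ultimately show ?thesis using False by (simp add: F_def)
qed

text \<open>Termwise integration, justified by uniform convergence on the circle.\<close>

lemma power_series_fourier_coefficient:
  fixes a :: "nat \<Rightarrow> complex"
  assumes sm: "summable (\<lambda>m. norm (a m) * \<rho> ^ m)" and \<rho>: "\<rho> \<ge> 0"
  shows "((\<lambda>x. cis (- real n * x) * (\<Sum>m. a m * (of_real \<rho> * cis x) ^ m)) has_integral 2 * of_real pi * a n * of_real (\<rho> ^ n)) {-pi..pi}"
proof -
  define g where "g m x = a m * of_real (\<rho> ^ m) * cis (of_int (int m - int n) * x)" for m x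
  have g_eq: "cis (- real n * x) * (a m * (of_real \<rho> * cis x) ^ m) = g m x" for m x
  proof -
    have "cis (- real n * x) * cis x ^ m = cis (of_int (int m - int n) * x)"
    proof -
      have "- real n * x + real m * x = of_int (int m - int n) * x" by (simp add: left_diff_distrib)
      moreover have "cis x ^ m = cis (real m * x)" by (rule Complex.DeMoivre)
      ultimately show ?thesis by (simp only: cis_mult)
    qed
    then show ?thesis unfolding g_def power_mult_distrib by (simp add: mult_ac)
  qed
  have ng: "norm (g m x) \<le> norm (a m) * \<rho> ^ m" for m x
    using \<rho> by (simp add: g_def norm_mult norm_power)
  have ul: "uniform_limit {-pi..pi} (\<lambda>N x. \<Sum>m<N. g m x) (\<lambda>x. \<Sum>m. g m x) sequentially"
    by (rule Weierstrass_m_test[OF ng sm])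
  have cont: "continuous_on {-pi..pi} (\<lambda>x. \<Sum>m<N. g m x)" for N
    unfolding g_def by (intro continuous_intros)
  obtain I J where IJ: "\<And>N. ((\<lambda>x. \<Sum>m<N. g m x) has_integral I N) {-pi..pi}"
    "((\<lambda>x. \<Sum>m. g m x) has_integral J) {-pi..pi}" "(I \<longlongrightarrow> J) sequentially"
    by (rule uniform_limit_integral[OF ul cont]) auto
  have gi: "(g m has_integral a m * of_real (\<rho> ^ m) * (if m = n then 2 * of_real pi else 0)) {-pi..pi}" for m
    using has_integral_mult_right[OF has_integral_cis_int[of "int m - int n"], of "a m * of_real (\<rho> ^ m)"]
    unfolding g_def[abs_def] by simp
  have "I N = 2 * of_real pi * a n * of_real (\<rho> ^ n)" if "N > n" for N
  proof -
    have "((\<lambda>x. \<Sum>m<N. g m x) has_integral (\<Sum>m<N. a m * of_real (\<rho> ^ m) * (if m = n then 2 * of_real pi else 0))) {-pi..pi}"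
      by (intro has_integral_sum gi) auto
    then have "I N = (\<Sum>m<N. a m * of_real (\<rho> ^ m) * (if m = n then 2 * of_real pi else 0))"
      using IJ(1) has_integral_unique by blast
    also have "\<dots> = (\<Sum>m<N. if m = n then a m * of_real (\<rho> ^ m) * (2 * of_real pi) else 0)"
      by (intro sum.cong) auto
    also have "\<dots> = a n * of_real (\<rho> ^ n) * (2 * of_real pi)" using that by simp
    finally show ?thesis by simp
  qed
  then have "I \<longlonglongrightarrow> 2 * of_real pi * a n * of_real (\<rho> ^ n)"
    by (intro tendsto_eventually) (auto intro: eventually_mono[OF eventually_gt_at_top[of n]])
  then have J: "J = 2 * of_real pi * a n * of_real (\<rho> ^ n)" using IJ(3) LIMSEQ_unique by blast
  have sg: "summable (\<lambda>m. a m * (of_real \<rho> * cis x) ^ m)" for x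
    by (rule summable_comparison_test'[OF sm, of 0]) (use \<rho> in \<open>simp add: norm_mult norm_power\<close>)
  have "(\<Sum>m. g m x) = cis (- real n * x) * (\<Sum>m. a m * (of_real \<rho> * cis x) ^ m)" for x
    unfolding g_eq[symmetric] by (rule suminf_mult[OF sg])
  then show ?thesis using IJ(2) unfolding J by simp
qed

lemma norm_one_minus_cis_le:
  assumes "0 \<le> h" shows "norm (1 - cis h) \<le> h"
proof (rule power2_le_imp_le[OF _ assms])
  have "(norm (1 - cis h))\<^sup>2 = (1 - cos h)\<^sup>2 + (sin h)\<^sup>2" by (simp add: cmod_power2)
  also have "\<dots> = 2 - 2 * cos h"
    using sin_cos_squared_add[of h] by (simp add: power2_eq_square algebra_simps)
  also have "\<dots> = (2 * sin (h / 2))\<^sup>2"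
    using cos_double_sin[of "h / 2"] by (simp add: power_mult_distrib)
  also have "\<dots> \<le> h\<^sup>2"
    using abs_sin_x_le_abs_x[of "h / 2"] by (intro abs_le_square_iff[THEN iffD1]) (simp add: abs_mult)
  finally show "(norm (1 - cis h))\<^sup>2 \<le> h\<^sup>2" .
qed

section \<open>The operator generating function of the return times\<close>

text \<open>\<open>t n\<close> stands for \<open>\<mu>(\<phi> > n)\<close>, so \<open>t n - t (Suc n)\<close> is \<open>\<mu>(\<phi> = n + 1)\<close> and \<open>norm_R\<close> is
hypothesis (H1).\<close>

locale renewal_sequence =
  fixes Rn :: "nat \<Rightarrow> 'b::banach \<Rightarrow>\<^sub>L 'b" and t H :: "nat \<Rightarrow> real" and c \<beta> C0 :: real
  assumes \<beta>: "1/2 < \<beta>" "\<beta> < 1" and c: "c > 0" and C0: "C0 \<ge> 0"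
    and t_mono: "\<And>n. t (Suc n) \<le> t n" and t_0: "t 0 = 1"
    and tail: "\<And>n. n \<ge> 1 \<Longrightarrow> t n = c * (real n powr - \<beta> + H n)"
    and H: "H \<in> O(\<lambda>n. real n powr (- 2 * \<beta>))"
    and norm_R: "\<And>n. norm (Rn (Suc n)) \<le> C0 * (t n - t (Suc n))"
begin

lemma tail_decay: obtains C where "C \<ge> 0" "\<And>n. n \<ge> 1 \<Longrightarrow> \<bar>t n\<bar> \<le> C * real n powr - \<beta>"
proof -
  obtain C where C: "C \<ge> 0" "\<And>n. n \<ge> 1 \<Longrightarrow> \<bar>H n\<bar> \<le> C * real n powr (- 2 * \<beta>)"
    using H by (rule bigo_nat_bound) auto
  show thesis
  proof (rule that[of "c * (1 + C)"])
    show "c * (1 + C) \<ge> 0" using c C by auto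
    fix n :: nat assume n: "n \<ge> 1"
    have "real n powr (- 2 * \<beta>) \<le> real n powr - \<beta>" using n \<beta> by (intro powr_mono) auto
    then have "C * real n powr (- 2 * \<beta>) \<le> C * real n powr - \<beta>" using C by (intro mult_left_mono)
    then have "\<bar>real n powr - \<beta> + H n\<bar> \<le> (1 + C) * real n powr - \<beta>"
      using C(2)[OF n] powr_ge_zero[of "real n" "-\<beta>"] unfolding distrib_right by linarith
    then show "\<bar>t n\<bar> \<le> c * (1 + C) * real n powr - \<beta>"
      unfolding tail[OF n] abs_mult mult.assoc using c by (auto intro: mult_left_mono)
  qed
qed

lemma tail_limit: "t \<longlonglongrightarrow> 0"
proof -
  obtain C where C: "C \<ge> 0" "\<And>n. n \<ge> 1 \<Longrightarrow> \<bar>t n\<bar> \<le> C * real n powr - \<beta>" by (rule tail_decay) blast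
  have "(\<lambda>n. C * real n powr - \<beta>) \<longlonglongrightarrow> C * 0"
    using \<beta> by (intro tendsto_intros tendsto_neg_powr filterlim_real_sequentially) auto
  then show ?thesis
    by (intro Lim_null_comparison[of t "\<lambda>n. C * real n powr - \<beta>"])
       (auto intro!: eventually_sequentiallyI[of 1] C)
qed

lemma tail_increment_sums: "(\<lambda>k. t (k + N) - t (Suc (k + N))) sums t N"
proof -
  have "(\<lambda>n. t (n + N)) \<longlonglongrightarrow> 0" by (rule LIMSEQ_ignore_initial_segment[OF tail_limit])
  from telescope_sums'[OF this] show ?thesis by simp
qed

lemma norm_term_le: "norm (cscale w o\<^sub>L complexify (Rn (Suc n))) \<le> 2 * norm w * (C0 * (t n - t (Suc n)))"
proof -
  have "norm (cscale w :: ('b \<times> 'b) \<Rightarrow>\<^sub>L _) * norm (complexify (Rn (Suc n))) \<le> (2 * norm w) * (C0 * (t n - t (Suc n)))"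
    by (intro mult_mono norm_cscale_le order_trans[OF norm_complexify_le norm_R]) auto
  then show ?thesis by (rule order_trans[OF norm_blinfun_compose])
qed

lemma R_summable:
  assumes "norm z \<le> 1" shows "summable (\<lambda>n. cscale (z ^ Suc n) o\<^sub>L complexify (Rn (Suc n)))"
proof (rule summable_comparison_test')
  show "summable (\<lambda>n. 2 * (C0 * (t n - t (Suc n))))"
    using tail_increment_sums[of 0] by (intro summable_mult) (auto simp: sums_iff)
  fix n :: nat
  have "norm (cscale (z ^ Suc n) o\<^sub>L complexify (Rn (Suc n))) \<le> 2 * norm (z ^ Suc n) * (C0 * (t n - t (Suc n)))"
    by (rule norm_term_le)
  also have "\<dots> \<le> 2 * 1 * (C0 * (t n - t (Suc n)))"
    using assms t_mono[of n] C0 by (intro mult_right_mono mult_left_mono) (auto simp: norm_power simp del: power_Suc intro!: power_le_one)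
  finally show "norm (cscale (z ^ Suc n) o\<^sub>L complexify (Rn (Suc n))) \<le> 2 * (C0 * (t n - t (Suc n)))" by simp
qed

lemma R_sums_apply:
  assumes "norm z \<le> 1"
  shows "(\<lambda>n. cscale (z ^ Suc n) (complexify (Rn (Suc n)) x)) sums (R_gen Rn z x)"
  using bounded_linear.sums[OF blinfun.bounded_linear_left summable_sums[OF R_summable[OF assms]], of x]
  by (simp add: R_gen_def del: blinfun_apply_cscale blinfun_apply_complexify)

lemma R_commute:
  assumes "norm z \<le> 1" shows "R_gen Rn z (cscale w x) = cscale w (R_gen Rn z x)"
proof -
  have "(\<lambda>n. cscale w (cscale (z ^ Suc n) (complexify (Rn (Suc n)) x))) sums (cscale w (R_gen Rn z x))"
    by (rule bounded_linear.sums[OF blinfun.bounded_linear_right R_sums_apply[OF assms]])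
  moreover have "cscale w (cscale (z ^ Suc n) (complexify (Rn (Suc n)) x)) = cscale (z ^ Suc n) (complexify (Rn (Suc n)) (cscale w x))" for n
    unfolding cscale_complexify_commute[symmetric] by (rule cscale_commute)
  ultimately show ?thesis using R_sums_apply[OF assms, of "cscale w x"] sums_unique2 by force
qed

text \<open>By (H1) the tails of \<open>\<Sum>\<parallel>R\<^sub>n\<parallel>\<close> decay like those of the return time.\<close>

lemma R_holder:
  obtains K where "K \<ge> 0"
    "\<And>z z'. norm z \<le> 1 \<Longrightarrow> norm z' \<le> 1 \<Longrightarrow> norm (R_gen Rn z - R_gen Rn z') \<le> K * norm (z - z') powr \<beta>"
proof -
  define a where "a n = (case n of 0 \<Rightarrow> 0 | Suc k \<Rightarrow> C0 * (t k - t (Suc k)))" for n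
  have a0: "a n \<ge> 0" for n using C0 t_mono by (auto simp: a_def split: nat.split)
  have as: "(\<lambda>k. a (k + N + 1)) sums (C0 * t N)" for N
    using sums_mult[OF tail_increment_sums[of N], of C0] by (simp add: a_def)
  have "summable (\<lambda>n. a (Suc n))" using as[of 0] by (simp add: sums_iff)
  then have sm: "summable a" by (simp add: summable_Suc_iff)
  obtain C where C: "C \<ge> 0" "\<And>n. n \<ge> 1 \<Longrightarrow> \<bar>t n\<bar> \<le> C * real n powr - \<beta>" by (rule tail_decay) blast
  have tl: "(\<Sum>k. a (k + N + 1)) \<le> C0 * C * real N powr - \<beta>" if "N \<ge> 1" for N
    using as[of N] mult_left_mono[OF C(2)[OF that] C0] C0 by (auto simp: sums_iff mult.assoc intro: order_trans[OF mult_left_mono[OF abs_ge_self]])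
  obtain K where K: "K \<ge> 0" "\<And>h. h \<ge> 0 \<Longrightarrow> summable (\<lambda>n. a n * min 2 (real n * h))"
     "\<And>h. h \<ge> 0 \<Longrightarrow> (\<Sum>n. a n * min 2 (real n * h)) \<le> K * h powr \<beta>"
    by (rule holder_of_tail[of a \<beta> "C0 * C"]) (use a0 sm \<beta> tl in auto)
  show thesis
  proof (rule that[of "2 * K"])
    show "2 * K \<ge> 0" using K by simp
    fix z z' :: complex assume z: "norm z \<le> 1" "norm z' \<le> 1"
    define h where "h = norm (z - z')"
    have h: "h \<ge> 0" by (simp add: h_def)
    define d where "d n = cscale (z ^ Suc n - z' ^ Suc n) o\<^sub>L complexify (Rn (Suc n))" for n
    have d: "d n = (cscale (z ^ Suc n) o\<^sub>L complexify (Rn (Suc n))) - (cscale (z' ^ Suc n) o\<^sub>L complexify (Rn (Suc n)))" for n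
      unfolding d_def by (simp only: cscale_diff compose_simps)
    have eq: "R_gen Rn z - R_gen Rn z' = (\<Sum>n. d n)"
      unfolding R_gen_def d by (rule suminf_diff[OF R_summable[OF z(1)] R_summable[OF z(2)]])
    have sS: "summable (\<lambda>n. 2 * (a (Suc n) * min 2 (real (Suc n) * h)))"
      using K(2)[OF h] by (intro summable_mult) (subst summable_Suc_iff)
    have le: "norm (d n) \<le> 2 * (a (Suc n) * min 2 (real (Suc n) * h))" for n
    proof -
      have "norm (d n) \<le> 2 * norm (z ^ Suc n - z' ^ Suc n) * a (Suc n)"
        unfolding d_def a_def using norm_term_le by simp
      also have "\<dots> \<le> 2 * min 2 (real (Suc n) * h) * a (Suc n)"
        unfolding h_def by (intro mult_right_mono mult_left_mono norm_power_diff_min z a0) auto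
      finally show ?thesis by (simp add: mult_ac)
    qed
    have "norm (\<Sum>n. d n) \<le> (\<Sum>n. 2 * (a (Suc n) * min 2 (real (Suc n) * h)))"
      by (rule norm_suminf_le[OF le sS])
    also have "\<dots> = 2 * (\<Sum>n. a (Suc n) * min 2 (real (Suc n) * h))"
      by (intro suminf_mult) (use K(2)[OF h] in \<open>subst summable_Suc_iff\<close>)
    also have "(\<Sum>n. a (Suc n) * min 2 (real (Suc n) * h)) = (\<Sum>n. a n * min 2 (real n * h))"
      using suminf_split_head[OF K(2)[OF h]] by (simp add: a_def)
    also have "\<dots> \<le> K * h powr \<beta>" by (rule K(3)[OF h])
    finally show "norm (R_gen Rn z - R_gen Rn z') \<le> 2 * K * norm (z - z') powr \<beta>"
      unfolding eq h_def by simp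
  qed
qed

lemma continuous_on_R: "continuous_on (cball 0 1) (R_gen Rn)"
proof -
  obtain K where K: "K \<ge> 0"
    "\<And>z z'. norm z \<le> 1 \<Longrightarrow> norm z' \<le> 1 \<Longrightarrow> norm (R_gen Rn z - R_gen Rn z') \<le> K * norm (z - z') powr \<beta>"
    by (rule R_holder) blast
  show ?thesis unfolding continuous_on_def
  proof
    fix x :: complex assume x: "x \<in> cball 0 1"
    have "((\<lambda>y. K * norm (y - x) powr \<beta>) \<longlongrightarrow> K * norm (x - x) powr \<beta>) (at x within cball 0 1)"
      using \<beta> by (intro tendsto_intros) auto
    moreover have "K * norm (x - x) powr \<beta> = 0" by simp
    ultimately have "((\<lambda>y. K * norm (y - x) powr \<beta>) \<longlongrightarrow> 0) (at x within cball 0 1)" by metis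
    then have "((\<lambda>y. R_gen Rn y - R_gen Rn x) \<longlongrightarrow> 0) (at x within cball 0 1)"
      by (rule Lim_null_comparison[rotated])
         (use K x in \<open>auto simp: eventually_at_filter\<close>)
    then show "(R_gen Rn \<longlongrightarrow> R_gen Rn x) (at x within cball 0 1)" by (simp add: LIM_zero_iff)
  qed
qed

end

text \<open>\<open>P\<close> is the rank one projection onto the constants; \<open>unit\<close> is the constant function \<open>1\<close>, \<open>\<nu>\<close> the integral,
and \<open>D0\<close> the inverse of \<open>I - R(1) + P\<close>, which exists because \<open>P\<close> removes the eigenvalue \<open>1\<close>.\<close>

locale renewal_operators = renewal_sequence Rn t H c \<beta> C0
  for Rn :: "nat \<Rightarrow> 'b::banach \<Rightarrow>\<^sub>L 'b" and t H :: "nat \<Rightarrow> real" and c \<beta> C0 :: real +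
  fixes P :: "'b \<Rightarrow>\<^sub>L 'b" and unit :: 'b and \<nu> :: "'b \<Rightarrow>\<^sub>L real"
    and D0 :: "('b \<times> 'b) \<Rightarrow>\<^sub>L ('b \<times> 'b)"
  assumes P_eq: "\<And>v. P v = \<nu> v *\<^sub>R unit" and \<nu>_unit: "\<nu> unit = 1"
    and \<nu>_R: "\<And>n. \<nu> (Rn (Suc n) unit) = t n - t (Suc n)"
    and R1_unit: "R_gen Rn 1 (unit, 0) = (unit, 0)"
    and P_R: "\<And>x. complexify P (R_gen Rn 1 x) = complexify P x"
    and D0: "inverse_op (id_blinfun - R_gen Rn 1 + complexify P) D0"
    and H2: "\<And>z. cmod z \<le> 1 \<Longrightarrow> z \<noteq> 1 \<Longrightarrow> 1 \<notin> op_spectrum (R_gen Rn z)"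
begin

definition T_gen :: "complex \<Rightarrow> ('b \<times> 'b) \<Rightarrow>\<^sub>L ('b \<times> 'b)" where
  "T_gen z = (SOME B. inverse_op (id_blinfun - R_gen Rn z) B)"

lemma T_gen: "norm z \<le> 1 \<Longrightarrow> z \<noteq> 1 \<Longrightarrow> inverse_op (id_blinfun - R_gen Rn z) (T_gen z)"
proof -
  assume "norm z \<le> 1" "z \<noteq> 1"
  from H2[OF this] have "\<exists>B. inverse_op (cscale 1 - R_gen Rn z) B" unfolding op_spectrum_def by blast
  then show ?thesis unfolding T_gen_def cscale_1 by (rule someI_ex)
qed

lemma continuous_on_T_gen: "continuous_on (cball 0 1 - {1}) T_gen"
  by (rule continuous_on_inverse_op[OF _ T_gen])
     (auto intro!: continuous_intros continuous_on_subset[OF continuous_on_R])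

definition \<nu>c :: "'b \<times> 'b \<Rightarrow> complex" where
  "\<nu>c p = of_real (\<nu> (fst p)) + \<i> * of_real (\<nu> (snd p))"

lemma bounded_linear_\<nu>c: "bounded_linear \<nu>c"
  unfolding \<nu>c_def
  by (intro bounded_linear_add bounded_linear_const_mult bounded_linear_compose[OF bounded_linear_of_real]
      bounded_linear_compose[OF blinfun.bounded_linear_right] bounded_linear_fst bounded_linear_snd)

lemma \<nu>c_cscale: "\<nu>c (cscale z p) = z * \<nu>c p"
  by (simp add: \<nu>c_def blinfun.bilinear_simps complex_eq_iff)

lemma complexify_P: "complexify P p = cscale (\<nu>c p) (unit, 0)"
  by (simp add: \<nu>c_def P_eq)

lemma \<nu>c_unit: "\<nu>c (unit, 0) = 1"
  by (simp add: \<nu>c_def \<nu>_unit blinfun.bilinear_simps)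

text \<open>The scalar generating function \<open>\<Sum>n. z ^ n \<mu>(\<phi> = n)\<close>, see \<open>r_sums\<close> below.\<close>

definition r :: "complex \<Rightarrow> complex" where "r z = \<nu>c (R_gen Rn z (unit, 0))"

lemma r_sums:
  assumes "norm z \<le> 1" shows "(\<lambda>n. of_real (t n - t (Suc n)) * z ^ Suc n) sums r z"
proof -
  have "(\<lambda>n. \<nu>c (cscale (z ^ Suc n) (complexify (Rn (Suc n)) (unit, 0)))) sums r z"
    unfolding r_def by (rule bounded_linear.sums[OF bounded_linear_\<nu>c R_sums_apply[OF assms]])
  moreover have "\<nu>c (cscale (z ^ Suc n) (complexify (Rn (Suc n)) (unit, 0))) = of_real (t n - t (Suc n)) * z ^ Suc n" for n
    unfolding \<nu>c_cscale by (simp add: \<nu>c_def \<nu>_R blinfun.bilinear_simps)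
  ultimately show ?thesis by simp
qed

lemma \<nu>c_R1: "\<nu>c (R_gen Rn 1 x) = \<nu>c x"
proof -
  have "cscale (\<nu>c (R_gen Rn 1 x)) (unit, 0) = cscale (\<nu>c x) (unit, 0)"
    using P_R[of x] unfolding complexify_P .
  then have "\<nu>c (cscale (\<nu>c (R_gen Rn 1 x)) (unit, 0)) = \<nu>c (cscale (\<nu>c x) (unit, 0))"
    by (rule arg_cong)
  then show ?thesis unfolding \<nu>c_cscale \<nu>c_unit by simp
qed

end

context renewal_sequence
begin

text \<open>An eigenvector for the eigenvalue \<open>1\<close> is fixed by \<open>P\<close>, hence a multiple of \<open>unit\<close>; so \<open>unit\<close> itself
is fixed by \<open>R(1)\<close>. The inverse of \<open>I - R(1) + P\<close> is \<open>G (I - P) + P\<close> with \<open>G\<close> from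
\<open>resolvent_identity\<close>.\<close>

lemma spectral_consequences:
  assumes eig: "simple_eigenvalue (R_gen Rn 1) 1"
    and P: "spectral_projection (R_gen Rn 1) 1 (complexify P)"
    and P_eq: "\<And>v. P v = \<nu> v *\<^sub>R unit" and \<nu>_unit: "\<nu> unit = (1::real)"
    and lin: "bounded_linear \<nu>"
  obtains D0 where "R_gen Rn 1 (unit, 0) = (unit, 0)"
    and "\<And>x. complexify P (R_gen Rn 1 x) = complexify P x"
    and "inverse_op (id_blinfun - R_gen Rn 1 + complexify P) D0"
proof -
  define A where "A = R_gen Rn 1"
  define Pc where "Pc = complexify P"
  have comm: "A (cscale z x) = cscale z (A x)" for z x
    unfolding A_def by (rule R_commute) simp
  obtain G where G: "(id_blinfun - A) o\<^sub>L G = id_blinfun - Pc" "G o\<^sub>L (id_blinfun - A) = id_blinfun - Pc"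
    "\<And>x. Pc (A x) = A (Pc x)" "\<And>x. A x = x \<Longrightarrow> Pc x = x"
    "\<And>(C :: ('b \<times> 'b) \<Rightarrow>\<^sub>L ('b \<times> 'b)) x. (\<And>x. A (C x) = C (A x)) \<Longrightarrow> (\<And>z x. cscale z (C x) = C (cscale z x)) \<Longrightarrow> G (C x) = C (G x)"
    unfolding Pc_def by (rule resolvent_identity[OF comm P[folded A_def]]) (rule that[unfolded Pc_def]; blast)
  obtain Q u where u: "u \<noteq> 0" "A u = u"
    using eig unfolding simple_eigenvalue_def A_def by auto
  define \<zeta> where "\<zeta> = Complex (\<nu> (fst u)) (\<nu> (snd u))"
  have Pc_eq: "Pc x = cscale (Complex (\<nu> (fst x)) (\<nu> (snd x))) (unit, 0)" for x
    by (simp add: Pc_def P_eq)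
  have u_eq: "u = cscale \<zeta> (unit, 0)"
    using G(4)[OF u(2)] Pc_eq[of u] unfolding \<zeta>_def by simp
  have \<zeta>: "\<zeta> \<noteq> 0" using u(1) u_eq by (metis cscale_0 blinfun.zero_left)
  have "A (cscale (1 / \<zeta>) u) = cscale (1 / \<zeta>) u" unfolding comm u(2) ..
  moreover have "cscale (1 / \<zeta>) u = (unit, 0)"
  proof -
    have "cscale (1 / \<zeta>) u = cscale (1 / \<zeta> * \<zeta>) (unit, 0)"
      by (subst u_eq) (simp only: cscale_mult blinfun_apply_blinfun_compose)
    then show ?thesis using \<zeta> by simp
  qed
  ultimately have A1: "A (unit, 0) = (unit, 0)" by simp
  have AP: "A (Pc x) = Pc x" for x unfolding Pc_eq comm A1 ..
  have PA: "Pc (A x) = Pc x" for x unfolding G(3) AP ..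
  have \<nu>0: "\<nu> (a *\<^sub>R unit) = a" for a
    using linear_scale[OF bounded_linear.linear[OF lin], of a unit] \<nu>_unit by simp
  have PP: "Pc (Pc x) = Pc x" for x
    by (simp add: Pc_def P_eq \<nu>0)
  have GP: "G (Pc x) = Pc (G x)" for x
    by (rule G(5)) (simp_all only: AP PA, simp_all only: Pc_def cscale_complexify_commute)
  have G1: "G x - A (G x) = x - Pc x" for x
    using arg_cong[OF G(1), of "\<lambda>X. blinfun_apply X x"] by (simp add: blinfun.diff_left)
  have G2: "G (x - A x) = x - Pc x" for x
    using arg_cong[OF G(2), of "\<lambda>X. blinfun_apply X x"] by (simp add: blinfun.diff_left)
  define D0 where "D0 = (G o\<^sub>L (id_blinfun - Pc)) + Pc"
  have inv: "inverse_op (id_blinfun - A + Pc) D0"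
    unfolding inverse_op_def
  proof (intro conjI blinfun_eqI)
    fix x
    define y where "y = G (x - Pc x)"
    have "Pc y = 0"
      unfolding y_def GP[symmetric] blinfun.diff_right PP by simp
    then have "y - A y + Pc y = x - Pc x"
      using G1[of "x - Pc x"] unfolding y_def by (simp add: blinfun.diff_right PP)
    then show "((id_blinfun - A + Pc) o\<^sub>L D0) x = id_blinfun x"
      by (simp add: D0_def blinfun.bilinear_simps AP PP y_def[symmetric] flip: blinfun.diff_right)
    define w where "w = x - A x + Pc x"
    have "Pc w = Pc x" by (simp add: w_def blinfun.bilinear_simps PA PP)
    moreover have "w - Pc x = x - A x" by (simp add: w_def)
    ultimately show "(D0 o\<^sub>L (id_blinfun - A + Pc)) x = id_blinfun x"
      using G2[of x] by (simp add: D0_def blinfun.bilinear_simps w_def[symmetric] flip: blinfun.diff_right)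
  qed
  show thesis
    using that[of D0] A1 PA inv unfolding A_def Pc_def by blast
qed

end

section \<open>The renewal resolvent near 1\<close>

context renewal_operators
begin

lemma D0_P: "D0 (complexify P x) = complexify P x"
proof -
  have "(id_blinfun - R_gen Rn 1 + complexify P) (complexify P x)
      = complexify P x - R_gen Rn 1 (complexify P x) + complexify P (complexify P x)"
    by (simp only: blinfun.add_left blinfun.diff_left blinfun_apply_id_blinfun id_apply)
  also have "R_gen Rn 1 (complexify P x) = complexify P x"
    unfolding complexify_P by (subst R_commute) (simp_all only: R1_unit norm_one order_refl)
  also have "complexify P (complexify P x) = complexify P x"
    unfolding complexify_P \<nu>c_cscale \<nu>c_unit by simp
  finally have "(id_blinfun - R_gen Rn 1 + complexify P) (complexify P x) = complexify P x" by simp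
  then show ?thesis using inverse_op_left[OF D0, of "complexify P x"] by simp
qed

text \<open>Let \<open>x = T(z) v\<close>, \<open>a = \<nu>(x)\<close>, \<open>y = x - P x\<close>, \<open>\<Delta> = R(1) - R(z)\<close> and \<open>h = |1 - z|\<close>, so that
\<open>\<Delta> = O(h powr \<beta>)\<close>. Applying \<open>D0\<close> to \<open>(I - R(1) + P) x = v - \<Delta> x + P x\<close> gives
\<open>y = D0 v - D0 \<Delta> x\<close>, and applying \<open>\<nu>\<close> gives \<open>\<nu>(v) = (1 - r(z)) a + \<nu>(\<Delta> y)\<close>. The lower bound
for \<open>|1 - r(z)|\<close> lets one solve this pair of equations: first \<open>h powr \<beta> * |a|\<close>, then \<open>y\<close>, and finally
\<open>a - \<nu>(v) / (1 - r(z))\<close> are \<open>O(\<parallel>v\<parallel>)\<close>.\<close>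

lemma T_gen_near_1:
  fixes w :: "complex \<Rightarrow> complex"
  defines "w \<equiv> \<lambda>z. 1 - r z"
  assumes \<delta>: "\<delta> > 0" and c1: "c1 > 0"
    and w_ge: "\<And>z. norm z < 1 \<Longrightarrow> norm (1 - z) < \<delta> \<Longrightarrow> norm (w z) \<ge> c1 * norm (1 - z) powr \<beta>"
  obtains \<delta>' C where "\<delta>' > 0" "\<delta>' \<le> \<delta>" "C \<ge> 0"
    "\<And>z. norm z < 1 \<Longrightarrow> norm (1 - z) < \<delta>' \<Longrightarrow> norm (T_gen z - (cscale (1 / w z) o\<^sub>L complexify P)) \<le> C"
proof -
  obtain K where K: "K \<ge> 0"
    "\<And>z z'. norm z \<le> 1 \<Longrightarrow> norm z' \<le> 1 \<Longrightarrow> norm (R_gen Rn z - R_gen Rn z') \<le> K * norm (z - z') powr \<beta>"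
    by (rule R_holder) blast
  obtain M where M: "M > 0" "\<And>x. norm (\<nu>c x) \<le> norm x * M"
    using bounded_linear.pos_bounded[OF bounded_linear_\<nu>c] by auto
  define d where "d = norm D0"
  define q where "q = norm (unit, 0 :: 'b)"
  have dq: "d \<ge> 0" "q \<ge> 0" by (auto simp: d_def q_def)
  define M' where "M' = M + M * K * (2 * d)"
  define X where "X = 2 * M' / c1"
  define Yc where "Yc = 2 * d + 4 * d * q * K * X"
  have pos: "M' > 0" "X \<ge> 0" "Yc \<ge> 0" using M K dq c1 by (auto simp: M'_def X_def Yc_def add_pos_nonneg)
  \<comment> \<open>The three bounds on \<open>h powr \<beta>\<close> absorb, in turn, \<open>y\<close> in the first equation, constants, and \<open>a\<close> in the second.\<close>
  define B where "B = min (1 / (2 * (d * K + 1))) (min 1 (c1 / (2 * (4 * M * d * q * K * K + 1))))"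
  have Bp: "B > 0" unfolding B_def using dq K c1 M by (auto simp: add_nonneg_pos)
  define \<delta>' where "\<delta>' = min \<delta> (B powr (1/\<beta>))"
  have \<delta>': "\<delta>' > 0" "\<delta>' \<le> \<delta>" using \<delta> Bp by (auto simp: \<delta>'_def)
  have main: "norm (T_gen z v - cscale (1 / w z) (complexify P v)) \<le> (Yc + 2 * (M * K * Yc / c1) * q) * norm v"
    if z: "norm z < 1" "norm (1 - z) < \<delta>'" for z v
  proof -
    define h where "h = norm (1 - z)"
    have h: "h > 0" using z by (auto simp: h_def)
    define hb where "hb = h powr \<beta>"
    have hb0: "hb > 0" using h by (simp add: hb_def)
    have "hb \<le> (B powr (1/\<beta>)) powr \<beta>"
      unfolding hb_def using z h \<beta> by (intro powr_mono2) (auto simp: h_def \<delta>'_def)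
    also have "\<dots> = B" using Bp \<beta> by (simp add: powr_powr)
    finally have hbB: "hb \<le> B" .
    have hb1: "d * K * hb \<le> 1/2"
    proof -
      have "hb \<le> 1 / (2 * (d * K + 1))" using hbB by (simp add: B_def)
      moreover have "d * K \<ge> 0" using dq K by simp
      ultimately have "hb * (2 * (d * K + 1)) \<le> 1" by (simp add: pos_le_divide_eq)
      then show ?thesis using hb0 by (simp add: algebra_simps)
    qed
    have hb2: "hb \<le> 1" using hbB by (simp add: B_def)
    have hb3: "4 * M * d * q * K * K * hb \<le> c1 / 2"
    proof -
      have p: "4 * M * d * q * K * K \<ge> 0" using M dq K by auto
      have "hb \<le> c1 / (2 * (4 * M * d * q * K * K + 1))" using hbB by (simp add: B_def)
      then have "hb * (2 * (4 * M * d * q * K * K + 1)) \<le> c1" using p by (simp add: pos_le_divide_eq)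
      then show ?thesis using hb0 by (simp add: algebra_simps)
    qed
    define \<Delta> where "\<Delta> = R_gen Rn 1 - R_gen Rn z"
    have n\<Delta>: "norm (\<Delta> x) \<le> K * hb * norm x" for x
      unfolding \<Delta>_def hb_def h_def
      by (rule order_trans[OF norm_blinfun]) (use z in \<open>auto intro!: mult_right_mono K(2)\<close>)
    define x where "x = T_gen z v"
    have z1: "norm z \<le> 1" "z \<noteq> 1" using z by auto
    have x: "x - R_gen Rn z x = v"
      using inverse_op_right[OF T_gen[OF z1], of v] by (simp add: x_def blinfun.diff_left)
    define a where "a = \<nu>c x"
    define y where "y = x - complexify P x"
    have Px: "complexify P x = cscale a (unit, 0)" unfolding a_def by (rule complexify_P)
    have nPx: "norm (complexify P x) \<le> 2 * norm a * q"
      unfolding Px q_def by (rule norm_cscale_apply_le)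
    have nx: "norm x \<le> norm y + 2 * norm a * q"
    proof -
      have "x = y + complexify P x" by (simp only: y_def diff_add_cancel)
      then have "norm x \<le> norm y + norm (complexify P x)" by (metis norm_triangle_ineq)
      then show ?thesis using nPx by linarith
    qed
    have "(id_blinfun - R_gen Rn 1 + complexify P) x = v - \<Delta> x + complexify P x"
      unfolding x[symmetric] \<Delta>_def
      by (simp only: blinfun.add_left blinfun.diff_left blinfun_apply_id_blinfun id_apply) (simp only: algebra_simps)
    then have "x = D0 v - D0 (\<Delta> x) + complexify P x"
      using inverse_op_left[OF D0, of x] by (simp only: blinfun.add_right blinfun.diff_right D0_P)
    then have y: "y = D0 v - D0 (\<Delta> x)" unfolding y_def by (metis add_diff_cancel_right')
    have "norm y \<le> norm (D0 v) + norm (D0 (\<Delta> x))" unfolding y by (rule norm_triangle_ineq4)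
    also have "\<dots> \<le> d * norm v + d * (K * hb * norm x)"
      unfolding d_def
      by (intro add_mono norm_blinfun order_trans[OF norm_blinfun] mult_left_mono n\<Delta> norm_ge_zero)
    also have "d * (K * hb * norm x) \<le> d * (K * hb * (norm y + 2 * norm a * q))"
      using dq K hb0 by (intro mult_left_mono nx) auto
    also have "d * (K * hb * (norm y + 2 * norm a * q)) = (d * K * hb) * norm y + 2 * d * q * K * (hb * norm a)"
      by (simp add: algebra_simps)
    also have "(d * K * hb) * norm y \<le> (1/2) * norm y" by (intro mult_right_mono hb1) auto
    finally have ny: "norm y \<le> 2 * d * norm v + 4 * d * q * K * (hb * norm a)" by simp
    have nv: "\<nu>c v = w z * a + \<nu>c (\<Delta> y)"
    proof -
      have L: "\<nu>c (p + p') = \<nu>c p + \<nu>c p'" "\<nu>c (p - p') = \<nu>c p - \<nu>c p'" for p p'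
        using bounded_linear_\<nu>c by (simp_all add: bounded_linear.linear linear_add linear_diff)
      have \<Delta>x: "\<nu>c (\<Delta> p) = \<nu>c p - \<nu>c (R_gen Rn z p)" for p
        unfolding \<Delta>_def blinfun.diff_left L \<nu>c_R1 ..
      have "\<nu>c v = \<nu>c (\<Delta> x)" unfolding \<Delta>x x[symmetric] L ..
      also have "\<Delta> x = \<Delta> (complexify P x) + \<Delta> y"
        unfolding y_def blinfun.diff_right by simp
      also have "\<nu>c (\<Delta> (complexify P x)) = w z * a"
        unfolding \<Delta>x Px R_commute[OF z1(1)] \<nu>c_cscale \<nu>c_unit r_def[symmetric] w_def by (simp add: algebra_simps)
      ultimately show ?thesis by (simp add: L)
    qed
    have key: "norm (w z * a - \<nu>c v) \<le> M * K * hb * norm y"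
    proof -
      have "norm (w z * a - \<nu>c v) = norm (\<nu>c (\<Delta> y))" unfolding nv by simp
      also have "\<dots> \<le> norm (\<Delta> y) * M" by (rule M)
      also have "\<dots> \<le> (K * hb * norm y) * M" using M by (intro mult_right_mono n\<Delta>) auto
      finally show ?thesis by (simp add: mult_ac)
    qed
    have wz: "norm (w z) \<ge> c1 * hb" using w_ge[of z] z \<delta>' by (simp add: hb_def h_def)
    have wz0: "norm (w z) > 0" using wz c1 hb0 by (smt (verit) mult_pos_pos)
    have "c1 * hb * norm a \<le> norm (w z) * norm a" using wz by (intro mult_right_mono) auto
    also have "\<dots> \<le> norm (\<nu>c v) + norm (w z * a - \<nu>c v)"
      unfolding norm_mult[symmetric] using norm_triangle_sub[of "w z * a" "\<nu>c v"] by simp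
    also have "\<dots> \<le> norm v * M + M * K * hb * norm y" by (intro add_mono M key)
    also have "M * K * hb * norm y \<le> M * K * hb * (2 * d * norm v + 4 * d * q * K * (hb * norm a))"
      using M K hb0 by (intro mult_left_mono ny) auto
    also have "M * K * hb * (2 * d * norm v + 4 * d * q * K * (hb * norm a))
        = M * K * (2 * d) * (hb * norm v) + (4 * M * d * q * K * K * hb) * (hb * norm a)"
      by (simp add: algebra_simps)
    also have "(4 * M * d * q * K * K * hb) * (hb * norm a) \<le> (c1 / 2) * (hb * norm a)"
      using hb0 by (intro mult_right_mono hb3) auto
    also have "M * K * (2 * d) * (hb * norm v) \<le> M * K * (2 * d) * (1 * norm v)"
      using M K dq hb2 by (intro mult_left_mono mult_right_mono) auto
    finally have "c1 / 2 * (hb * norm a) \<le> M' * norm v"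
      using M K dq hb0 by (simp add: M'_def algebra_simps)
    then have ha: "hb * norm a \<le> X * norm v" using c1 by (simp add: X_def field_simps)
    have ny2: "norm y \<le> Yc * norm v"
    proof -
      have "4 * d * q * K * (hb * norm a) \<le> 4 * d * q * K * (X * norm v)"
        using dq K by (intro mult_left_mono ha) auto
      then show ?thesis using ny by (simp add: Yc_def algebra_simps)
    qed
    have na: "norm (a - \<nu>c v / w z) \<le> M * K * Yc / c1 * norm v"
    proof -
      have "a - \<nu>c v / w z = (w z * a - \<nu>c v) / w z" using wz0 by (simp add: field_simps)
      then have "norm (a - \<nu>c v / w z) = norm (w z * a - \<nu>c v) / norm (w z)" by (simp only: norm_divide)
      also have "\<dots> \<le> (M * K * hb * (Yc * norm v)) / (c1 * hb)"
        using key ny2 M K hb0 c1 wz pos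
        by (intro frac_le order_trans[OF key] mult_left_mono ny2) auto
      also have "\<dots> = M * K * Yc / c1 * norm v" using hb0 by simp
      finally show ?thesis .
    qed
    have "T_gen z v - cscale (1 / w z) (complexify P v) = y + cscale (a - \<nu>c v / w z) (unit, 0)"
    proof -
      have "cscale (1 / w z) (complexify P v) = cscale (\<nu>c v / w z) (unit, 0)"
        unfolding complexify_P blinfun_apply_blinfun_compose[symmetric] cscale_mult[symmetric] by simp
      then show ?thesis unfolding x_def[symmetric] y_def Px cscale_diff blinfun.diff_left
        by (simp only: algebra_simps)
    qed
    then have "norm (T_gen z v - cscale (1 / w z) (complexify P v)) \<le> norm y + norm (cscale (a - \<nu>c v / w z) (unit, 0 :: 'b))"
      by (metis norm_triangle_ineq)
    also have "\<dots> \<le> Yc * norm v + 2 * norm (a - \<nu>c v / w z) * q"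
      unfolding q_def by (intro add_mono ny2 norm_cscale_apply_le)
    also have "\<dots> \<le> Yc * norm v + 2 * (M * K * Yc / c1 * norm v) * q"
      using dq by (intro add_left_mono mult_right_mono mult_left_mono na) auto
    finally show ?thesis by (simp add: algebra_simps)
  qed
  show thesis
  proof (rule that[OF \<delta>'])
    show C: "Yc + 2 * (M * K * Yc / c1) * q \<ge> 0" using pos M K c1 dq by auto
    show "norm (T_gen z - (cscale (1 / w z) o\<^sub>L complexify P)) \<le> Yc + 2 * (M * K * Yc / c1) * q"
      if "norm z < 1" "norm (1 - z) < \<delta>'" for z
      by (rule norm_blinfun_bound[OF C]) (use main[OF that] in \<open>simp only: blinfun.diff_left blinfun_apply_blinfun_compose\<close>)
  qed
qed

text \<open>\<open>b0\<close> is the coefficient of \<open>(1 - z) powr \<beta>\<close> in \<open>1 - r(z)\<close>, and \<open>b0 * \<theta>\<close> that of \<open>1 - z\<close>.\<close>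

definition b0 :: real where "b0 = c * Gamma (1 - \<beta>)"
definition \<theta> :: real where "\<theta> = suminf (tail_defect t c \<beta>) / Gamma (1 - \<beta>)"
text \<open>Enough terms for the remainder of the expansion to be bounded.\<close>

definition n_sing :: nat where "n_sing = nat \<lceil>\<beta> / (1 - \<beta>)\<rceil>"
definition sing_gen :: "complex \<Rightarrow> complex" where "sing_gen = singular_part b0 \<theta> \<beta> n_sing"
text \<open>What remains of the renewal resolvent after its explicit singular part at \<open>1\<close> is removed.\<close>

definition T_reg :: "complex \<Rightarrow> ('b \<times> 'b) \<Rightarrow>\<^sub>L ('b \<times> 'b)" where
  "T_reg z = T_gen z - (cscale (sing_gen z) o\<^sub>L complexify P)"

lemma norm_cscale_compose_le: "norm (cscale z o\<^sub>L A) \<le> 2 * norm z * norm A"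
  by (rule order_trans[OF norm_blinfun_compose]) (intro mult_right_mono norm_cscale_le norm_ge_zero)

lemma T_reg_bounded: obtains C where "C \<ge> 0" "\<And>z. norm z < 1 \<Longrightarrow> norm (T_reg z) \<le> C"
proof -
  have G: "Gamma (1 - \<beta>) > 0" using \<beta> by (intro Gamma_real_pos) auto
  have b0: "b0 > 0" using G c by (simp add: b0_def)
  have n_sing: "(real n_sing + 1) * (1 - \<beta>) \<ge> \<beta>"
  proof -
    have "\<beta> / (1 - \<beta>) \<le> real n_sing" unfolding n_sing_def using \<beta> by linarith
    then have "\<beta> \<le> real n_sing * (1 - \<beta>)" using \<beta> by (simp add: field_simps)
    then show ?thesis using \<beta> by (simp add: algebra_simps)
  qed
  obtain K where K: "K \<ge> 0" "\<And>z. norm z < 1 \<Longrightarrow>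
    norm (1 - r z - of_real c * (of_real (Gamma (1 - \<beta>)) * (1 - z) powr of_real \<beta>
            + of_real (suminf (tail_defect t c \<beta>)) * (1 - z)))
      \<le> K * norm (1 - z) powr (2 * \<beta>)"
    by (rule one_minus_gf_expansion[OF \<beta> c tail t_0 H r_sums[OF less_imp_le]]) blast+
  have K': "norm (1 - r z - of_real b0 * ((1 - z) powr of_real \<beta> + of_real \<theta> * (1 - z)))
      \<le> K * norm (1 - z) powr (2 * \<beta>)" if "norm z < 1" for z
  proof -
    have "of_real b0 * ((1 - z) powr of_real \<beta> + of_real \<theta> * (1 - z)) =
      of_real c * (of_real (Gamma (1 - \<beta>)) * (1 - z) powr of_real \<beta> + of_real (suminf (tail_defect t c \<beta>)) * (1 - z))"
      using G by (simp add: b0_def \<theta>_def field_simps)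
    then show ?thesis using K(2)[OF that] by simp
  qed
  obtain \<delta> c1 C1 where 1: "\<delta> > 0" "c1 > 0" "C1 \<ge> 0"
    "\<And>z. norm z < 1 \<Longrightarrow> norm (1 - z) < \<delta> \<Longrightarrow> norm (1 - r z) \<ge> c1 * norm (1 - z) powr \<beta>"
    "\<And>z. norm z < 1 \<Longrightarrow> norm (1 - z) < \<delta> \<Longrightarrow> norm (1 / (1 - r z) - sing_gen z) \<le> C1"
    unfolding sing_gen_def 
  proof (rule reciprocal_expansion[OF \<beta> b0 n_sing K' K(1)])
    fix \<delta> c1 C1 :: real
    assume "\<delta> > 0" "c1 > 0" "C1 \<ge> 0"
      and "\<And>z. norm z < 1 \<Longrightarrow> norm (1 - z) < \<delta> \<Longrightarrow> norm (1 - r z) \<ge> c1 * norm (1 - z) powr \<beta>"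
      and "\<And>z. norm z < 1 \<Longrightarrow> norm (1 - z) < \<delta> \<Longrightarrow> norm (1 / (1 - r z) - singular_part b0 \<theta> \<beta> n_sing z) \<le> C1"
    then show thesis by (rule that[unfolded sing_gen_def])
  qed
  obtain \<delta>' C where 2: "\<delta>' > 0" "\<delta>' \<le> \<delta>" "C \<ge> 0"
    "\<And>z. norm z < 1 \<Longrightarrow> norm (1 - z) < \<delta>' \<Longrightarrow> norm (T_gen z - (cscale (1 / (1 - r z)) o\<^sub>L complexify P)) \<le> C"
  proof (rule T_gen_near_1[OF 1(1,2,4)])
    fix \<delta>' C :: real
    assume "\<delta>' > 0" "\<delta>' \<le> \<delta>" "C \<ge> 0"
      and "\<And>z. norm z < 1 \<Longrightarrow> norm (1 - z) < \<delta>' \<Longrightarrow> norm (T_gen z - (cscale (1 / (1 - r z)) o\<^sub>L complexify P)) \<le> C"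
    then show thesis by (rule that)
  qed
  \<comment> \<open>Away from \<open>1\<close> the resolvent is continuous up to the boundary of the disc, by (H2).\<close>
  let ?A = "cball (0::complex) 1 - ball 1 \<delta>'"
  have "compact ?A" by (intro compact_diff compact_cball open_ball)
  moreover have "continuous_on ?A T_gen" by (rule continuous_on_subset[OF continuous_on_T_gen]) (use 2(1) in auto)
  ultimately have "bounded (T_gen ` ?A)" by (intro compact_imp_bounded compact_continuous_image)
  then obtain CT where CT: "\<And>z. z \<in> ?A \<Longrightarrow> norm (T_gen z) \<le> CT" unfolding bounded_iff by blast
  obtain CE where CE: "CE \<ge> 0" "\<And>z. norm z < 1 \<Longrightarrow> norm (sing_gen z) \<le> CE * norm (1 - z) powr - \<beta>"
    unfolding sing_gen_def by (rule singular_part_bound[of \<beta> b0 \<theta> n_sing]) (use \<beta> in auto)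
  define p where "p = norm (complexify P)"
  have p: "p \<ge> 0" by (simp add: p_def)
  define B where "B = max (C + 2 * C1 * p) (CT + 2 * (CE * \<delta>' powr - \<beta>) * p)"
  have "norm (T_reg z) \<le> B" if z: "norm z < 1" for z
  proof (cases "norm (1 - z) < \<delta>'")
    case True
    have "T_reg z = (T_gen z - (cscale (1 / (1 - r z)) o\<^sub>L complexify P)) + (cscale (1 / (1 - r z) - sing_gen z) o\<^sub>L complexify P)"
      unfolding T_reg_def cscale_diff compose_simps by simp
    also have "norm \<dots> \<le> C + 2 * C1 * p"
    proof (rule norm_triangle_le, rule add_mono)
      show "norm (cscale (1 / (1 - r z) - sing_gen z) o\<^sub>L complexify P) \<le> 2 * C1 * p"
        using 1(5)[OF z] 2(2) True p unfolding p_def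
        by (intro order_trans[OF norm_cscale_compose_le] mult_right_mono mult_left_mono) auto
    qed (rule 2(4)[OF z True])
    finally show ?thesis by (simp add: B_def)
  next
    case False
    have "norm (T_reg z) \<le> norm (T_gen z) + norm (cscale (sing_gen z) o\<^sub>L complexify P)"
      unfolding T_reg_def by (rule norm_triangle_ineq4)
    also have "\<dots> \<le> CT + 2 * (CE * \<delta>' powr - \<beta>) * p"
    proof (rule add_mono)
      show "norm (T_gen z) \<le> CT" by (rule CT) (use z False in \<open>auto simp: dist_norm\<close>)
      have "norm (sing_gen z) \<le> CE * norm (1 - z) powr - \<beta>" by (rule CE(2)[OF z])
      also have "\<dots> \<le> CE * \<delta>' powr - \<beta>"
        using False 2(1) \<beta> CE(1) by (intro mult_left_mono powr_mono2') auto
      finally show "norm (cscale (sing_gen z) o\<^sub>L complexify P) \<le> 2 * (CE * \<delta>' powr - \<beta>) * p"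
        unfolding p_def by (intro order_trans[OF norm_cscale_compose_le] mult_right_mono mult_left_mono) auto
    qed
    finally show ?thesis by (simp add: B_def)
  qed
  moreover have "B \<ge> 0" using 2(3) 1(3) p by (simp add: B_def le_max_iff_disj)
  ultimately show thesis using that by blast
qed

lemma one_minus_bounds: "norm (z::complex) < 1 \<Longrightarrow> 0 < norm (1 - z) \<and> norm (1 - z) \<le> 2"
  using norm_triangle_ineq4[of 1 z] by auto

lemma T_gen_bound: obtains C where "C \<ge> 0" "\<And>z. norm z < 1 \<Longrightarrow> norm (T_gen z) \<le> C * norm (1 - z) powr - \<beta>"
proof -
  obtain B where B: "B \<ge> 0" "\<And>z. norm z < 1 \<Longrightarrow> norm (T_reg z) \<le> B" by (rule T_reg_bounded) blast
  obtain CE where CE: "CE \<ge> 0" "\<And>z. norm z < 1 \<Longrightarrow> norm (sing_gen z) \<le> CE * norm (1 - z) powr - \<beta>"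
    unfolding sing_gen_def by (rule singular_part_bound[of \<beta> b0 \<theta> n_sing]) (use \<beta> in auto)
  define p where "p = norm (complexify P)"
  have p: "p \<ge> 0" by (simp add: p_def)
  show thesis
  proof (rule that[of "B * 2 powr \<beta> + 2 * CE * p"])
    show "B * 2 powr \<beta> + 2 * CE * p \<ge> 0" using B CE p by auto
    fix z :: complex assume z: "norm z < 1"
    define h where "h = norm (1 - z)"
    have h: "0 < h" "h \<le> 2" using one_minus_bounds[OF z] by (auto simp: h_def)
    have "T_gen z = T_reg z + (cscale (sing_gen z) o\<^sub>L complexify P)" by (simp add: T_reg_def)
    also have "norm \<dots> \<le> B * (2 powr \<beta> * h powr - \<beta>) + 2 * (CE * h powr - \<beta>) * p"
    proof (rule norm_triangle_le, rule add_mono)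
      have "2 powr - \<beta> \<le> h powr - \<beta>" using h \<beta> by (intro powr_mono2') auto
      then have "1 \<le> 2 powr \<beta> * h powr - \<beta>" by (simp add: powr_minus field_simps)
      then have "B * 1 \<le> B * (2 powr \<beta> * h powr - \<beta>)" by (intro mult_left_mono B)
      then show "norm (T_reg z) \<le> B * (2 powr \<beta> * h powr - \<beta>)" using B(2)[OF z] by simp
      show "norm (cscale (sing_gen z) o\<^sub>L complexify P) \<le> 2 * (CE * h powr - \<beta>) * p"
        unfolding p_def h_def using CE(2)[OF z]
        by (intro order_trans[OF norm_cscale_compose_le] mult_right_mono mult_left_mono) auto
    qed
    finally show "norm (T_gen z) \<le> (B * 2 powr \<beta> + 2 * CE * p) * norm (1 - z) powr - \<beta>"
      by (simp add: h_def algebra_simps)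
  qed
qed

text \<open>For the resolvent itself this is \<open>T(z') - T(z) = T(z') (R(z') - R(z)) T(z)\<close> with
\<open>T(z) = O(|1 - z| powr - \<beta>)\<close>; the singular part satisfies the same bound.\<close>

lemma T_reg_holder:
  obtains C where "C \<ge> 0"
    "\<And>z z'. norm z < 1 \<Longrightarrow> norm z' < 1 \<Longrightarrow> norm (z - z') \<le> norm (1 - z) / 2 \<Longrightarrow>
      norm (T_reg z' - T_reg z) \<le> C * norm (z - z') powr \<beta> * norm (1 - z) powr (- 2 * \<beta>)"
proof -
  obtain CT where CT: "CT \<ge> 0" "\<And>z. norm z < 1 \<Longrightarrow> norm (T_gen z) \<le> CT * norm (1 - z) powr - \<beta>" by (rule T_gen_bound) blast
  obtain K where K: "K \<ge> 0"
    "\<And>z z'. norm z \<le> 1 \<Longrightarrow> norm z' \<le> 1 \<Longrightarrow> norm (R_gen Rn z - R_gen Rn z') \<le> K * norm (z - z') powr \<beta>"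
    by (rule R_holder) blast
  obtain CE where CE: "CE \<ge> 0"
    "\<And>z z'. norm z < 1 \<Longrightarrow> norm z' < 1 \<Longrightarrow> norm (z - z') \<le> norm (1 - z) / 2 \<Longrightarrow>
      norm (sing_gen z' - sing_gen z) \<le> CE * norm (z - z') powr \<beta> * norm (1 - z) powr (- 2 * \<beta>)"
    unfolding sing_gen_def by (rule singular_part_lipschitz[of \<beta> b0 \<theta> n_sing]) (use \<beta> in auto)
  define p where "p = norm (complexify P)"
  have p: "p \<ge> 0" by (simp add: p_def)
  define C where "C = CT * CT * K * 2 powr \<beta> + 2 * CE * p"
  show thesis
  proof (rule that[of C])
    show "C \<ge> 0" using CT K CE p by (simp add: C_def)
    fix z z' :: complex assume z: "norm z < 1" "norm z' < 1" "norm (z - z') \<le> norm (1 - z) / 2"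
    define h where "h = norm (1 - z)"
    define k where "k = norm (z - z') powr \<beta>"
    have h: "0 < h" using one_minus_bounds[OF z(1)] by (simp add: h_def)
    have h': "norm (1 - z') \<ge> h / 2"
      using norm_triangle_ineq2[of "1 - z" "z' - z"] z(3) by (simp add: h_def norm_minus_commute)
    have T': "norm (T_gen z') \<le> CT * (2 powr \<beta> * h powr - \<beta>)"
    proof -
      have "norm (1 - z') powr - \<beta> \<le> (h / 2) powr - \<beta>" using h h' \<beta> by (intro powr_mono2') auto
      also have "\<dots> = 2 powr \<beta> * h powr - \<beta>" using h by (simp add: powr_divide powr_minus field_simps)
      finally have "CT * norm (1 - z') powr - \<beta> \<le> CT * (2 powr \<beta> * h powr - \<beta>)" by (intro mult_left_mono CT)
      then show ?thesis using CT(2)[OF z(2)] by linarith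
    qed
    have z1: "norm z \<le> 1" "z \<noteq> 1" "norm z' \<le> 1" "z' \<noteq> 1" using z by auto
    have "T_gen z' - T_gen z = T_gen z' o\<^sub>L ((id_blinfun - R_gen Rn z) - (id_blinfun - R_gen Rn z')) o\<^sub>L T_gen z"
      by (rule inverse_op_diff[OF T_gen[OF z1(1,2)] T_gen[OF z1(3,4)]])
    then have "norm (T_gen z' - T_gen z) \<le> norm (T_gen z') * norm (R_gen Rn z' - R_gen Rn z) * norm (T_gen z)"
      using norm_compose3_le[of "T_gen z'" "R_gen Rn z' - R_gen Rn z" "T_gen z"] by simp
    also have "\<dots> \<le> (CT * (2 powr \<beta> * h powr - \<beta>)) * (K * k) * (CT * h powr - \<beta>)"
      using K(2)[OF z1(3,1)] CT K CT(2)[OF z(1)] T'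
      by (intro mult_mono) (auto simp: k_def h_def norm_minus_commute)
    also have "\<dots> = CT * CT * K * 2 powr \<beta> * k * (h powr - \<beta> * h powr - \<beta>)" by (simp add: mult_ac)
    also have "h powr - \<beta> * h powr - \<beta> = h powr (- 2 * \<beta>)" by (simp add: powr_add[symmetric])
    finally have 1: "norm (T_gen z' - T_gen z) \<le> CT * CT * K * 2 powr \<beta> * k * h powr (- 2 * \<beta>)" .
    have 2: "norm (cscale (sing_gen z' - sing_gen z) o\<^sub>L complexify P) \<le> 2 * (CE * k * h powr (- 2 * \<beta>)) * p"
      unfolding p_def k_def h_def using CE(2)[OF z]
      by (intro order_trans[OF norm_cscale_compose_le] mult_right_mono mult_left_mono) auto
    have "T_reg z' - T_reg z = (T_gen z' - T_gen z) - (cscale (sing_gen z' - sing_gen z) o\<^sub>L complexify P)"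
      unfolding T_reg_def cscale_diff compose_simps by simp
    then have "norm (T_reg z' - T_reg z) \<le> norm (T_gen z' - T_gen z) + norm (cscale (sing_gen z' - sing_gen z) o\<^sub>L complexify P)"
      by (metis norm_triangle_ineq4)
    also have "\<dots> \<le> C * k * h powr (- 2 * \<beta>)"
      using 1 2 by (simp add: C_def algebra_simps)
    finally show "norm (T_reg z' - T_reg z) \<le> C * norm (z - z') powr \<beta> * norm (1 - z) powr (- 2 * \<beta>)"
      by (simp add: k_def h_def)
  qed
qed

end

section \<open>Renewal operators as Fourier coefficients\<close>

context renewal_operators
begin

text \<open>Let \<open>q = T(z) p\<close>, so \<open>p = q - R(z) q\<close>. The renewal equation says that
\<open>\<Sum>n. z ^ n \<alpha>\<^sub>n(R(z) q)\<close>, summed along the diagonals of the double series, equals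
\<open>\<Sum>n\<ge>1. z ^ n \<alpha>\<^sub>n(q)\<close>. Subtracting leaves \<open>\<alpha>\<^sub>0(q)\<close>. No convergence of a series of operators is
involved.\<close>

lemma functional_generating_function:
  fixes \<alpha> :: "nat \<Rightarrow> 'b \<times> 'b \<Rightarrow> complex"
  assumes lin: "\<And>n. bounded_linear (\<alpha> n)" and A: "\<And>n p. norm (\<alpha> n p) \<le> A * norm p"
    and hom: "\<And>n z p. \<alpha> n (cscale z p) = z * \<alpha> n p"
    and renewal: "\<And>n p. n \<ge> 1 \<Longrightarrow> \<alpha> n p = (\<Sum>j<n. \<alpha> (n - Suc j) (complexify (Rn (Suc j)) p))"
    and z: "norm z < 1"
  shows "(\<lambda>n. \<alpha> n p * z ^ n) sums \<alpha> 0 (T_gen z p)"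
proof -
  define q where "q = T_gen z p"
  have z1: "norm z \<le> 1" "z \<noteq> 1" using z by auto
  have p: "p = q - R_gen Rn z q"
    using inverse_op_right[OF T_gen[OF z1], of p] by (simp add: q_def blinfun.diff_left)
  define Rc where "Rc j = complexify (Rn (Suc j)) q" for j
  define f where "f nj = z ^ fst nj * (z ^ Suc (snd nj) * \<alpha> (fst nj) (Rc (snd nj)))" for nj :: "nat \<times> nat"
  define m where "m j = t j - t (Suc j)" for j
  have A0: "A \<ge> 0 \<or> (\<forall>p::'b\<times>'b. norm p = 0)" using A[of 0] by (metis linorder_not_le mult_less_0_iff norm_ge_zero order_trans order_le_less)
  have m0: "m j \<ge> 0" for j using t_mono[of j] by (simp add: m_def)
  have nRc: "norm (Rc j) \<le> C0 * m j * norm q" for j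
    unfolding Rc_def m_def
    by (rule order_trans[OF norm_blinfun mult_right_mono[OF order_trans[OF norm_complexify_le norm_R]]]) simp
  have n\<alpha>: "norm (\<alpha> n (Rc j)) \<le> \<bar>A\<bar> * (C0 * m j * norm q)" for n j
    by (rule order_trans[OF A order_trans[OF mult_right_mono[of A "\<bar>A\<bar>"] mult_left_mono[OF nRc]]]) auto
  define B where "B = \<bar>A\<bar> * C0 * norm q"
  have B0: "B \<ge> 0" using C0 by (simp add: B_def)
  have nf: "norm (f (n, j)) \<le> norm (norm z ^ n * (B * m j))" for n j
  proof -
    have "norm (z ^ Suc j) \<le> 1" using z1 by (simp add: norm_power power_le_one del: power_Suc)
    then have "norm (z ^ Suc j * \<alpha> n (Rc j)) \<le> 1 * (\<bar>A\<bar> * (C0 * m j * norm q))"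
      unfolding norm_mult using n\<alpha> by (intro mult_mono) auto
    then have "norm (f (n, j)) \<le> norm z ^ n * (\<bar>A\<bar> * (C0 * m j * norm q))"
      by (simp add: f_def norm_mult norm_power mult_left_mono)
    also have "\<dots> = norm (norm z ^ n * (B * m j))" using B0 m0[of j] by (simp add: B_def mult_ac abs_mult C0)
    finally show ?thesis .
  qed
  have ms: "(\<lambda>j. B * m j) sums B"
    using sums_mult[OF tail_increment_sums[of 0], of B] by (simp add: m_def t_0)
  have "((\<lambda>nj. norm z ^ fst nj * (B * m (snd nj))) summable_on (UNIV \<times> UNIV))"
  proof (rule summable_on_SigmaI)
    show "((\<lambda>j. norm z ^ fst (n, j) * (B * m (snd (n, j)))) has_sum (norm z ^ n * B)) UNIV" for n :: nat
    proof (rule norm_summable_imp_has_sum)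
      show "(\<lambda>j. norm z ^ fst (n, j) * (B * m (snd (n, j)))) sums (norm z ^ n * B)"
        unfolding fst_conv snd_conv by (intro sums_mult ms)
      then show "summable (\<lambda>j. norm (norm z ^ fst (n, j) * (B * m (snd (n, j)))))"
        using m0 B0 by (simp add: abs_mult sums_iff)
    qed
    show "(\<lambda>n. norm z ^ n * B) summable_on UNIV"
      using z B0 by (subst summable_on_UNIV_nonneg_real_iff) (auto intro!: summable_mult2 summable_geometric)
  qed (use m0 B0 in auto)
  then have "(\<lambda>nj. norm (f nj)) summable_on (UNIV \<times> UNIV)"
    by (rule summable_on_comparison_test) (use nf m0 B0 in \<open>auto simp: abs_mult\<close>)
  then have "f summable_on (UNIV \<times> UNIV)" by (rule abs_summable_summable)
  then obtain X where X: "(f has_sum X) (UNIV \<times> UNIV)" by (auto simp: summable_on_def)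
  have rows: "((\<lambda>j. f (n, j)) has_sum (z ^ n * \<alpha> n (R_gen Rn z q))) UNIV" for n
  proof (rule norm_summable_imp_has_sum)
    show "summable (\<lambda>j. norm (f (n, j)))"
    proof (rule summable_comparison_test')
      show "summable (\<lambda>j. norm z ^ n * (B * m j))"
        using tail_increment_sums[of 0] by (intro summable_mult) (auto simp: m_def sums_iff)
      show "norm (norm (f (n, j))) \<le> norm z ^ n * (B * m j)" for j
        using nf[of n j] m0 B0 by (simp add: abs_mult)
    qed
    have "(\<lambda>j. z ^ n * \<alpha> n (cscale (z ^ Suc j) (Rc j))) sums (z ^ n * \<alpha> n (R_gen Rn z q))"
      unfolding Rc_def by (intro sums_mult bounded_linear.sums[OF lin] R_sums_apply[OF z1(1)])
    then show "(\<lambda>j. f (n, j)) sums (z ^ n * \<alpha> n (R_gen Rn z q))" by (simp only: hom f_def fst_conv snd_conv)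
  qed
  have s1: "(\<lambda>n. z ^ n * \<alpha> n (R_gen Rn z q)) sums X"
    using has_sum_SigmaD[OF X rows] by (rule has_sum_imp_sums)
  define h where "h N = (if N = 0 then 0 else z ^ N * \<alpha> N q)" for N
  \<comment> \<open>Reindex by \<open>N = n + j + 1\<close>, the exponent of \<open>z\<close>.\<close>
  have diag: "((\<lambda>(N, j). f (N - Suc j, j)) has_sum X) (Sigma UNIV (\<lambda>N. {..<N}))"
    by (rule iffD1[OF has_sum_reindex_bij_witness[of "UNIV \<times> UNIV" "\<lambda>(N, j). (N - Suc j, j)" "\<lambda>(n, j). (n + Suc j, j)"] X])
       auto
  have "(h has_sum X) UNIV"
  proof (rule has_sum_SigmaD[OF diag])
    fix N :: nat
    have "(\<Sum>j<N. f (N - Suc j, j)) = h N"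
    proof (cases "N = 0")
      case False
      then have N: "N \<ge> 1" by simp
      have "(\<Sum>j<N. f (N - Suc j, j)) = (\<Sum>j<N. z ^ N * \<alpha> (N - Suc j) (Rc j))"
      proof (rule sum.cong)
        fix j assume "j \<in> {..<N}"
        then have "z ^ (N - Suc j) * z ^ Suc j = z ^ N"
          unfolding power_add[symmetric] by simp
        then show "f (N - Suc j, j) = z ^ N * \<alpha> (N - Suc j) (Rc j)"
          unfolding f_def fst_conv snd_conv mult.assoc[symmetric] by (rule arg_cong)
      qed simp
      also have "\<dots> = z ^ N * (\<Sum>j<N. \<alpha> (N - Suc j) (Rc j))" by (simp add: sum_distrib_left)
      also have "\<dots> = h N" unfolding Rc_def renewal[OF N, symmetric] using N by (simp add: h_def)
      finally show ?thesis .
    qed (simp add: h_def)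
    then show "((\<lambda>j. case (N, j) of (N, j) \<Rightarrow> f (N - Suc j, j)) has_sum h N) {..<N}"
      by (metis (no_types, lifting) case_prod_conv finite_lessThan has_sum_cong has_sum_finite)
  qed
  then have "h sums X" by (rule has_sum_imp_sums)
  then have "(\<lambda>N. h N + (if N = 0 then \<alpha> 0 q else 0)) sums (X + \<alpha> 0 q)"
    by (intro sums_add sums_single[of 0 "\<lambda>_. \<alpha> 0 q"])
  moreover have "h N + (if N = 0 then \<alpha> 0 q else 0) = z ^ N * \<alpha> N q" for N by (simp add: h_def)
  ultimately have "(\<lambda>N. z ^ N * \<alpha> N q) sums (X + \<alpha> 0 q)" by simp
  from sums_diff[OF this s1]
  have "(\<lambda>N. z ^ N * \<alpha> N q - z ^ N * \<alpha> N (R_gen Rn z q)) sums \<alpha> 0 q" by simp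
  moreover have "z ^ N * \<alpha> N q - z ^ N * \<alpha> N (R_gen Rn z q) = \<alpha> N p * z ^ N" for N
  proof -
    have "\<alpha> N p = \<alpha> N q - \<alpha> N (R_gen Rn z q)"
      unfolding p using linear_diff[OF bounded_linear.linear[OF lin]] .
    then show ?thesis by (simp only: right_diff_distrib mult.commute)
  qed
  ultimately show ?thesis unfolding q_def by simp
qed

text \<open>The radius tends to \<open>1\<close> fast enough for \<open>radius n ^ n\<close> to stay bounded away from \<open>0\<close>, while
\<open>radius n < 1\<close> keeps all integrands continuous.\<close>

definition radius :: "nat \<Rightarrow> real" where "radius n = 1 - 1 / (real n + 2)"

lemma radius: "1/2 \<le> radius n" "radius n < 1" "0 < radius n"
  by (auto simp: radius_def field_simps)

lemma radius_power: "inverse (radius n ^ n) \<le> 3"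
proof -
  have "inverse (radius n) = 1 + 1 / (real n + 1)" by (simp add: radius_def field_simps)
  also have "\<dots> \<le> exp (1 / (real n + 1))" by (rule exp_ge_add_one_self)
  finally have "inverse (radius n) ^ n \<le> exp (1 / (real n + 1)) ^ n"
    using radius(3)[of n] by (intro power_mono) auto
  also have "\<dots> = exp (real n * (1 / (real n + 1)))" by (simp only: exp_of_nat_mult)
  also have "\<dots> \<le> exp 1" by (simp add: field_simps)
  also have "\<dots> \<le> 3" using exp_le by simp
  finally show ?thesis by (simp add: power_inverse)
qed

definition circle :: "nat \<Rightarrow> real \<Rightarrow> complex" where "circle n x = of_real (radius n) * cis x"

lemma norm_circle: "norm (circle n x) = radius n"
  using radius(3)[of n] by (simp add: circle_def norm_mult)

lemma circle_in_disc: "norm (circle n x) < 1" "norm (circle n x) \<le> 1" "circle n x \<noteq> 1"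
  using radius(2)[of n] norm_circle[of n x] by auto

lemma continuous_circle: "continuous_on S (circle n)"
  unfolding circle_def by (intro continuous_intros)

lemma continuous_T_gen_circle: "continuous_on S (\<lambda>x. T_gen (circle n x))"
  by (rule continuous_on_compose2[OF continuous_on_T_gen continuous_circle]) (use circle_in_disc in auto)

text \<open>The \<open>n\<close>-th power series coefficient of \<open>T(z)\<close> by Cauchy's formula on the circle of radius \<open>radius n\<close>.\<close>

definition Q_op :: "nat \<Rightarrow> ('b \<times> 'b) \<Rightarrow>\<^sub>L ('b \<times> 'b)" where
  "Q_op n = (1 / (2 * pi * radius n ^ n)) *\<^sub>R
     integral {-pi..pi} (\<lambda>x. cscale (cis (- real n * x)) o\<^sub>L T_gen (circle n x))"

definition T_op :: "nat \<Rightarrow> 'b \<Rightarrow>\<^sub>L 'b" where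
  "T_op n = fst_blinfun o\<^sub>L Q_op n o\<^sub>L Blinfun (\<lambda>v. (v, 0))"

lemma apply_pair_0: "blinfun_apply (Blinfun (\<lambda>v::'b. (v, 0 :: 'b))) v = (v, 0)"
  by (subst bounded_linear_Blinfun_apply) (auto intro!: bounded_linear_Pair bounded_linear_ident bounded_linear_zero)

lemma T_op_apply: "T_op n v = fst (Q_op n (v, 0))"
  by (simp add: T_op_def apply_pair_0)

lemma T_gen_circle_integrable: "(\<lambda>x. cscale (cis (- real n * x)) o\<^sub>L T_gen (circle n x)) integrable_on {-pi..pi}"
  by (intro integrable_continuous_real continuous_intros continuous_T_gen_circle)

lemma Q_op_functional:
  fixes \<alpha> :: "nat \<Rightarrow> 'b \<times> 'b \<Rightarrow> complex"
  assumes lin: "\<And>n. bounded_linear (\<alpha> n)" and A: "\<And>n p. norm (\<alpha> n p) \<le> A * norm p"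
    and hom: "\<And>n z p. \<alpha> n (cscale z p) = z * \<alpha> n p"
    and renewal: "\<And>n p. n \<ge> 1 \<Longrightarrow> \<alpha> n p = (\<Sum>j<n. \<alpha> (n - Suc j) (complexify (Rn (Suc j)) p))"
  shows "\<alpha> 0 (Q_op n p) = \<alpha> n p"
proof -
  have sm: "summable (\<lambda>m. norm (\<alpha> m p) * radius n ^ m)"
  proof (rule summable_comparison_test')
    show "summable (\<lambda>m. A * norm p * radius n ^ m)"
      using radius[of n] by (intro summable_mult summable_geometric) auto
    show "norm (norm (\<alpha> m p) * radius n ^ m) \<le> A * norm p * radius n ^ m" for m
      using radius(3)[of n] A[of m p] by (simp add: abs_mult mult_right_mono)
  qed
  have gf: "(\<Sum>m. \<alpha> m p * (of_real (radius n) * cis x) ^ m) = \<alpha> 0 (T_gen (circle n x) p)" for x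
    using functional_generating_function[OF lin A hom renewal circle_in_disc(1)[of n x], of p]
    by (simp add: sums_iff circle_def)
  have "((\<lambda>x. cis (- real n * x) * \<alpha> 0 (T_gen (circle n x) p)) has_integral 2 * of_real pi * \<alpha> n p * of_real (radius n ^ n)) {-pi..pi}"
    using power_series_fourier_coefficient[OF sm, of n] radius(3)[of n] unfolding gf by simp
  then have I: "integral {-pi..pi} (\<lambda>x. \<alpha> 0 ((cscale (cis (- real n * x)) o\<^sub>L T_gen (circle n x)) p)) = 2 * of_real pi * \<alpha> n p * of_real (radius n ^ n)"
    by (simp only: blinfun_apply_blinfun_compose hom integral_unique)
  have bl: "bounded_linear (\<lambda>X. \<alpha> 0 (blinfun_apply X p))"
    by (rule bounded_linear_compose[OF lin blinfun.bounded_linear_left])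
  have "\<alpha> 0 (Q_op n p) = (1 / (2 * pi * radius n ^ n)) *\<^sub>R \<alpha> 0 (integral {-pi..pi} (\<lambda>x. cscale (cis (- real n * x)) o\<^sub>L T_gen (circle n x)) p)"
    unfolding Q_op_def blinfun.scaleR_left using linear_scale[OF bounded_linear.linear[OF lin]] .
  also have "\<alpha> 0 (integral {-pi..pi} (\<lambda>x. cscale (cis (- real n * x)) o\<^sub>L T_gen (circle n x)) p)
     = 2 * of_real pi * \<alpha> n p * of_real (radius n ^ n)"
    using integral_linear[OF T_gen_circle_integrable bl, of n] unfolding o_def I by simp
  also have "(1 / (2 * pi * radius n ^ n)) *\<^sub>R (2 * of_real pi * \<alpha> n p * of_real (radius n ^ n)) = \<alpha> n p"
    using radius(3)[of n] by (simp add: scaleR_conv_of_real)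
  finally show ?thesis .
qed

text \<open>Only the real part of the complexified statement is kept; \<open>T_op\<close> restricts \<open>Q_op\<close> to real vectors
and projects back.\<close>

lemma T_op_functional:
  fixes \<alpha> :: "nat \<Rightarrow> 'b \<Rightarrow> real"
  assumes lin: "\<And>n. bounded_linear (\<alpha> n)" and A: "\<And>n v. \<bar>\<alpha> n v\<bar> \<le> A * norm v"
    and renewal: "\<And>n v. n \<ge> 1 \<Longrightarrow> \<alpha> n v = (\<Sum>j<n. \<alpha> (n - Suc j) (Rn (Suc j) v))"
  shows "\<alpha> 0 (T_op n v) = \<alpha> n v"
proof -
  define \<alpha>c where "\<alpha>c n p = of_real (\<alpha> n (fst p)) + \<i> * of_real (\<alpha> n (snd p))" for n p
  note L = linear_add[OF bounded_linear.linear[OF lin]] linear_diff[OF bounded_linear.linear[OF lin]]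
    linear_scale[OF bounded_linear.linear[OF lin]] linear_0[OF bounded_linear.linear[OF lin]]
  have "\<alpha>c 0 (Q_op n (v, 0)) = \<alpha>c n (v, 0)"
  proof (rule Q_op_functional)
    show "bounded_linear (\<alpha>c n)" for n
      unfolding \<alpha>c_def
      by (intro bounded_linear_add bounded_linear_const_mult bounded_linear_compose[OF bounded_linear_of_real]
          bounded_linear_compose[OF lin] bounded_linear_fst bounded_linear_snd)
    show "\<alpha>c n (cscale z p) = z * \<alpha>c n p" for n z p
      by (simp add: \<alpha>c_def L complex_eq_iff)
    show "norm (\<alpha>c n p) \<le> (2 * \<bar>A\<bar>) * norm p" for n p
    proof -
      have 1: "\<bar>\<alpha> n x\<bar> \<le> \<bar>A\<bar> * norm p" if "norm x \<le> norm p" for x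
        using A[of n x] that by (meson abs_ge_self abs_ge_zero mult_mono norm_ge_zero order_trans)
      have "norm (\<alpha>c n p) \<le> \<bar>\<alpha> n (fst p)\<bar> + \<bar>\<alpha> n (snd p)\<bar>"
        unfolding \<alpha>c_def by (rule order_trans[OF norm_triangle_ineq]) (simp add: norm_mult)
      also have "\<dots> \<le> \<bar>A\<bar> * norm p + \<bar>A\<bar> * norm p"
        by (intro add_mono 1) (metis norm_fst_le norm_snd_le prod.collapse)+
      finally show ?thesis by simp
    qed
    show "\<alpha>c n p = (\<Sum>j<n. \<alpha>c (n - Suc j) (complexify (Rn (Suc j)) p))" if "n \<ge> 1" for n p
      using renewal[OF that, of "fst p"] renewal[OF that, of "snd p"]
      by (simp add: \<alpha>c_def sum.distrib sum_distrib_left)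
  qed
  then have "Re (\<alpha>c 0 (Q_op n (v, 0))) = Re (\<alpha>c n (v, 0))" by (rule arg_cong)
  then show ?thesis by (simp add: \<alpha>c_def T_op_apply)
qed

text \<open>The power series coefficients of \<open>sing_gen\<close>.\<close>

definition sing_coeff :: "nat \<Rightarrow> real" where
  "sing_coeff n = (\<Sum>k\<le>n_sing. (- \<theta>) ^ k / b0 * bincoef (\<beta> - real k * (1 - \<beta>)) n)"

lemma sing_gen_sums:
  assumes "norm z < 1" shows "(\<lambda>n. of_real (sing_coeff n) * z ^ n) sums sing_gen z"
proof -
  have "(\<lambda>n. \<Sum>k\<le>n_sing. of_real ((- \<theta>) ^ k / b0) * (of_real (bincoef (\<beta> - real k * (1 - \<beta>)) n) * z ^ n)) sums sing_gen z"
    unfolding sing_gen_def singular_part_def by (intro sums_sum sums_mult bincoef_sums assms)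
  moreover have "(\<Sum>k\<le>n_sing. of_real ((- \<theta>) ^ k / b0) * (of_real (bincoef (\<beta> - real k * (1 - \<beta>)) n) * z ^ n)) = of_real (sing_coeff n) * z ^ n" for n
    unfolding sing_coeff_def of_real_sum sum_distrib_right by (intro sum.cong) (auto simp: mult_ac)
  ultimately show ?thesis by simp
qed

lemma sing_gen_fourier:
  "((\<lambda>x. cis (- real n * x) * sing_gen (circle n x)) has_integral 2 * of_real pi * of_real (sing_coeff n) * of_real (radius n ^ n)) {-pi..pi}"
proof -
  have "radius n < (1 + radius n) / 2" "(1 + radius n) / 2 < 1" using radius(2)[of n] by auto
  then have "summable (\<lambda>m. of_real (sing_coeff m) * (of_real ((1 + radius n) / 2) :: complex) ^ m)"
    using sing_gen_sums[of "of_real ((1 + radius n) / 2)"] radius(3)[of n] by (auto simp: sums_iff norm_of_real simp del: of_real_divide of_real_add)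
  then have "summable (\<lambda>m. norm (of_real (sing_coeff m) * (of_real (radius n) :: complex) ^ m))"
    by (rule powser_insidea) (use radius[of n] in \<open>auto simp del: of_real_divide of_real_add\<close>)
  then have sm: "summable (\<lambda>m. norm (complex_of_real (sing_coeff m)) * radius n ^ m)"
    using radius(3)[of n] by (simp add: norm_mult norm_power)
  have "(\<Sum>m. of_real (sing_coeff m) * (of_real (radius n) * cis x) ^ m) = sing_gen (circle n x)" for x
    using sing_gen_sums[OF circle_in_disc(1)[of n x]] by (simp add: sums_iff circle_def)
  then show ?thesis using power_series_fourier_coefficient[OF sm, of n] radius(3)[of n] by simp
qed

lemma continuous_on_T_reg: "continuous_on (ball 0 1) T_reg"
  unfolding continuous_on_def
proof
  fix z :: complex assume "z \<in> ball 0 1"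
  then have z: "norm z < 1" by simp
  obtain C where C: "C \<ge> 0"
    "\<And>z z'. norm z < 1 \<Longrightarrow> norm z' < 1 \<Longrightarrow> norm (z - z') \<le> norm (1 - z) / 2 \<Longrightarrow>
      norm (T_reg z' - T_reg z) \<le> C * norm (z - z') powr \<beta> * norm (1 - z) powr (- 2 * \<beta>)"
    by (rule T_reg_holder) blast
  have pos: "norm (1 - z) / 2 > 0" using one_minus_bounds[OF z] by simp
  have n0: "((\<lambda>y. norm (z - y)) \<longlongrightarrow> norm (z - z)) (at z within ball 0 1)"
    by (intro tendsto_intros)
  have "((\<lambda>y. C * norm (z - y) powr \<beta> * norm (1 - z) powr (- 2 * \<beta>)) \<longlongrightarrow> C * norm (z - z) powr \<beta> * norm (1 - z) powr (- 2 * \<beta>)) (at z within ball 0 1)"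
    using \<beta> by (intro tendsto_mult tendsto_const tendsto_powr2 n0) auto
  then have lim: "((\<lambda>y. C * norm (z - y) powr \<beta> * norm (1 - z) powr (- 2 * \<beta>)) \<longlongrightarrow> 0) (at z within ball 0 1)"
    by simp
  have "eventually (\<lambda>y. norm (z - y) < norm (1 - z) / 2) (at z within ball 0 1)"
    using order_tendstoD(2)[OF n0, of "norm (1 - z) / 2"] pos by simp
  moreover have "eventually (\<lambda>y. y \<in> ball 0 1) (at z within ball 0 1)"
    by (simp add: eventually_at_filter)
  ultimately have "eventually (\<lambda>y. norm (T_reg y - T_reg z) \<le> C * norm (z - y) powr \<beta> * norm (1 - z) powr (- 2 * \<beta>)) (at z within ball 0 1)"
    by eventually_elim (use C(2)[OF z] in auto)
  then have "((\<lambda>y. T_reg y - T_reg z) \<longlongrightarrow> 0) (at z within ball 0 1)"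
    by (rule Lim_null_comparison[OF _ lim])
  then show "(T_reg \<longlongrightarrow> T_reg z) (at z within ball 0 1)" by (simp add: LIM_zero_iff)
qed

lemma T_reg_coefficient_bound:
  obtains C where "C \<ge> 0" "\<And>n. n \<ge> 1 \<Longrightarrow>
    norm (integral {-pi..pi} (\<lambda>x. cscale (cis (- real n * x)) o\<^sub>L T_reg (circle n x))) \<le> C * real n powr - (1/2)"
proof -
  obtain C1 where C1: "C1 \<ge> 0" "\<And>z. norm z < 1 \<Longrightarrow> norm (T_reg z) \<le> C1" by (rule T_reg_bounded) blast
  obtain C2 where C2: "C2 \<ge> 0"
    "\<And>z z'. norm z < 1 \<Longrightarrow> norm z' < 1 \<Longrightarrow> norm (z - z') \<le> norm (1 - z) / 2 \<Longrightarrow>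
      norm (T_reg z' - T_reg z) \<le> C2 * norm (z - z') powr \<beta> * norm (1 - z) powr (- 2 * \<beta>)"
    by (rule T_reg_holder) blast
  define K where "K = max C1 (C2 * pi powr (2 * \<beta>))"
  have K: "K \<ge> 0" using C1 by (simp add: K_def le_max_iff_disj)
  show thesis
  proof (rule fourier_coefficient_decay[OF \<beta> K])
    fix C assume C: "C \<ge> 0"
     "\<And>(g :: real \<Rightarrow> ('b \<times> 'b) \<Rightarrow>\<^sub>L ('b \<times> 'b)) n.
      n \<ge> 1 \<Longrightarrow> continuous_on UNIV g \<Longrightarrow> (\<And>x. g (x + 2 * pi) = g x) \<Longrightarrow> (\<And>x. norm (g x) \<le> K) \<Longrightarrow>
      (\<And>x h. \<bar>x\<bar> \<le> pi \<Longrightarrow> h > 0 \<Longrightarrow> 2 * pi * h \<le> \<bar>x\<bar> \<Longrightarrow>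
         norm (g (x + h) - g x) \<le> K * h powr \<beta> * \<bar>x\<bar> powr (- 2 * \<beta>)) \<Longrightarrow>
      norm (integral {-pi..pi} (\<lambda>x. cscale (cis (- real n * x)) o\<^sub>L g x)) \<le> C * real n powr - (1/2)"
  show thesis
  proof (rule that[OF C(1)])
    fix n :: nat assume n: "n \<ge> 1"
    show "norm (integral {-pi..pi} (\<lambda>x. cscale (cis (- real n * x)) o\<^sub>L T_reg (circle n x))) \<le> C * real n powr - (1/2)"
    proof (rule C(2)[OF n])
      show "continuous_on UNIV (\<lambda>x. T_reg (circle n x))"
        by (rule continuous_on_compose2[OF continuous_on_T_reg continuous_circle]) (use circle_in_disc in auto)
      show "T_reg (circle n (x + 2 * pi)) = T_reg (circle n x)" for x
        by (simp add: circle_def cis_mult[symmetric])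
      show "norm (T_reg (circle n x)) \<le> K" for x
        using C1(2)[OF circle_in_disc(1)[of n x]] by (simp add: K_def le_max_iff_disj)
      show "norm (T_reg (circle n (x + h)) - T_reg (circle n x)) \<le> K * h powr \<beta> * \<bar>x\<bar> powr (- 2 * \<beta>)"
        if x: "\<bar>x\<bar> \<le> pi" and h: "h > 0" "2 * pi * h \<le> \<bar>x\<bar>" for x h
      proof -
        have lo: "norm (1 - circle n x) \<ge> \<bar>x\<bar> / pi"
          unfolding circle_def by (rule one_minus_rcis_ge) (use radius[of n] x in auto)
        have "circle n x - circle n (x + h) = of_real (radius n) * (cis x * (1 - cis h))"
          by (simp add: circle_def cis_mult[symmetric] algebra_simps)
        then have "norm (circle n x - circle n (x + h)) = radius n * norm (1 - cis h)"
          using radius(3)[of n] by (simp add: norm_mult)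
        also have "\<dots> \<le> 1 * h"
          using radius[of n] h by (intro mult_mono norm_one_minus_cis_le) auto
        finally have d: "norm (circle n x - circle n (x + h)) \<le> h" by simp
        have "2 * h \<le> \<bar>x\<bar> / pi" using h(2) pi_gt_zero by (simp add: field_simps)
        then have half: "norm (circle n x - circle n (x + h)) \<le> norm (1 - circle n x) / 2" using d lo by linarith
        have x0: "\<bar>x\<bar> > 0" using h pi_gt_zero by (smt (verit) mult_pos_pos)
        have "norm (T_reg (circle n (x + h)) - T_reg (circle n x))
           \<le> C2 * norm (circle n x - circle n (x + h)) powr \<beta> * norm (1 - circle n x) powr (- 2 * \<beta>)"
          by (rule C2(2)[OF circle_in_disc(1) circle_in_disc(1) half])
        also have "\<dots> \<le> C2 * h powr \<beta> * (\<bar>x\<bar> / pi) powr (- 2 * \<beta>)"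
          using C2(1) d lo x0 \<beta> by (intro mult_mono mult_left_mono powr_mono2 powr_mono2') auto
        also have "(\<bar>x\<bar> / pi) powr (- 2 * \<beta>) = pi powr (2 * \<beta>) * \<bar>x\<bar> powr (- 2 * \<beta>)"
          using x0 by (simp add: powr_divide powr_minus field_simps)
        also have "C2 * h powr \<beta> * (pi powr (2 * \<beta>) * \<bar>x\<bar> powr (- 2 * \<beta>))
            = (C2 * pi powr (2 * \<beta>)) * (h powr \<beta> * \<bar>x\<bar> powr (- 2 * \<beta>))" by (simp add: mult_ac)
        also have "\<dots> \<le> K * (h powr \<beta> * \<bar>x\<bar> powr (- 2 * \<beta>))" by (intro mult_right_mono) (auto simp: K_def)
        finally show ?thesis by (simp add: mult.assoc)
      qed
    qed
  qed
  qed
qed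

theorem T_op_expansion:
  obtains C where "C \<ge> 0" "\<And>n. n \<ge> 1 \<Longrightarrow> norm (T_op n - sing_coeff n *\<^sub>R P) \<le> C * real n powr - (1/2)"
proof -
  obtain C where C: "C \<ge> 0" "\<And>n. n \<ge> 1 \<Longrightarrow>
    norm (integral {-pi..pi} (\<lambda>x. cscale (cis (- real n * x)) o\<^sub>L T_reg (circle n x))) \<le> C * real n powr - (1/2)"
    by (rule T_reg_coefficient_bound) blast
  show thesis
  proof (rule that[OF C(1)])
    fix n :: nat assume n: "n \<ge> 1"
    define k where "k = 1 / (2 * pi * radius n ^ n)"
    have k: "0 \<le> k" "k \<le> 1"
    proof -
      show "0 \<le> k" using radius(3)[of n] by (simp add: k_def)
      have "k = inverse (radius n ^ n) / (2 * pi)" by (simp add: k_def field_simps)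
      also have "\<dots> \<le> 3 / (2 * pi)" using radius_power[of n] pi_gt_zero by (intro divide_right_mono) auto
      also have "\<dots> \<le> 1" using pi_gt3 by simp
      finally show "k \<le> 1" .
    qed
    define IS where "IS = integral {-pi..pi} (\<lambda>x. cscale (cis (- real n * x)) o\<^sub>L T_reg (circle n x))"
    have iE: "((\<lambda>x. cscale (cis (- real n * x) * sing_gen (circle n x)) o\<^sub>L complexify P)
        has_integral (cscale (2 * of_real pi * of_real (sing_coeff n) * of_real (radius n ^ n)) o\<^sub>L complexify P)) {-pi..pi}"
      using has_integral_linear[OF sing_gen_fourier[of n] bounded_linear_compose[OF
          bounded_bilinear.bounded_linear_left[OF bounded_bilinear_blinfun_compose, of "complexify P"] bounded_linear_cscale]]
      by (simp add: o_def)
    have eq: "cscale (cis (- real n * x)) o\<^sub>L T_reg (circle n x) =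
       (cscale (cis (- real n * x)) o\<^sub>L T_gen (circle n x)) - (cscale (cis (- real n * x) * sing_gen (circle n x)) o\<^sub>L complexify P)" for x
      unfolding T_reg_def compose_simps cscale_mult blinfun_compose_assoc ..
    have "IS = integral {-pi..pi} (\<lambda>x. cscale (cis (- real n * x)) o\<^sub>L T_gen (circle n x))
          - (cscale (2 * of_real pi * of_real (sing_coeff n) * of_real (radius n ^ n)) o\<^sub>L complexify P)"
      unfolding IS_def eq
      by (rule integral_unique[OF has_integral_diff[OF integrable_integral[OF T_gen_circle_integrable] iE]])
    moreover have "k *\<^sub>R (cscale (2 * of_real pi * of_real (sing_coeff n) * of_real (radius n ^ n)) o\<^sub>L complexify P) = sing_coeff n *\<^sub>R complexify P"
    proof -
      have "(2 * of_real pi * of_real (sing_coeff n) * of_real (radius n ^ n) :: complex) = of_real (2 * pi * sing_coeff n * radius n ^ n)" by simp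
      then have "k *\<^sub>R (cscale (2 * of_real pi * of_real (sing_coeff n) * of_real (radius n ^ n)) o\<^sub>L complexify P)
         = (k * (2 * pi * sing_coeff n * radius n ^ n)) *\<^sub>R complexify P"
        by (simp only: cscale_of_real) (rule blinfun_eqI, simp add: blinfun.bilinear_simps scaleR_prod_def)
      also have "k * (2 * pi * sing_coeff n * radius n ^ n) = sing_coeff n" using radius(3)[of n] by (simp add: k_def)
      finally show ?thesis .
    qed
    ultimately have kIS: "k *\<^sub>R IS = Q_op n - sing_coeff n *\<^sub>R complexify P"
      unfolding Q_op_def k_def[symmetric] by (simp add: scaleR_diff_right)
    have "norm (T_op n - sing_coeff n *\<^sub>R P) \<le> norm (k *\<^sub>R IS)"
    proof (rule norm_blinfun_bound)
      fix v
      have "(T_op n - sing_coeff n *\<^sub>R P) v = fst ((k *\<^sub>R IS) (v, 0))"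
        unfolding kIS by (simp add: blinfun.diff_left blinfun.scaleR_left T_op_apply)
      also have "norm \<dots> \<le> norm ((k *\<^sub>R IS) (v, 0))" by (metis norm_fst_le prod.collapse)
      also have "\<dots> \<le> norm (k *\<^sub>R IS) * norm (v, 0 :: 'b)" by (rule norm_blinfun)
      also have "norm (v, 0 :: 'b) = norm v" by (simp add: norm_prod_def)
      finally show "norm ((T_op n - sing_coeff n *\<^sub>R P) v) \<le> norm (k *\<^sub>R IS) * norm v" .
    qed simp
    also have "\<dots> \<le> 1 * norm IS" unfolding norm_scaleR using k by (intro mult_right_mono) auto
    also have "\<dots> \<le> C * real n powr - (1/2)" using C(2)[OF n] by (simp add: IS_def)
    finally show "norm (T_op n - sing_coeff n *\<^sub>R P) \<le> C * real n powr - (1/2)" .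
  qed
qed

end

section \<open>Asymptotics of the renewal operators\<close>

context renewal_operators
begin

lemma n_sing_ge_1: "n_sing \<ge> 1"
proof -
  have "0 < \<beta> / (1 - \<beta>)" using \<beta> by simp
  then show ?thesis unfolding n_sing_def by linarith
qed

lemma b0_pos: "b0 > 0"
  unfolding b0_def using \<beta> c by (intro mult_pos_pos Gamma_real_pos) auto

text \<open>After multiplication by \<open>n powr (2 - 2 * \<beta>)\<close> the \<open>k\<close>-th term has order
\<open>n powr ((1 - \<beta>) * (1 - k))\<close>: the term \<open>k = 0\<close> is cancelled to sufficient order by its limit, \<open>k = 1\<close> gives
the limit and \<open>k \<ge> 2\<close> vanishes.\<close>

lemma sing_coeff_limit:
  "(\<lambda>n. real n powr (1 - \<beta>) * (real n powr (1 - \<beta>) * sing_coeff n - rGamma \<beta> / b0))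
     \<longlonglongrightarrow> - \<theta> / b0 * rGamma (2 * \<beta> - 1)"
proof -
  define x where "x n = real n powr (1 - \<beta>)" for n
  define a where "a k = \<beta> - real k * (1 - \<beta>)" for k
  define q where "q k n = (- \<theta>) ^ k / b0 * (x n * x n * bincoef (a k) n)" for k n
  obtain C where C: "C \<ge> 0" "\<And>n. n \<ge> 1 \<Longrightarrow> \<bar>bincoef \<beta> n - rGamma \<beta> * real n powr (\<beta> - 1)\<bar> \<le> C * real n powr (\<beta> - 2)"
    by (rule bincoef_rate[of \<beta>]) (use \<beta> in auto)
  have x2: "x n * x n = real n powr (2 - 2 * \<beta>)" for n
    by (simp add: x_def powr_add[symmetric])
  have q0: "(\<lambda>n. q 0 n - x n * (rGamma \<beta> / b0)) \<longlonglongrightarrow> 0"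
  proof (rule Lim_null_comparison)
    show "eventually (\<lambda>n. norm (q 0 n - x n * (rGamma \<beta> / b0)) \<le> C / b0 * real n powr - \<beta>) sequentially"
      using eventually_ge_at_top[of 1]
    proof eventually_elim
      case (elim n)
      have "real n powr (2 - 2 * \<beta>) * real n powr (\<beta> - 1) = x n"
        by (simp add: x_def powr_add[symmetric])
      then have "q 0 n - x n * (rGamma \<beta> / b0) = 1 / b0 * (real n powr (2 - 2 * \<beta>) * (bincoef \<beta> n - rGamma \<beta> * real n powr (\<beta> - 1)))"
        unfolding q_def x2 a_def by (simp add: right_diff_distrib mult_ac)
      also have "norm \<dots> \<le> 1 / b0 * (real n powr (2 - 2 * \<beta>) * (C * real n powr (\<beta> - 2)))"
        unfolding norm_mult using b0_pos C(2)[OF elim] by (intro mult_mono) auto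
      also have "\<dots> = C / b0 * (real n powr (2 - 2 * \<beta>) * real n powr (\<beta> - 2))" by simp
      also have "real n powr (2 - 2 * \<beta>) * real n powr (\<beta> - 2) = real n powr - \<beta>"
        by (simp add: powr_add[symmetric])
      finally show ?case .
    qed
    have "(\<lambda>n. C / b0 * real n powr - \<beta>) \<longlonglongrightarrow> C / b0 * 0"
      using \<beta> by (intro tendsto_intros tendsto_neg_powr filterlim_real_sequentially) auto
    then show "(\<lambda>n. C / b0 * real n powr - \<beta>) \<longlonglongrightarrow> 0" by simp
  qed
  have qk: "q k \<longlonglongrightarrow> (if k = 1 then - \<theta> / b0 * rGamma (2 * \<beta> - 1) else 0)" if "k \<ge> 1" for k
  proof -
    have lim: "(\<lambda>n. bincoef (a k) n * real n powr (1 - a k)) \<longlonglongrightarrow> rGamma (a k)" by (rule bincoef_limit)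
    show ?thesis
    proof (cases "k = 1")
      case True
      have "a k = 2 * \<beta> - 1" using True by (simp add: a_def)
      then have "(\<lambda>n. - \<theta> / b0 * (bincoef (a k) n * real n powr (2 - 2 * \<beta>))) \<longlonglongrightarrow> - \<theta> / b0 * rGamma (2 * \<beta> - 1)"
        using tendsto_mult[OF tendsto_const[of "- \<theta> / b0"] lim] by simp
      then show ?thesis using True unfolding q_def[abs_def] x2 by (simp add: mult_ac)
    next
      case False
      then have k: "k \<ge> 2" using that by simp
      define s where "s = (real k - 1) * (1 - \<beta>)"
      have s: "s > 0" using k \<beta> by (simp add: s_def)
      have "(\<lambda>n. (- \<theta>) ^ k / b0 * ((bincoef (a k) n * real n powr (1 - a k)) * real n powr - s)) \<longlonglongrightarrow> (- \<theta>) ^ k / b0 * (rGamma (a k) * 0)"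
        using s by (intro tendsto_intros lim tendsto_neg_powr filterlim_real_sequentially) auto
      moreover have "q k n = (- \<theta>) ^ k / b0 * ((bincoef (a k) n * real n powr (1 - a k)) * real n powr - s)" for n
      proof -
        have "real n powr (1 - a k) * real n powr - s = real n powr (2 - 2 * \<beta>)"
          unfolding powr_add[symmetric] by (simp add: a_def s_def algebra_simps)
        then show ?thesis unfolding q_def x2 by (simp add: mult.assoc mult.left_commute)
      qed
      ultimately have "(\<lambda>n. q k n) \<longlonglongrightarrow> (- \<theta>) ^ k / b0 * (rGamma (a k) * 0)" by (simp only:)
      then show ?thesis using False by simp
    qed
  qed
  have "(\<lambda>n. (q 0 n - x n * (rGamma \<beta> / b0)) + (\<Sum>k=1..n_sing. q k n))
      \<longlonglongrightarrow> 0 + (\<Sum>k=1..n_sing. if k = 1 then - \<theta> / b0 * rGamma (2 * \<beta> - 1) else 0)"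
    by (intro tendsto_add q0 tendsto_sum qk) auto
  moreover have "(\<Sum>k=1..n_sing. if k = 1 then - \<theta> / b0 * rGamma (2 * \<beta> - 1) else 0) = - \<theta> / b0 * rGamma (2 * \<beta> - 1)"
    using n_sing_ge_1 by simp
  moreover have "(q 0 n - x n * (rGamma \<beta> / b0)) + (\<Sum>k=1..n_sing. q k n) = x n * (x n * sing_coeff n - rGamma \<beta> / b0)" for n
  proof -
    have "q 0 n + (\<Sum>k=1..n_sing. q k n) = (\<Sum>k\<le>n_sing. q k n)"
      by (simp add: atMost_atLeast0 sum.atLeast_Suc_atMost)
    also have "\<dots> = x n * x n * sing_coeff n"
      unfolding q_def sing_coeff_def a_def sum_distrib_left by (intro sum.cong) auto
    finally show ?thesis by (simp add: right_diff_distrib)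
  qed
  ultimately show ?thesis unfolding x_def by simp
qed

lemma d_const_b0: "rGamma \<beta> / b0 = d_const \<beta> / c"
  using d_const_eq[of \<beta>] \<beta> by (simp add: b0_def)

theorem T_op_first_order:
  "(\<lambda>n. norm (real n powr (1 - \<beta>) *\<^sub>R T_op n - (d_const \<beta> / c) *\<^sub>R P)) \<in> O(\<lambda>n. real n powr - (min (1 - \<beta>) (\<beta> - 1/2)))"
proof -
  obtain C where C: "C \<ge> 0" "\<And>n. n \<ge> 1 \<Longrightarrow> norm (T_op n - sing_coeff n *\<^sub>R P) \<le> C * real n powr - (1/2)"
    by (rule T_op_expansion) blast
  define y where "y n = real n powr (1 - \<beta>) * sing_coeff n - rGamma \<beta> / b0" for n
  obtain B where B: "B > 0" "\<And>n. \<bar>real n powr (1 - \<beta>) * y n\<bar> \<le> B"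
    using convergent_imp_Bseq[OF convergentI[OF sing_coeff_limit]] unfolding Bseq_def y_def by auto
  define \<gamma> where "\<gamma> = min (1 - \<beta>) (\<beta> - 1/2)"
  have "norm (real n powr (1 - \<beta>) *\<^sub>R T_op n - (d_const \<beta> / c) *\<^sub>R P) \<le> (B * norm P + C) * real n powr - \<gamma>" if n: "n \<ge> 1" for n
  proof -
    have "real n powr (1 - \<beta>) *\<^sub>R T_op n - (d_const \<beta> / c) *\<^sub>R P = y n *\<^sub>R P + real n powr (1 - \<beta>) *\<^sub>R (T_op n - sing_coeff n *\<^sub>R P)"
      by (simp add: y_def d_const_b0 algebra_simps)
    also have "norm \<dots> \<le> \<bar>y n\<bar> * norm P + real n powr (1 - \<beta>) * norm (T_op n - sing_coeff n *\<^sub>R P)"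
      by (rule order_trans[OF norm_triangle_ineq]) simp
    also have "\<dots> \<le> (B * real n powr - \<gamma>) * norm P + C * real n powr - \<gamma>"
    proof (intro add_mono mult_right_mono)
      have "\<bar>y n\<bar> = \<bar>real n powr (1 - \<beta>) * y n\<bar> * real n powr - (1 - \<beta>)"
      proof -
        have "real n powr (1 - \<beta>) * real n powr - (1 - \<beta>) = 1"
          using n unfolding powr_add[symmetric] by simp
        then show ?thesis by (simp only: abs_mult abs_of_nonneg[OF powr_ge_zero] mult.assoc mult.commute mult.left_commute mult_1_right)
      qed
      also have "\<dots> \<le> B * real n powr - \<gamma>"
        using B n by (intro mult_mono powr_mono) (auto simp: \<gamma>_def)
      finally show "\<bar>y n\<bar> \<le> B * real n powr - \<gamma>" .
      have "real n powr (1 - \<beta>) * norm (T_op n - sing_coeff n *\<^sub>R P) \<le> real n powr (1 - \<beta>) * (C * real n powr - (1/2))"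
        by (intro mult_left_mono C n) auto
      also have "\<dots> = C * real n powr (1 - \<beta> - 1/2)"
        using powr_add[of "real n" "1 - \<beta>" "- (1/2)"] by simp
      also have "\<dots> \<le> C * real n powr - \<gamma>"
        using C n by (intro mult_left_mono powr_mono) (auto simp: \<gamma>_def)
      finally show "real n powr (1 - \<beta>) * norm (T_op n - sing_coeff n *\<^sub>R P) \<le> C * real n powr - \<gamma>" .
    qed auto
    finally show ?thesis by (simp add: algebra_simps)
  qed
  then show ?thesis unfolding \<gamma>_def[symmetric]
    by (intro bigoI[of _ "B * norm P + C"] eventually_sequentiallyI[of 1]) auto
qed

theorem T_op_second_order:
  assumes "3/4 < \<beta>"
  shows "(\<lambda>n. real n powr (1 - \<beta>) *\<^sub>R (real n powr (1 - \<beta>) *\<^sub>R T_op n - (d_const \<beta> / c) *\<^sub>R P))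
     \<longlonglongrightarrow> (- \<theta> / b0 * rGamma (2 * \<beta> - 1)) *\<^sub>R P"
proof -
  obtain C where C: "C \<ge> 0" "\<And>n. n \<ge> 1 \<Longrightarrow> norm (T_op n - sing_coeff n *\<^sub>R P) \<le> C * real n powr - (1/2)"
    by (rule T_op_expansion) blast
  define x where "x n = real n powr (1 - \<beta>)" for n
  have err: "(\<lambda>n. (x n * x n) *\<^sub>R (T_op n - sing_coeff n *\<^sub>R P)) \<longlonglongrightarrow> 0"
  proof (rule Lim_null_comparison)
    show "eventually (\<lambda>n. norm ((x n * x n) *\<^sub>R (T_op n - sing_coeff n *\<^sub>R P)) \<le> C * real n powr - (2 * \<beta> - 3/2)) sequentially"
      using eventually_ge_at_top[of 1]
    proof eventually_elim
      case (elim n)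
      have "norm ((x n * x n) *\<^sub>R (T_op n - sing_coeff n *\<^sub>R P)) \<le> (x n * x n) * (C * real n powr - (1/2))"
        unfolding norm_scaleR x_def using C(2)[OF elim] by (intro mult_mono) auto
      also have "\<dots> = C * (real n powr (1 - \<beta>) * real n powr (1 - \<beta>) * real n powr - (1/2))" by (simp add: x_def)
      also have "real n powr (1 - \<beta>) * real n powr (1 - \<beta>) * real n powr - (1/2) = real n powr - (2 * \<beta> - 3/2)"
        unfolding powr_add[symmetric] by (rule arg_cong[where f = "(powr) (real n)"]) simp
      finally show ?case .
    qed
    have "(\<lambda>n. C * real n powr - (2 * \<beta> - 3/2)) \<longlonglongrightarrow> C * 0"
      using assms by (intro tendsto_intros tendsto_neg_powr filterlim_real_sequentially) auto
    then show "(\<lambda>n. C * real n powr - (2 * \<beta> - 3/2)) \<longlonglongrightarrow> 0" by simp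
  qed
  have "(\<lambda>n. (x n * (x n * sing_coeff n - rGamma \<beta> / b0)) *\<^sub>R P + (x n * x n) *\<^sub>R (T_op n - sing_coeff n *\<^sub>R P))
     \<longlonglongrightarrow> (- \<theta> / b0 * rGamma (2 * \<beta> - 1)) *\<^sub>R P + 0"
    unfolding x_def by (intro tendsto_add tendsto_scaleR sing_coeff_limit tendsto_const err[unfolded x_def])
  moreover have "(x n * (x n * sing_coeff n - rGamma \<beta> / b0)) *\<^sub>R P + (x n * x n) *\<^sub>R (T_op n - sing_coeff n *\<^sub>R P)
      = x n *\<^sub>R (x n *\<^sub>R T_op n - (d_const \<beta> / c) *\<^sub>R P)" for n
    by (simp add: d_const_b0 algebra_simps)
  ultimately show ?thesis unfolding x_def by simp
qed

end

section \<open>First returns of a conservative map\<close>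

locale return_system =
  fixes M :: "'a measure" and f :: "'a \<Rightarrow> 'a" and Y :: "'a set"
  assumes f_mp: "measure_preserving_map M f" and f_cons: "conservative M f"
    and Y: "Y \<in> sets M" "emeasure M Y = 1"
begin

abbreviation \<phi> :: "'a \<Rightarrow> nat" where "\<phi> \<equiv> return_time f Y"
abbreviation N :: "'a measure" where "N \<equiv> restrict_space M Y"

lemma f_measurable [measurable]: "f \<in> measurable M M"
  using f_mp by (simp add: measure_preserving_map_def)

lemma Y_subset: "Y \<subseteq> space M" using Y(1) by (rule sets.sets_into_space)

lemma Y_inter [simp]: "Y \<inter> space M = Y" "space M \<inter> Y = Y" using Y_subset by auto

lemma space_N [simp]: "space N = Y" by (simp add: space_restrict_space)

lemma prob_N: "prob_space N"
  by (rule prob_spaceI) (simp add: emeasure_restrict_space Y)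

sublocale N: prob_space N by (rule prob_N)

lemma measure_N: "A \<in> sets M \<Longrightarrow> A \<subseteq> Y \<Longrightarrow> measure N A = measure M A"
  by (rule measure_restrict_space) (use Y in auto)

lemma return_time_le:
  assumes "n \<ge> 1" "(f ^^ n) y \<in> Y"
  shows "1 \<le> \<phi> y" "\<phi> y \<le> n"
proof -
  let ?K = "{n. n \<ge> 1 \<and> (f ^^ n) y \<in> Y}"
  have "n \<in> ?K" using assms by simp
  then have "Inf ?K \<in> ?K" by (intro Inf_nat_def1) auto
  then show "1 \<le> \<phi> y" by (simp add: return_time_def)
  show "\<phi> y \<le> n" unfolding return_time_def using \<open>n \<in> ?K\<close> by (intro cInf_lower) auto
qed

lemma return_time_eqD: "\<phi> y = n \<Longrightarrow> return_map f Y y = (f ^^ n) y"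
  by (simp add: return_map_def)

lemma vimage_Y [measurable]: "{y \<in> space M. (f ^^ n) y \<in> Y} \<in> sets M"
  using measurable_sets[OF measurable_compose_n[OF f_measurable, of n] Y(1)]
  by (simp add: vimage_def Int_def conj_commute)

text \<open>Level sets of a first return time are Boolean combinations of visit sets, up to the points that never
return, which all lie in the level set of \<open>Inf {}\<close>.\<close>

lemma return_time_eq_sets: "{y \<in> Y. \<phi> y = n} \<in> sets M"
proof -
  define V where "V k = {y \<in> space M. (f ^^ k) y \<in> Y}" for k
  define D where "D = Inf ({} :: nat set)"
  have V: "V k \<in> sets M" for k unfolding V_def by (rule vimage_Y)
  have char: "\<phi> y = n \<longleftrightarrow> (n \<ge> 1 \<and> y \<in> V n \<and> (\<forall>k\<in>{1..<n}. y \<notin> V k)) \<or> (n = D \<and> (\<forall>k\<in>{1..}. y \<notin> V k))"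
    if y: "y \<in> Y" for y
  proof -
    have yV: "y \<in> V k \<longleftrightarrow> (f ^^ k) y \<in> Y" for k using y Y_subset by (auto simp: V_def)
    show ?thesis
    proof (cases "\<exists>k\<ge>1. y \<in> V k")
      case False
      then have "{n. n \<ge> 1 \<and> (f ^^ n) y \<in> Y} = {}" unfolding yV by auto
      then have "\<phi> y = D" by (simp only: return_time_def D_def)
      then show ?thesis using False by auto
    next
      case True
      let ?K = "{n. n \<ge> 1 \<and> (f ^^ n) y \<in> Y}"
      have ne: "?K \<noteq> {}" using True unfolding yV by auto
      have "\<phi> y \<in> ?K" unfolding return_time_def by (rule Inf_nat_def1[OF ne])
      then have 1: "\<phi> y \<ge> 1" "y \<in> V (\<phi> y)" unfolding yV by auto
      have 2: "\<phi> y \<le> k" if "k \<ge> 1" "y \<in> V k" for k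
        using return_time_le(2)[of k y] that unfolding yV by auto
      show ?thesis
      proof
        assume "\<phi> y = n"
        then show "(n \<ge> 1 \<and> y \<in> V n \<and> (\<forall>k\<in>{1..<n}. y \<notin> V k)) \<or> (n = D \<and> (\<forall>k\<in>{1..}. y \<notin> V k))"
          using 1 2 by force
      next
        assume "(n \<ge> 1 \<and> y \<in> V n \<and> (\<forall>k\<in>{1..<n}. y \<notin> V k)) \<or> (n = D \<and> (\<forall>k\<in>{1..}. y \<notin> V k))"
        then have n: "n \<ge> 1" "y \<in> V n" "\<forall>k\<in>{1..<n}. y \<notin> V k" using True by auto
        have "\<not> \<phi> y < n" using n(3) 1 by auto
        then show "\<phi> y = n" using 2[OF n(1,2)] by simp
      qed
    qed
  qed
  have "{y \<in> Y. \<phi> y = n} = (if n \<ge> 1 then (Y \<inter> V n) - (\<Union>k\<in>{1..<n}. V k) else {}) \<union> (if n = D then Y - (\<Union>k\<in>{1..}. V k) else {})"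
    using char by (auto split: if_splits)
  also have "\<dots> \<in> sets M" using V Y(1) by auto
  finally show ?thesis .
qed

lemma return_time_Collect_sets: "{y \<in> Y. Q (\<phi> y)} \<in> sets M"
proof -
  have "{y \<in> Y. Q (\<phi> y)} = (\<Union>n\<in>{n. Q n}. {y \<in> Y. \<phi> y = n})" by auto
  also have "\<dots> \<in> sets M" by (intro sets.countable_UN') (use return_time_eq_sets in auto)
  finally show ?thesis .
qed

definition t :: "nat \<Rightarrow> real" where "t n = measure M {y \<in> Y. \<phi> y > n}"

lemma emeasure_subset_finite: "A \<subseteq> Y \<Longrightarrow> A \<in> sets M \<Longrightarrow> emeasure M A \<noteq> \<infinity>"
  using emeasure_mono[of A Y M] Y by (auto simp: top_unique)

lemma t_diff: "measure M {y \<in> Y. \<phi> y = Suc n} = t n - t (Suc n)"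
proof -
  have "{y \<in> Y. \<phi> y > n} - {y \<in> Y. \<phi> y > Suc n} = {y \<in> Y. \<phi> y = Suc n}" by auto
  moreover have "measure M ({y \<in> Y. \<phi> y > n} - {y \<in> Y. \<phi> y > Suc n}) = t n - t (Suc n)"
    unfolding t_def
  proof (rule measure_Diff)
    show "emeasure M {y \<in> Y. n < \<phi> y} \<noteq> \<infinity>" by (rule emeasure_subset_finite) (auto intro: return_time_Collect_sets)
  qed (auto intro!: return_time_Collect_sets)
  ultimately show ?thesis by simp
qed

text \<open>The points of \<open>Y\<close> that never return form a wandering set.\<close>

lemma t_0: "t 0 = 1"
proof -
  define W where "W = Y - (\<Union>k\<in>{1..}. {y \<in> space M. (f ^^ k) y \<in> Y})"
  have W: "W \<in> sets M" unfolding W_def using Y(1) by (intro sets.Diff sets.countable_UN') auto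
  have noret: "(f ^^ k) x \<notin> Y" if "x \<in> W" "k \<ge> 1" for x k
    using that Y_subset unfolding W_def by auto
  have "disjoint_family (\<lambda>n::nat. (f ^^ n) -` W \<inter> space M)"
  proof -
    have "False" if x: "(f ^^ m) x \<in> W" "(f ^^ n) x \<in> W" and mn: "m < n" for m n x
    proof -
      have "(f ^^ (n - m)) ((f ^^ m) x) = (f ^^ n) x"
        using mn funpow_add[of "n - m" m f] by (simp add: fun_eq_iff)
      moreover have "(f ^^ (n - m)) ((f ^^ m) x) \<notin> Y" using noret[OF x(1)] mn by simp
      ultimately show False using x(2) by (simp add: W_def)
    qed
    then show ?thesis unfolding disjoint_family_on_def
      by (metis (no_types, lifting) disjoint_iff IntD1 nat_neq_iff vimageE)
  qed
  then have W0: "emeasure M W = 0" using f_cons W unfolding conservative_def by blast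
  have sub: "Y - W \<subseteq> {y \<in> Y. \<phi> y > 0}"
  proof
    fix y assume "y \<in> Y - W"
    then obtain k where "k \<ge> 1" "(f ^^ k) y \<in> Y" "y \<in> Y" by (auto simp: W_def)
    then show "y \<in> {y \<in> Y. \<phi> y > 0}" using return_time_le(1)[of k y] by auto
  qed
  have "emeasure M (Y - W) = 1"
    using emeasure_Diff[of M W Y] W W0 Y by (auto simp: W_def)
  then have "emeasure M {y \<in> Y. \<phi> y > 0} \<ge> 1"
    using emeasure_mono[OF sub return_time_Collect_sets] by simp
  moreover have "emeasure M {y \<in> Y. \<phi> y > 0} \<le> 1"
    using emeasure_mono[of "{y \<in> Y. \<phi> y > 0}" Y M] Y by auto
  ultimately have "emeasure M {y \<in> Y. \<phi> y > 0} = 1" by (rule antisym[rotated])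
  then show ?thesis by (simp add: t_def measure_def)
qed

lemma H1_fun_eq:
  assumes "x \<ge> 0" shows "H1_fun M Y \<phi> c \<beta> x = (1 / c) * t (nat \<lfloor>x\<rfloor>) - x powr - \<beta>"
proof -
  have "real k > x \<longleftrightarrow> k > nat \<lfloor>x\<rfloor>" for k :: nat using assms by linarith
  then show ?thesis by (simp add: H1_fun_def t_def)
qed

text \<open>The observable \<open>1\<^sub>Y w\<close> seen at time \<open>n\<close>.\<close>

definition visit :: "('a \<Rightarrow> real) \<Rightarrow> nat \<Rightarrow> 'a \<Rightarrow> real" where
  "visit w n y = (if (f ^^ n) y \<in> Y then w ((f ^^ n) y) else 0)"

lemma borel_measurable_N_iff:
  fixes w :: "'a \<Rightarrow> real"
  shows "w \<in> borel_measurable N \<longleftrightarrow> (\<lambda>x. indicator Y x * w x) \<in> borel_measurable M"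
  using borel_measurable_restrict_space_iff[of Y M w] Y(1) by (simp add: real_scaleR_def)

lemma visit_measurable_M:
  assumes w: "w \<in> borel_measurable N" shows "visit w n \<in> borel_measurable M"
proof -
  have "visit w n = (\<lambda>y. (\<lambda>x. indicator Y x * w x) ((f ^^ n) y))"
    by (auto simp: visit_def)
  also have "\<dots> \<in> borel_measurable M"
    by (rule measurable_compose[OF measurable_compose_n[OF f_measurable] w[unfolded borel_measurable_N_iff]])
  finally show ?thesis .
qed

lemma visit_measurable: "w \<in> borel_measurable N \<Longrightarrow> visit w n \<in> borel_measurable N"
  by (rule measurable_restrict_space1[OF visit_measurable_M])

lemma visit_bounded: "(\<And>y. y \<in> Y \<Longrightarrow> \<bar>w y\<bar> \<le> B) \<Longrightarrow> B \<ge> 0 \<Longrightarrow> \<bar>visit w n y\<bar> \<le> B"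
  by (auto simp: visit_def)

lemma integrable_mult_visit:
  assumes v: "integrable N v" and w: "w \<in> borel_measurable N" and B: "\<And>y. y \<in> Y \<Longrightarrow> \<bar>w y\<bar> \<le> B" "B \<ge> 0"
  shows "integrable N (\<lambda>y. v y * visit w n y)"
proof (rule Bochner_Integration.integrable_bound[OF integrable_mult_right[OF v, of B]])
  show "(\<lambda>y. v y * visit w n y) \<in> borel_measurable N"
    using v visit_measurable[OF w] by (intro borel_measurable_times) auto
  show "AE y in N. norm (v y * visit w n y) \<le> norm (B * v y)"
    using visit_bounded[of w B, OF B] B(2) by (intro AE_I2) (auto simp: abs_mult mult.commute[of B] intro!: mult_left_mono)
qed

text \<open>If \<open>f ^^ n\<close> sends \<open>y\<close> to \<open>Y\<close>, then the first return happens at exactly one time in \<open>{1..n}\<close>, and the rest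
of the orbit starts from the return point. Otherwise every term vanishes, since it observes \<open>f ^^ n\<close> as well.\<close>

lemma visit_first_return:
  assumes n: "n \<ge> 1"
  shows "visit w n y = (\<Sum>j<n. indicator {y. \<phi> y = Suc j} y * visit w (n - Suc j) (return_map f Y y))"
proof -
  have comp: "visit w (n - Suc j) (return_map f Y y) = visit w n y" if "\<phi> y = Suc j" "j < n" for j
  proof -
    have "(f ^^ (n - Suc j)) ((f ^^ Suc j) y) = (f ^^ n) y"
      using that(2) funpow_add[of "n - Suc j" "Suc j" f] by (simp add: fun_eq_iff del: funpow.simps)
    then show ?thesis unfolding return_time_eqD[OF that(1)] visit_def by simp
  qed
  show ?thesis
  proof (cases "\<exists>j<n. \<phi> y = Suc j")
    case True
    then obtain j where j: "j < n" "\<phi> y = Suc j" by auto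
    have "(\<Sum>i<n. indicator {y. \<phi> y = Suc i} y * visit w (n - Suc i) (return_map f Y y))
        = (\<Sum>i<n. if i = j then visit w n y else 0)"
      by (intro sum.cong) (use j comp in \<open>auto simp: indicator_def\<close>)
    then show ?thesis using j by simp
  next
    case False
    have "(f ^^ n) y \<notin> Y"
    proof
      assume "(f ^^ n) y \<in> Y"
      from return_time_le[OF n this] False show False
        by (metis Suc_le_D Suc_le_lessD One_nat_def)
    qed
    moreover have "(\<Sum>j<n. indicator {y. \<phi> y = Suc j} y * visit w (n - Suc j) (return_map f Y y)) = 0"
      using False by (intro sum.neutral) (auto simp: indicator_def)
    ultimately show ?thesis by (simp add: visit_def)
  qed
qed

lemma integrable_return_piece:
  fixes v :: "'a \<Rightarrow> real"
  assumes "integrable N v" shows "integrable N (\<lambda>y. indicator {y. \<phi> y = n} y * v y)"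
proof (rule Bochner_Integration.integrable_bound[OF assms])
  have "{y. \<phi> y = n} \<inter> space N \<in> sets N"
    using return_time_eq_sets[of n] Y(1) by (subst sets_restrict_space_iff) (auto simp: Int_def conj_commute)
  then have "(indicator {y. \<phi> y = n} :: 'a \<Rightarrow> real) \<in> borel_measurable N"
    by (rule iffD2[OF borel_measurable_indicator_iff])
  then show "(\<lambda>y. indicator {y. \<phi> y = n} y * v y) \<in> borel_measurable N"
    using assms by (intro borel_measurable_times) auto
qed (auto simp: indicator_def)

text \<open>The renewal equation, in weak form.\<close>

lemma visit_renewal:
  assumes R: "transfer_operator N (return_map f Y) R" and n: "n \<ge> 1"
    and v: "integrable N v" and w: "w \<in> borel_measurable N" and B: "\<And>y. y \<in> Y \<Longrightarrow> \<bar>w y\<bar> \<le> B" "B \<ge> 0"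
  shows "(\<integral>y. v y * visit w n y \<partial>N) = (\<Sum>j<n. \<integral>y. R_fun R \<phi> (Suc j) v y * visit w (n - Suc j) y \<partial>N)"
proof -
  define p where "p j y = indicator {y. \<phi> y = Suc j} y * v y" for j y
  have p: "integrable N (p j)" for j unfolding p_def by (rule integrable_return_piece[OF v])
  have bnd: "bounded (visit w m ` space N)" for m
    by (rule boundedI[of _ B]) (use visit_bounded[of w B, OF B] in auto)
  have 1: "(\<integral>y. R_fun R \<phi> (Suc j) v y * visit w (n - Suc j) y \<partial>N) = (\<integral>y. p j y * visit w (n - Suc j) (return_map f Y y) \<partial>N)" for j
    using R p[of j] visit_measurable[OF w] bnd unfolding transfer_operator_def R_fun_def p_def by blast
  have 2: "p j y * visit w (n - Suc j) (return_map f Y y) = p j y * visit w n y" if "j < n" for j y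
  proof (cases "\<phi> y = Suc j")
    case True
    have "(f ^^ (n - Suc j)) ((f ^^ Suc j) y) = (f ^^ n) y"
      using that funpow_add[of "n - Suc j" "Suc j" f] by (simp add: fun_eq_iff del: funpow.simps)
    then show ?thesis unfolding return_time_eqD[OF True] visit_def by simp
  qed (simp add: p_def)
  have "(\<Sum>j<n. \<integral>y. R_fun R \<phi> (Suc j) v y * visit w (n - Suc j) y \<partial>N) = (\<Sum>j<n. \<integral>y. p j y * visit w n y \<partial>N)"
    by (intro sum.cong refl) (simp only: 1 2 lessThan_iff)
  also have "\<dots> = (\<integral>y. (\<Sum>j<n. p j y * visit w n y) \<partial>N)"
    by (rule Bochner_Integration.integral_sum[symmetric]) (rule integrable_mult_visit[OF p w B])
  also have "(\<lambda>y. \<Sum>j<n. p j y * visit w n y) = (\<lambda>y. v y * visit w n y)"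
  proof
    fix y
    have "(\<Sum>j<n. p j y * visit w n y) = v y * (\<Sum>j<n. indicator {y. \<phi> y = Suc j} y * visit w (n - Suc j) (return_map f Y y))"
      unfolding sum_distrib_left by (intro sum.cong refl) (simp add: 2[symmetric], simp add: p_def)
    then show "(\<Sum>j<n. p j y * visit w n y) = v y * visit w n y" unfolding visit_first_return[OF n, symmetric] .
  qed
  finally show ?thesis ..
qed

lemma transfer_power:
  assumes L: "transfer_operator M f L" and v: "integrable M v"
  shows "integrable M ((L ^^ n) v)"
    and "w \<in> borel_measurable M \<Longrightarrow> bounded (w ` space M) \<Longrightarrow> (\<integral>x. (L ^^ n) v x * w x \<partial>M) = (\<integral>x. v x * w ((f ^^ n) x) \<partial>M)"
proof (induction n arbitrary: w)
  case 0
  { case 1 then show ?case using v by simp }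
  { case 2 then show ?case by simp }
next
  case (Suc n)
  { case 1 then show ?case using L Suc.IH(1) unfolding transfer_operator_def by simp }
  { case 2
    have b: "bounded ((\<lambda>x. w (f x)) ` space M)"
      using 2(2) measurable_space[OF f_measurable] by (rule_tac bounded_subset) auto
    have "(\<integral>x. (L ^^ Suc n) v x * w x \<partial>M) = (\<integral>x. (L ^^ n) v x * w (f x) \<partial>M)"
      using L Suc.IH(1) 2 unfolding transfer_operator_def by simp
    also have "\<dots> = (\<integral>x. v x * w (f ((f ^^ n) x)) \<partial>M)"
      using Suc.IH(2)[of "\<lambda>x. w (f x)"] 2(1) b by simp
    finally show ?case by simp }
qed

lemma T_fun_duality:
  assumes L: "transfer_operator M f L" and v: "integrable N v"
  shows "integrable N (T_fun L Y n v)"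
    and "w \<in> borel_measurable N \<Longrightarrow> (\<And>y. y \<in> Y \<Longrightarrow> \<bar>w y\<bar> \<le> B) \<Longrightarrow> B \<ge> 0 \<Longrightarrow>
      (\<integral>y. T_fun L Y n v y * w y \<partial>N) = (\<integral>y. v y * visit w n y \<partial>N)"
proof -
  define u where "u = (\<lambda>x. indicator Y x * v x)"
  have u: "integrable M u" using v integrable_restrict_space[of Y M v] Y(1) by (simp add: u_def)
  note tp = transfer_power[OF L u, where n = n]
  have iY: "Y \<inter> space M \<in> sets M" using Y(1) by simp
  have "integrable M (\<lambda>x. indicator Y x * (L ^^ n) u x)"
    using integrable_mult_indicator[OF Y(1) tp(1)] by simp
  then show "integrable N (T_fun L Y n v)"
    unfolding T_fun_def u_def[symmetric] integrable_restrict_space[OF iY]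
    by (rule iffD1[OF Bochner_Integration.integrable_cong, rotated -1]) (auto simp: indicator_def)
  assume w: "w \<in> borel_measurable N" and B: "\<And>y. y \<in> Y \<Longrightarrow> \<bar>w y\<bar> \<le> B" "B \<ge> 0"
  have bnd: "bounded (visit w 0 ` space M)" 
    by (rule boundedI[of _ B]) (use visit_bounded[of w B, OF B] in auto)
  have "(\<integral>y. T_fun L Y n v y * w y \<partial>N) = (\<integral>x. (L ^^ n) u x * visit w 0 x \<partial>M)"
    unfolding integral_restrict_space[OF iY] T_fun_def u_def[symmetric]
    by (intro Bochner_Integration.integral_cong) (auto simp: indicator_def visit_def)
  also have "\<dots> = (\<integral>x. u x * visit w 0 ((f ^^ n) x) \<partial>M)"
    by (rule tp(2)[OF visit_measurable_M[OF w] bnd])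
  also have "\<dots> = (\<integral>y. v y * visit w n y \<partial>N)"
    unfolding integral_restrict_space[OF iY] u_def
    by (intro Bochner_Integration.integral_cong) (auto simp: indicator_def visit_def)
  finally show "(\<integral>y. T_fun L Y n v y * w y \<partial>N) = (\<integral>y. v y * visit w n y \<partial>N)" .
qed

end

text \<open>Test with the sign of the difference.\<close>

lemma AE_eq_of_bounded_duality:
  fixes g h :: "'a \<Rightarrow> real"
  assumes g: "integrable N g" and h: "integrable N h"
    and eq: "\<And>w. w \<in> borel_measurable N \<Longrightarrow> (\<And>y. \<bar>w y\<bar> \<le> 1) \<Longrightarrow> (\<integral>y. g y * w y \<partial>N) = (\<integral>y. h y * w y \<partial>N)"
  shows "AE y in N. g y = h y"
proof -
  define w where "w y = sgn (g y - h y)" for y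
  have gm: "g \<in> borel_measurable N" and hm: "h \<in> borel_measurable N" using g h by auto
  have w: "w \<in> borel_measurable N" unfolding w_def using gm hm by measurable
  have w1: "\<bar>w y\<bar> \<le> 1" for y by (simp add: w_def sgn_real_def)
  have bi: "integrable N (\<lambda>y. k y * w y)" if k: "integrable N k" for k
  proof (rule Bochner_Integration.integrable_bound[OF k])
    show "(\<lambda>y. k y * w y) \<in> borel_measurable N" using k w by (intro borel_measurable_times) auto
    show "AE y in N. norm (k y * w y) \<le> norm (k y)"
      using w1 by (intro AE_I2) (auto simp: abs_mult intro!: mult_left_le)
  qed
  have "(\<integral>y. \<bar>g y - h y\<bar> \<partial>N) = (\<integral>y. g y * w y - h y * w y \<partial>N)"
    by (intro Bochner_Integration.integral_cong) (auto simp: w_def sgn_real_def)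
  also have "\<dots> = 0" using Bochner_Integration.integral_diff[OF bi[OF g] bi[OF h]] eq[OF w w1] by simp
  finally have "(\<integral>y. \<bar>g y - h y\<bar> \<partial>N) = 0" .
  moreover have "integrable N (\<lambda>y. \<bar>g y - h y\<bar>)" using g h by (intro integrable_abs Bochner_Integration.integrable_diff)
  ultimately have "AE y in N. \<bar>g y - h y\<bar> = 0"
    by (subst integral_nonneg_eq_0_iff_AE[symmetric]) auto
  then show ?thesis by (rule AE_mp) auto
qed

context return_system
begin

lemma Linfty_measurable: "Linfty_subspace N e \<Longrightarrow> e v \<in> borel_measurable N"
  by (simp add: Linfty_subspace_def)

lemma Linfty_AE_bound:
  assumes "Linfty_subspace N e" shows "AE y in N. \<bar>e v y\<bar> \<le> norm v"
proof -
  have "esssup N (\<lambda>y. ereal \<bar>e v y\<bar>) \<le> ereal (norm v)" using assms by (simp add: Linfty_subspace_def)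
  with esssup_AE[of "\<lambda>y. ereal \<bar>e v y\<bar>" N] show ?thesis
    by (auto elim!: eventually_mono dest: order_trans)
qed

lemma Linfty_integrable:
  assumes "Linfty_subspace N e" shows "integrable N (e v)"
  by (rule N.integrable_const_bound[of _ "norm v"])
     (use Linfty_AE_bound[OF assms] Linfty_measurable[OF assms] in auto)

definition pairing :: "('b::banach \<Rightarrow> 'a \<Rightarrow> real) \<Rightarrow> ('a \<Rightarrow> real) \<Rightarrow> 'b \<Rightarrow> real" where
  "pairing e w v = (\<integral>y. e v y * w y \<partial>N)"

lemma integrable_pairing:
  assumes e: "Linfty_subspace N e" and w: "w \<in> borel_measurable N" and K: "\<And>y. y \<in> Y \<Longrightarrow> \<bar>w y\<bar> \<le> K"
  shows "integrable N (\<lambda>y. e v y * w y)"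
proof (rule Bochner_Integration.integrable_bound[OF integrable_mult_right[OF Linfty_integrable[OF e], of K v]])
  show "(\<lambda>y. e v y * w y) \<in> borel_measurable N"
    using Linfty_measurable[OF e] w by (intro borel_measurable_times)
  show "AE y in N. norm (e v y * w y) \<le> norm (K * e v y)"
  proof (rule AE_I2)
    fix y assume "y \<in> space N"
    then have "\<bar>w y\<bar> \<le> \<bar>K\<bar>" using K[of y] by simp
    then show "norm (e v y * w y) \<le> norm (K * e v y)"
      using mult_left_mono[of "\<bar>w y\<bar>" "\<bar>K\<bar>" "\<bar>e v y\<bar>"] by (simp add: abs_mult mult.commute)
  qed
qed

lemma pairing_bound:
  assumes e: "Linfty_subspace N e" and w: "w \<in> borel_measurable N" and K: "\<And>y. y \<in> Y \<Longrightarrow> \<bar>w y\<bar> \<le> K"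
  shows "\<bar>pairing e w v\<bar> \<le> K * norm v"
proof -
  have "\<bar>pairing e w v\<bar> \<le> (\<integral>y. \<bar>e v y * w y\<bar> \<partial>N)"
    unfolding pairing_def by (rule integral_abs_bound)
  also have "\<dots> \<le> (\<integral>y. K * norm v \<partial>N)"
  proof (rule integral_mono_AE)
    show "integrable N (\<lambda>y. \<bar>e v y * w y\<bar>)" by (intro integrable_abs integrable_pairing[OF e w K])
    show "AE y in N. \<bar>e v y * w y\<bar> \<le> K * norm v"
      using Linfty_AE_bound[OF e, of v] AE_space
    proof eventually_elim
      case (elim y)
      then have "\<bar>w y\<bar> \<le> K" using K[of y] by simp
      then have "\<bar>w y\<bar> * \<bar>e v y\<bar> \<le> K * norm v" using elim(1) by (intro mult_mono) auto
      then show ?case by (simp add: abs_mult mult.commute)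
    qed
  qed simp
  also have "\<dots> = K * norm v" using N.prob_space by simp
  finally show ?thesis .
qed

lemma bounded_linear_pairing:
  assumes e: "Linfty_subspace N e" and w: "w \<in> borel_measurable N" and K: "\<And>y. y \<in> Y \<Longrightarrow> \<bar>w y\<bar> \<le> K"
  shows "bounded_linear (pairing e w)"
proof (rule bounded_linear_intro[where K = K])
  note i = integrable_pairing[OF e w K]
  fix u v :: 'b and a :: real
  have "AE y in N. e (u + v) y = e u y + e v y" using e by (simp add: Linfty_subspace_def)
  then have "AE y in N. e (u + v) y * w y = e u y * w y + e v y * w y"
    by (auto simp: distrib_right elim!: eventually_mono)
  then have "pairing e w (u + v) = (\<integral>y. e u y * w y + e v y * w y \<partial>N)"
    unfolding pairing_def by (rule integral_cong_AE[rotated 2]) (use i in auto)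
  also have "\<dots> = pairing e w u + pairing e w v" unfolding pairing_def by (rule Bochner_Integration.integral_add[OF i i])
  finally show "pairing e w (u + v) = pairing e w u + pairing e w v" .
  have "AE y in N. e (a *\<^sub>R v) y = a * e v y" using e by (simp add: Linfty_subspace_def)
  then have "AE y in N. e (a *\<^sub>R v) y * w y = a * (e v y * w y)"
    by (auto elim!: eventually_mono)
  then have "pairing e w (a *\<^sub>R v) = (\<integral>y. a * (e v y * w y) \<partial>N)"
    unfolding pairing_def by (rule integral_cong_AE[rotated 2]) (use i in auto)
  then show "pairing e w (a *\<^sub>R v) = a *\<^sub>R pairing e w v" by (simp add: pairing_def)
  show "norm (pairing e w v) \<le> norm v * K"
    using pairing_bound[OF e w K, of v] by (simp add: mult.commute)
qed

lemma pairing_renewal: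
  assumes e: "Linfty_subspace N e" and R: "transfer_operator N (return_map f Y) R"
    and Rn: "\<And>n. n \<ge> 1 \<Longrightarrow> realizes N e (Rn n) (R_fun R \<phi> n)" and n: "n \<ge> 1"
    and w: "w \<in> borel_measurable N" and K: "\<And>y. y \<in> Y \<Longrightarrow> \<bar>w y\<bar> \<le> K" "K \<ge> 0"
  shows "pairing e (visit w n) v = (\<Sum>j<n. pairing e (visit w (n - Suc j)) (Rn (Suc j) v))"
proof -
  have "pairing e (visit w n) v = (\<Sum>j<n. \<integral>y. R_fun R \<phi> (Suc j) (e v) y * visit w (n - Suc j) y \<partial>N)"
    unfolding pairing_def by (rule visit_renewal[OF R n Linfty_integrable[OF e] w K])
  also have "\<dots> = (\<Sum>j<n. pairing e (visit w (n - Suc j)) (Rn (Suc j) v))"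
  proof (rule sum.cong)
    fix j assume "j \<in> {..<n}"
    have RI: "integrable N (R_fun R \<phi> (Suc j) (e v))"
      using R integrable_return_piece[OF Linfty_integrable[OF e, of v], of "Suc j"]
      unfolding transfer_operator_def R_fun_def by blast
    have "AE y in N. e (Rn (Suc j) v) y = R_fun R \<phi> (Suc j) (e v) y"
      using Rn[of "Suc j"] by (simp add: realizes_def)
    then have "AE y in N. R_fun R \<phi> (Suc j) (e v) y * visit w (n - Suc j) y = e (Rn (Suc j) v) y * visit w (n - Suc j) y"
      by (auto elim!: eventually_mono)
    then show "(\<integral>y. R_fun R \<phi> (Suc j) (e v) y * visit w (n - Suc j) y \<partial>N) = pairing e (visit w (n - Suc j)) (Rn (Suc j) v)"
      unfolding pairing_def
      by (rule integral_cong_AE[rotated 2])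
         (use RI visit_measurable[OF w] Linfty_measurable[OF e] in \<open>auto intro!: borel_measurable_times\<close>)
  qed simp
  finally show ?thesis .
qed

lemma realizes_T_fun:
  fixes T :: "'b::banach \<Rightarrow>\<^sub>L 'b"
  assumes e: "Linfty_subspace N e" and L: "transfer_operator M f L"
    and T: "\<And>w v. w \<in> borel_measurable N \<Longrightarrow> (\<And>y. \<bar>w y\<bar> \<le> 1) \<Longrightarrow>
       pairing e (visit w 0) (T v) = pairing e (visit w n) v"
  shows "realizes N e T (T_fun L Y n)"
  unfolding realizes_def
proof
  fix v
  show "AE y in N. e (T v) y = T_fun L Y n (e v) y"
  proof (rule AE_eq_of_bounded_duality)
    show "integrable N (e (T v))" by (rule Linfty_integrable[OF e])
    show "integrable N (T_fun L Y n (e v))" by (rule T_fun_duality(1)[OF L Linfty_integrable[OF e]])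
    fix w :: "'a \<Rightarrow> real" assume w: "w \<in> borel_measurable N" "\<And>y. \<bar>w y\<bar> \<le> 1"
    have "(\<integral>y. e (T v) y * w y \<partial>N) = pairing e (visit w 0) (T v)"
      unfolding pairing_def by (intro Bochner_Integration.integral_cong) (auto simp: visit_def)
    also have "\<dots> = (\<integral>y. T_fun L Y n (e v) y * w y \<partial>N)"
      unfolding T[OF w] unfolding pairing_def
      by (rule T_fun_duality(2)[OF L Linfty_integrable[OF e] w(1), of 1, symmetric]) (use w(2) in auto)
    finally show "(\<integral>y. e (T v) y * w y \<partial>N) = (\<integral>y. T_fun L Y n (e v) y * w y \<partial>N)" .
  qed
qed

end

section \<open>First and second order mixing\<close>

theorem theorem9p1:
  fixes M :: "'a measure" and f :: "'a \<Rightarrow> 'a" and Y :: "'a set"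
    and L R :: "('a \<Rightarrow> real) \<Rightarrow> ('a \<Rightarrow> real)"
    and e :: "'b::banach \<Rightarrow> 'a \<Rightarrow> real"
    and Rn :: "nat \<Rightarrow> 'b \<Rightarrow>\<^sub>L 'b" and P :: "'b \<Rightarrow>\<^sub>L 'b"
    and c \<beta> \<gamma> :: real and H :: "nat \<Rightarrow> real"
    and \<phi> :: "'a \<Rightarrow> nat" and N :: "'a measure"
  defines "\<phi> \<equiv> return_time f Y"
    and "N \<equiv> restrict_space M Y"
    and "\<gamma> \<equiv> min (1 - \<beta>) (\<beta> - 1 / 2)"
  assumes infinite_measure: "emeasure M (space M) = \<infinity>"
    and f_mp: "measure_preserving_map M f"
    and f_cons: "conservative M f"
    and Y: "Y \<in> sets M" "emeasure M Y = 1"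
    and L: "transfer_operator M f L"
    and R: "transfer_operator N (return_map f Y) R"
    and B: "Linfty_subspace N e"
    and H1_op: "\<And>n. n \<ge> 1 \<Longrightarrow> realizes N e (Rn n) (R_fun R \<phi> n)"
    and H1_bound: "\<exists>C>0. \<forall>n\<ge>1. norm (Rn n) \<le> C * measure M {y \<in> Y. \<phi> y = n}"
    and H2_i: "simple_eigenvalue (R_gen Rn 1) 1" "1 isolated_in op_spectrum (R_gen Rn 1)"
    and H2_ii: "\<And>z. cmod z \<le> 1 \<Longrightarrow> z \<noteq> 1 \<Longrightarrow> 1 \<notin> op_spectrum (R_gen Rn z)"
    and P_spectral: "spectral_projection (R_gen Rn 1) 1 (complexify P)"
    and P_integral: "realizes N e P (\<lambda>v y. \<integral>x. v x \<partial>N)"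
    and \<beta>: "1 / 2 < \<beta>" "\<beta> < 1"
    and c: "c > 0"
    and tail: "\<And>n. n \<ge> 1 \<Longrightarrow> measure M {y \<in> Y. \<phi> y > n} = c * (real n powr - \<beta> + H n)"
    and H: "H \<in> O(\<lambda>n. real n powr (- 2 * \<beta>))"
  shows "\<exists>T :: nat \<Rightarrow> 'b \<Rightarrow>\<^sub>L 'b.
      (\<forall>n. realizes N e (T n) (T_fun L Y n)) \<and>
      (\<lambda>n. norm (real n powr (1 - \<beta>) *\<^sub>R T n - (d_const \<beta> / c) *\<^sub>R P)) \<in> O(\<lambda>n. real n powr - \<gamma>) \<and>
      (3 / 4 < \<beta> \<longrightarrow>
        (\<lambda>n. real n powr (1 - \<beta>) *\<^sub>R (real n powr (1 - \<beta>) *\<^sub>R T n - (d_const \<beta> / c) *\<^sub>R P))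
          \<longlonglongrightarrow> (d1_const M Y \<phi> c \<beta> / c) *\<^sub>R P)"
proof -
  interpret S: return_system M f Y by unfold_locales (rule f_mp f_cons Y)+
  note B = B[unfolded N_def] and R = R[unfolded N_def] and H1_op = H1_op[unfolded N_def \<phi>_def]
    and P_integral = P_integral[unfolded N_def]
  have tail': "S.t n = c * (real n powr - \<beta> + H n)" if "n \<ge> 1" for n
    using tail[OF that] by (simp add: S.t_def \<phi>_def)
  obtain C where C: "C > 0" "\<And>n. n \<ge> 1 \<Longrightarrow> norm (Rn n) \<le> C * measure M {y \<in> Y. \<phi> y = n}"
    using H1_bound by blast
  have normR: "norm (Rn (Suc n)) \<le> C * (S.t n - S.t (Suc n))" for n
    using C(2)[of "Suc n"] unfolding \<phi>_def S.t_diff by simp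
  have tmono: "S.t (Suc n) \<le> S.t n" for n
    using S.t_diff[of n] measure_nonneg[of M "{y \<in> Y. return_time f Y y = Suc n}"] by linarith
  interpret Q: renewal_sequence Rn S.t H c \<beta> C
    by unfold_locales (use \<beta> c C(1) tmono S.t_0 tail' H normR in auto)
  define \<nu>0 where "\<nu>0 = S.pairing e (\<lambda>_. 1)"
  have bl\<nu>: "bounded_linear \<nu>0"
    unfolding \<nu>0_def by (rule S.bounded_linear_pairing[OF B, where K = 1]) auto
  define \<nu> where "\<nu> = Blinfun \<nu>0"
  have \<nu>_app: "\<nu> v = (\<integral>y. e v y \<partial>S.N)" for v
    unfolding \<nu>_def bounded_linear_Blinfun_apply[OF bl\<nu>] by (simp add: \<nu>0_def S.pairing_def)
  obtain unit where unit: "AE y in S.N. e unit y = 1"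
    using B unfolding Linfty_subspace_def by blast
  note em = S.Linfty_measurable[OF B]
  have \<nu>_unit: "\<nu> unit = 1"
  proof -
    have "\<nu> unit = (\<integral>y. 1 \<partial>S.N)"
      unfolding \<nu>_app by (rule integral_cong_AE[rotated 2, OF unit]) (use em in auto)
    then show ?thesis using S.N.prob_space by simp
  qed
  have P_eq: "P v = \<nu> v *\<^sub>R unit" for v
  proof -
    have "AE y in S.N. e (P v) y = \<nu> v" using P_integral by (simp add: realizes_def \<nu>_app)
    moreover have "AE y in S.N. e (\<nu> v *\<^sub>R unit) y = \<nu> v * e unit y" using B by (simp add: Linfty_subspace_def)
    ultimately have "AE y in S.N. e (P v) y = e (\<nu> v *\<^sub>R unit) y"
      using unit by eventually_elim simp
    then show ?thesis using B unfolding Linfty_subspace_def by blast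
  qed
  obtain D0 where D0: "R_gen Rn 1 (unit, 0) = (unit, 0)"
    "\<And>x. complexify P (R_gen Rn 1 x) = complexify P x"
    "inverse_op (id_blinfun - R_gen Rn 1 + complexify P) D0"
    by (rule Q.spectral_consequences[OF H2_i(1) P_spectral P_eq \<nu>_unit blinfun.bounded_linear_right]) blast
  have \<nu>_R: "\<nu> (Rn (Suc n) unit) = S.t n - S.t (Suc n)" for n
  proof -
    let ?A = "{y. return_time f Y y = Suc n}"
    let ?p = "\<lambda>y. indicator ?A y * e unit y"
    have p: "integrable S.N ?p" by (rule S.integrable_return_piece[OF S.Linfty_integrable[OF B]])
    have bd: "bounded ((\<lambda>_. 1 :: real) ` space S.N)"
      by (rule boundedI[of _ 1]) auto
    have Rp: "integrable S.N (R ?p)" and dual: "(\<integral>y. R ?p y * 1 \<partial>S.N) = (\<integral>y. ?p y * 1 \<partial>S.N)"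
      using R p bd borel_measurable_const[of "1 :: real" S.N] unfolding transfer_operator_def by blast+
    have "\<nu> (Rn (Suc n) unit) = (\<integral>y. R ?p y \<partial>S.N)"
      unfolding \<nu>_app
    proof (rule integral_cong_AE)
      show "AE y in S.N. e (Rn (Suc n) unit) y = R ?p y"
        using H1_op[of "Suc n"] by (simp add: realizes_def R_fun_def)
    qed (use em Rp in auto)
    also have "\<dots> = (\<integral>y. indicator ?A y \<partial>S.N)"
    proof -
      have "(\<integral>y. ?p y \<partial>S.N) = (\<integral>y. indicator ?A y \<partial>S.N)"
      proof (rule integral_cong_AE)
        have "?A \<inter> space S.N \<in> sets S.N"
          using S.return_time_eq_sets[of "Suc n"] Y(1)
          by (subst sets_restrict_space_iff) (auto simp: Int_def conj_commute)
        then show "(indicator ?A :: 'a \<Rightarrow> real) \<in> borel_measurable S.N"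
          by (rule iffD2[OF borel_measurable_indicator_iff])
        show "AE y in S.N. ?p y = indicator ?A y" using unit by eventually_elim simp
      qed (use p in auto)
      then show ?thesis using dual by simp
    qed
    also have "\<dots> = measure S.N (?A \<inter> space S.N)" by simp
    also have "?A \<inter> space S.N = {y \<in> Y. return_time f Y y = Suc n}" by auto
    also have "measure S.N \<dots> = S.t n - S.t (Suc n)"
      using S.measure_N[OF S.return_time_eq_sets] S.t_diff by auto
    finally show ?thesis .
  qed
  interpret Q: renewal_operators Rn S.t H c \<beta> C P unit \<nu> D0
    by unfold_locales (use P_eq \<nu>_unit \<nu>_R D0 H2_ii in auto)
  have real: "realizes S.N e (Q.T_op n) (T_fun L Y n)" for n
  proof (rule S.realizes_T_fun[OF B L])
    fix w :: "'a \<Rightarrow> real" and v assume w: "w \<in> borel_measurable S.N" "\<And>y. \<bar>w y\<bar> \<le> 1"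
    have vb: "\<bar>S.visit w k y\<bar> \<le> 1" for k y using S.visit_bounded[of w 1 k y] w(2) by simp
    show "S.pairing e (S.visit w 0) (Q.T_op n v) = S.pairing e (S.visit w n) v"
    proof (rule Q.T_op_functional[where \<alpha> = "\<lambda>k. S.pairing e (S.visit w k)" and A = 1])
      show "bounded_linear (S.pairing e (S.visit w k))" for k
        by (rule S.bounded_linear_pairing[OF B S.visit_measurable[OF w(1)] vb])
      show "\<bar>S.pairing e (S.visit w k) u\<bar> \<le> 1 * norm u" for k u
        by (rule S.pairing_bound[OF B S.visit_measurable[OF w(1)] vb])
      show "S.pairing e (S.visit w k) u = (\<Sum>j<k. S.pairing e (S.visit w (k - Suc j)) (Rn (Suc j) u))"
        if "k \<ge> 1" for k u
        by (rule S.pairing_renewal[OF B R H1_op that w(1), where K = 1]) (use w(2) in auto)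
    qed
  qed
  have cH: "cH_const M Y \<phi> c \<beta> = suminf (tail_defect S.t c \<beta>)"
  proof -
    have "((\<lambda>x. (1 / c) * S.t (nat \<lfloor>x\<rfloor>) - x powr - \<beta>) has_integral suminf (tail_defect S.t c \<beta>)) {0<..}"
      by (rule cH_eq_suminf[OF \<beta> c tail' H Q.tail_limit])
    then have "(H1_fun M Y \<phi> c \<beta> has_integral suminf (tail_defect S.t c \<beta>)) {0<..}"
      by (rule has_integral_eq[rotated]) (simp add: \<phi>_def S.H1_fun_eq)
    then show ?thesis unfolding cH_const_def by (rule integral_unique)
  qed
  have d1: "- Q.\<theta> / Q.b0 * rGamma (2 * \<beta> - 1) = d1_const M Y \<phi> c \<beta> / c"
    unfolding d1_const_eq[OF \<beta>] cH Q.\<theta>_def Q.b0_def by (simp add: power2_eq_square)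
  show ?thesis
    using real Q.T_op_first_order Q.T_op_second_order unfolding d1 N_def \<gamma>_def
    by (intro exI[of _ Q.T_op]) auto
qed

end
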